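(* Let $\mathbf{T}=(T_1,\dots,T_d)$ be a commuting $d$-tuple of bounded operators on $\mathcal{H}$, and let $0<t\le 1$. Then $\sigma_{Te}(\Delta_t(\mathbf{T}))=\sigma_{Te}(\mathbf{T})$. Moreover, $\operatorname{index}(\Delta_t(\mathbf{T})-\boldsymbol{\lambda})=\operatorname{index}(\mathbf{T}-\boldsymbol{\lambda})$ for all $\boldsymbol{\lambda}\in\mathbb{C}^d\setminus\sigma_{Te}(\mathbf{T})$.
   Context: $\mathcal{H}$ is a complex infinite-dimensional Hilbert space. For a commuting $d$-tuple $\mathbf{T}=(T_1,\dots,T_d)$ of bounded operators on $\mathcal{H}$, put $P:=\sqrt{T_1^*T_1+\cdots+T_d^*T_d}$ and let $T_i=V_iP$ $(i=1,\dots,d)$ be the canonical (spherical) polar decomposition: the column $(V_1,\dots,V_d)^{\mathsf T}:\mathcal{H}\to\mathcal{H}\oplus\cdots\oplus\mathcal{H}$ is the partial isometry in the polar decomposition of the column operator $(T_1,\dots,T_d)^{\mathsf T}$, so that $\bigcap_i\ker T_i=\bigcap_i\ker V_i=\ker P$. For $0\le t\le 1$ the generalized spherical Aluthge transform is $\Delta_t(\mathbf{T}):=(P^tV_1P^{1-t},\dots,P^tV_dP^{1-t})$, with the convention $P^0=I$; it is again a commuting $d$-tuple. Koszul complex $K(\mathbf{T},\mathcal{H})$: the cochain complex $0\to\mathcal{H}\otimes\Lambda^0\to\mathcal{H}\otimes\Lambda^1\to\cdots\to\mathcal{H}\otimes\Lambda^d\to 0$, where $\Lambda^k$ is the $k$-th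 exterior power of $\mathbb{C}^d$ with basis vectors $e_1,\dots,e_d$, and boundary maps $D^k_{\mathbf{T}}(x\otimes\xi)=\sum_{i=1}^d T_ix\otimes(e_i\wedge\xi)$. For $\boldsymbol{\lambda}\in\mathbb{C}^d$, $\mathbf{T}-\boldsymbol{\lambda}:=(T_1-\lambda_1,\dots,T_d-\lambda_d)$. $\mathbf{T}$ is Fredholm if all the (co)homology quotients $H^k$ $(k=0,\dots,d)$ of $K(\mathbf{T},\mathcal{H})$ are finite-dimensional; in that case $\operatorname{index}(\mathbf{T})$ is the Euler characteristic $\sum_{k=0}^d(-1)^k\dim H^k$. The Taylor essential spectrum is $\sigma_{Te}(\mathbf{T}):=\{\boldsymbol{\lambda}\in\mathbb{C}^d:\mathbf{T}-\boldsymbol{\lambda}\text{ is not Fredholm}\}$. *)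

theory Defs
  imports "HOL-Analysis.Analysis" "HOL-Computational_Algebra.Polynomial"
begin

section \<open>Complex Hilbert spaces\<close>

class complex_vector = real_vector +
  fixes scaleC :: "complex \<Rightarrow> 'a \<Rightarrow> 'a" (infixr "*\<^sub>C" 75)
  assumes scaleC_add_right: "a *\<^sub>C (x + y) = a *\<^sub>C x + a *\<^sub>C y"
    and scaleC_add_left: "(a + b) *\<^sub>C x = a *\<^sub>C x + b *\<^sub>C x"
    and scaleC_scaleC: "a *\<^sub>C b *\<^sub>C x = (a * b) *\<^sub>C x"
    and scaleC_one: "1 *\<^sub>C x = x"
    and scaleR_scaleC: "r *\<^sub>R x = complex_of_real r *\<^sub>C x"

global_interpretation cvs: vector_space "scaleC :: complex \<Rightarrow> 'a \<Rightarrow> 'a :: complex_vector"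
  by unfold_locales
    (rule scaleC_add_right scaleC_add_left scaleC_scaleC scaleC_one)+

text \<open>A complex inner product space carries the real inner product \<open>Re \<langle>x, y\<rangle>\<close>; building the
  class on top of \<^class>\<open>real_inner\<close> makes the norm \<open>sqrt \<langle>x, x\<rangle>\<close>, its metric and its topology the
  library ones. The form \<open>cinner\<close> is linear in its first argument; its positivity is that
  of \<open>inner\<close>.\<close>

class complex_inner = complex_vector + real_inner +
  fixes cinner :: "'a \<Rightarrow> 'a \<Rightarrow> complex"
  assumes cinner_commute: "cinner x y = cnj (cinner y x)"
    and cinner_add_left: "cinner (x + y) z = cinner x z + cinner y z"
    and cinner_scaleC_left: "cinner (a *\<^sub>C x) y = a * cinner x y"
    and inner_eq_Re_cinner: "inner x y = Re (cinner x y)"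

class chilbert_space = complex_inner + complete_space

text \<open>\<open>'h ^ 'n\<close> is the direct sum of copies of \<open>'h\<close>, one for each element of \<open>'n\<close>; the norm
  the library puts on it is the Hilbert space norm.\<close>

instantiation vec :: (complex_vector, finite) complex_vector
begin

definition scaleC_vec :: "complex \<Rightarrow> 'a ^ 'b \<Rightarrow> 'a ^ 'b"
  where "c *\<^sub>C x = (\<chi> i. c *\<^sub>C (x $ i))"

instance
  by standard
    (simp_all add: scaleC_vec_def vec_eq_iff scaleC_add_right scaleC_add_left scaleC_scaleC
      scaleC_one scaleR_scaleC)

end

section \<open>Bounded operators\<close>

definition bounded_clinear ::
  "('a::{complex_vector, real_normed_vector} \<Rightarrow> 'b::{complex_vector, real_normed_vector}) \<Rightarrow> bool"
  where "bounded_clinear A \<longleftrightarrow> bounded_linear A \<and> (\<forall>c x. A (c *\<^sub>C x) = c *\<^sub>C A x)"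

definition cadjoint :: "('h::chilbert_space \<Rightarrow> 'h) \<Rightarrow> 'h \<Rightarrow> 'h"
  where "cadjoint A = (THE B. \<forall>x y. cinner (A x) y = cinner x (B y))"

definition partial_isometry ::
  "('a::complex_inner \<Rightarrow> 'b::{complex_vector, real_normed_vector}) \<Rightarrow> bool"
  where "partial_isometry W \<longleftrightarrow> bounded_clinear W \<and>
    (\<forall>x. (\<forall>y. W y = 0 \<longrightarrow> cinner x y = 0) \<longrightarrow> norm (W x) = norm x)"

definition spectrum :: "('h::chilbert_space \<Rightarrow> 'h) \<Rightarrow> complex set"
  where "spectrum A = {z. \<not> (\<exists>B. bounded_clinear B \<and>
    (\<forall>x. B (A x - z *\<^sub>C x) = x) \<and> (\<forall>x. A (B x) - z *\<^sub>C B x = x))}"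

definition poly_op :: "real poly \<Rightarrow> ('h::chilbert_space \<Rightarrow> 'h) \<Rightarrow> 'h \<Rightarrow> 'h"
  where "poly_op p A x = (\<Sum>k\<le>degree p. coeff p k *\<^sub>R (A ^^ k) x)"

text \<open>The continuous functional calculus of a self-adjoint operator \<open>A\<close>: \<open>f(A)\<close> is the
  operator norm limit of \<open>p\<^sub>n(A)\<close> whenever the polynomials \<open>p\<^sub>n\<close> tend to \<open>f\<close> uniformly
  on the spectrum of \<open>A\<close>, which is real.\<close>

definition cfc :: "(real \<Rightarrow> real) \<Rightarrow> ('h::chilbert_space \<Rightarrow> 'h) \<Rightarrow> 'h \<Rightarrow> 'h"
  where "cfc f A = (THE B. bounded_clinear B \<and>
    (\<forall>p. uniform_limit {r. complex_of_real r \<in> spectrum A} (\<lambda>n. poly (p n)) f sequentially \<longrightarrow>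
      (\<lambda>n. onorm (\<lambda>x. poly_op (p n) A x - B x)) \<longlonglongrightarrow> 0))"

text \<open>The case split is the convention \<open>A\<^sup>0 = I\<close>, also for non-injective \<open>A\<close>
  (in the library, \<open>0 powr 0 = 0\<close>).\<close>

definition op_powr :: "('h::chilbert_space \<Rightarrow> 'h) \<Rightarrow> real \<Rightarrow> 'h \<Rightarrow> 'h"
  where "op_powr A t = (if t = 0 then id else cfc (\<lambda>r. r powr t) A)"

section \<open>The generalized spherical Aluthge transform\<close>

definition commuting_tuple :: "('d \<Rightarrow> 'h::chilbert_space \<Rightarrow> 'h) \<Rightarrow> bool"
  where "commuting_tuple T \<longleftrightarrow>
    (\<forall>i. bounded_clinear (T i)) \<and> (\<forall>i j. T i \<circ> T j = T j \<circ> T i)"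

definition column_op :: "('d::finite \<Rightarrow> 'h::chilbert_space \<Rightarrow> 'h) \<Rightarrow> 'h \<Rightarrow> 'h ^ 'd"
  where "column_op T x = (\<chi> i. T i x)"

definition spherical_modulus :: "('d::finite \<Rightarrow> 'h::chilbert_space \<Rightarrow> 'h) \<Rightarrow> 'h \<Rightarrow> 'h"
  where "spherical_modulus T = cfc sqrt (\<lambda>x. \<Sum>i\<in>UNIV. cadjoint (T i) (T i x))"

definition polar_part ::
  "('d::finite \<Rightarrow> 'h::chilbert_space \<Rightarrow> 'h) \<Rightarrow> 'd \<Rightarrow> 'h \<Rightarrow> 'h"
  where "polar_part T = (THE V. partial_isometry (column_op V) \<and>
    (\<forall>i. T i = V i \<circ> spherical_modulus T) \<and>
    {x. column_op V x = 0} = {x. spherical_modulus T x = 0})"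

definition aluthge ::
  "real \<Rightarrow> ('d::finite \<Rightarrow> 'h::chilbert_space \<Rightarrow> 'h) \<Rightarrow> 'd \<Rightarrow> 'h \<Rightarrow> 'h"
  where "aluthge t T i = op_powr (spherical_modulus T) t \<circ> polar_part T i \<circ>
    op_powr (spherical_modulus T) (1 - t)"

section \<open>The Koszul complex, Fredholm tuples and the index\<close>

text \<open>The tensor product of \<open>'h\<close> with the exterior algebra of \<open>\<complex>\<^sup>d\<close> is \<open>'h ^ 'd set\<close>: the
  component at \<open>I = {i\<^sub>1 < \<dots> < i\<^sub>k}\<close> is the coefficient of \<open>e\<^sub>I = e\<^bsub>i\<^sub>1\<^esub> \<and> \<dots> \<and> e\<^bsub>i\<^sub>k\<^esub>\<close>.\<close>

definition koszul_chains :: "nat \<Rightarrow> ('h::complex_vector ^ ('d::finite) set) set"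
  where "koszul_chains k = {x. \<forall>I. card I \<noteq> k \<longrightarrow> x $ I = 0}"

text \<open>The map \<open>x \<otimes> \<xi> \<mapsto> x \<otimes> (e\<^sub>i \<and> \<xi>)\<close>; note that \<open>e\<^sub>i \<and> e\<^sub>I\<close> is \<open>0\<close> if \<open>i \<in> I\<close>, and otherwise
  \<open>e\<^bsub>I \<union> {i}\<^esub>\<close> with the sign \<open>(-1) ^ card {j \<in> I. j < i}\<close>.\<close>

definition wedge ::
  "'d::{finite,linorder} \<Rightarrow> 'h::complex_vector ^ 'd set \<Rightarrow> 'h ^ 'd set"
  where "wedge i x =
    (\<chi> J. if i \<in> J then (-1) ^ card {j \<in> J - {i}. j < i} *\<^sub>C (x $ (J - {i})) else 0)"

definition koszul_map ::
  "('d::{finite,linorder} \<Rightarrow> 'h::complex_vector \<Rightarrow> 'h) \<Rightarrow> 'h ^ 'd set \<Rightarrow> 'h ^ 'd set"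
  where "koszul_map T x = (\<Sum>i\<in>UNIV. wedge i (\<chi> I. T i (x $ I)))"

definition cocycles ::
  "('d::{finite,linorder} \<Rightarrow> 'h::complex_vector \<Rightarrow> 'h) \<Rightarrow> nat \<Rightarrow> ('h ^ 'd set) set"
  where "cocycles T k = {x \<in> koszul_chains k. koszul_map T x = 0}"

definition coboundaries ::
  "('d::{finite,linorder} \<Rightarrow> 'h::complex_vector \<Rightarrow> 'h) \<Rightarrow> nat \<Rightarrow> ('h ^ 'd set) set"
  where "coboundaries T k = (if k = 0 then {0} else koszul_map T ` koszul_chains (k - 1))"

text \<open>\<open>S\<close> represents a finite basis of the quotient space \<open>Z / B\<close>: the cosets \<open>s + B\<close>, \<open>s \<in> S\<close>,
  are linearly independent (in particular pairwise distinct) and span \<open>Z / B\<close>.\<close>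

definition quotient_basis :: "'a::complex_vector set \<Rightarrow> 'a set \<Rightarrow> 'a set \<Rightarrow> bool"
  where "quotient_basis Z B S \<longleftrightarrow> finite S \<and> S \<subseteq> Z \<and>
    (\<forall>c. (\<Sum>s\<in>S. c s *\<^sub>C s) \<in> B \<longrightarrow> (\<forall>s\<in>S. c s = 0)) \<and>
    (\<forall>z\<in>Z. \<exists>c. z - (\<Sum>s\<in>S. c s *\<^sub>C s) \<in> B)"

definition quotient_finite_dim :: "'a::complex_vector set \<Rightarrow> 'a set \<Rightarrow> bool"
  where "quotient_finite_dim Z B \<longleftrightarrow> (\<exists>S. quotient_basis Z B S)"

definition quotient_dim :: "'a::complex_vector set \<Rightarrow> 'a set \<Rightarrow> nat"
  where "quotient_dim Z B = card (SOME S. quotient_basis Z B S)"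

definition fredholm_tuple ::
  "('d::{finite,linorder} \<Rightarrow> 'h::complex_vector \<Rightarrow> 'h) \<Rightarrow> bool"
  where "fredholm_tuple T \<longleftrightarrow>
    (\<forall>k\<le>CARD('d). quotient_finite_dim (cocycles T k) (coboundaries T k))"

definition fredholm_index ::
  "('d::{finite,linorder} \<Rightarrow> 'h::complex_vector \<Rightarrow> 'h) \<Rightarrow> int"
  where "fredholm_index T =
    (\<Sum>k\<le>CARD('d). (-1) ^ k * int (quotient_dim (cocycles T k) (coboundaries T k)))"

definition shift_tuple ::
  "('d::finite \<Rightarrow> 'h::complex_vector \<Rightarrow> 'h) \<Rightarrow> complex ^ 'd \<Rightarrow> 'd \<Rightarrow> 'h \<Rightarrow> 'h"
  where "shift_tuple T l i x = T i x - (l $ i) *\<^sub>C x"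

definition taylor_essential_spectrum ::
  "('d::{finite,linorder} \<Rightarrow> 'h::complex_vector \<Rightarrow> 'h) \<Rightarrow> (complex ^ ('d::{finite,linorder})) set"
  where "taylor_essential_spectrum T = {l. \<not> fredholm_tuple (shift_tuple T l)}"

end

theory Submission
  imports Defs "HOL-Computational_Algebra.Fundamental_Theorem_Algebra"
begin

text \<open>Write \<open>A = P\<^sup>t\<close> and \<open>W\<^sub>i = V\<^sub>i P\<^bsup>1-t\<^esup>\<close>, so that \<open>T\<^sub>i = W\<^sub>i A\<close> and the Aluthge transform is \<open>A W\<^sub>i\<close>.
  Since \<open>T\<^sub>i V\<^sub>j = T\<^sub>j V\<^sub>i\<close> on the range of \<open>P\<close>, hence everywhere (the \<open>V\<^sub>i\<close> vanish on \<open>ker P\<close>), \<open>W\<^sub>i A W\<^sub>j = W\<^sub>j A W\<^sub>i\<close>; therefore \<open>A\<close> and each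
  \<open>W\<^sub>i\<close> induce chain maps between the Koszul complexes of \<open>T - \<lambda>\<close> and its transform. If \<open>\<lambda>\<^sub>i \<noteq> 0\<close>, then
  \<open>A\<close> and \<open>W\<^sub>i / \<lambda>\<^sub>i\<close> are inverse to each other on cohomology, because \<open>T\<^sub>i - \<lambda>\<^sub>i\<close> is null-homotopic.
  If \<open>\<lambda> = 0\<close>, Fredholmness of either tuple makes kernel and cokernel of \<open>A\<close> finite-dimensional. The
  chain map \<open>A\<close> then has kernel and cokernel of the form \<open>N \<otimes> \<Lambda>\<close> with \<open>N\<close> finite-dimensional; their Euler
  characteristics \<open>dim N \<cdot> \<Sum>\<^sub>k (-1)\<^sup>k (d choose k)\<close> vanish, so the index is unchanged.\<close>

section \<open>Complex inner product spaces\<close>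

text \<open>At the origin no variant of the homotopy argument can work: the composite
  \<open>W i \<circ> A\<close> is \<open>T i\<close>, which is itself null-homotopic, so
  \<open>A\<close> need not be an isomorphism on cohomology and only dimensions can be compared. The
  corank of \<open>A\<close> also has to be extracted differently from the two tuples. Coboundaries
  of the transform carry \<open>A\<close> on the left, so its top degree sees the corank at once.
  For \<open>T\<close> the factor \<open>A\<close> is on the right, and the ranges of the
  \<open>T i\<close> in top degree say nothing about that of \<open>A\<close>; the corank of
  \<open>P\<close> is found in low degrees instead. Ranges are not assumed closed: all quotients are
  algebraic, and long exact sequences are replaced by filtrations whose dimensions are counted in
  two ways. The analytic half is long because adjoint, functional calculus and polar part are
  definite descriptions, each of which needs existence and uniqueness before any property is
  available.\<close>

instance chilbert_space \<subseteq> banach ..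

lemma cinner_scaleC_right: "cinner x (a *\<^sub>C y) = cnj a * cinner x y" for x :: "'a::complex_inner"
  by (metis cinner_commute cinner_scaleC_left complex_cnj_mult)

lemma inner_ii: "inner (\<i> *\<^sub>C x) y = - Im (cinner x y)" for x :: "'a::complex_inner"
  by (simp add: inner_eq_Re_cinner cinner_scaleC_left)

text \<open>The imaginary part of \<open>cinner x y\<close> is, up to sign, the real inner product
  of \<open>\<i> *\<^sub>C x\<close> with \<open>y\<close>. Complex identities thus reduce to real
  ones, which is why nearly everything below is phrased with \<open>inner\<close>.\<close>

lemma cinner_eqI: "inner x y = inner u v \<Longrightarrow> inner (\<i> *\<^sub>C x) y = inner (\<i> *\<^sub>C u) v \<Longrightarrow> cinner x y = cinner u v"
  for x :: "'a::complex_inner"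
  by (simp add: complex_eq_iff inner_eq_Re_cinner cinner_scaleC_left)

lemma inner_scaleC_left: "inner (a *\<^sub>C x) y = inner x (cnj a *\<^sub>C y)" for x :: "'a::complex_inner"
  by (simp add: inner_eq_Re_cinner cinner_scaleC_left cinner_scaleC_right)

lemma norm_scaleC: "norm (a *\<^sub>C x) = cmod a * norm x" for x :: "'a::complex_inner"
proof -
  have "cnj a * a = complex_of_real ((cmod a)\<^sup>2)" using complex_norm_square[of a] by (simp add: mult.commute)
  then have "(norm (a *\<^sub>C x))\<^sup>2 = inner x (complex_of_real ((cmod a)\<^sup>2) *\<^sub>C x)"
    by (simp add: power2_norm_eq_inner inner_scaleC_left)
  also have "\<dots> = (cmod a * norm x)\<^sup>2"
    by (simp add: power2_norm_eq_inner power_mult_distrib flip: scaleR_scaleC)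
  finally show ?thesis by (simp add: power2_eq_iff_nonneg)
qed

lemma bounded_clinear_bounded_linear: "bounded_clinear A \<Longrightarrow> bounded_linear A"
  and bounded_clinear_scale: "bounded_clinear A \<Longrightarrow> A (c *\<^sub>C x) = c *\<^sub>C A x"
  by (simp_all add: bounded_clinear_def)

lemma bounded_clinear_add: "bounded_clinear A \<Longrightarrow> A (x + y) = A x + A y"
  by (simp add: bounded_clinear_def linear_simps)

lemma bounded_clinear_diff: "bounded_clinear A \<Longrightarrow> A (x - y) = A x - A y"
  by (simp add: bounded_clinear_def linear_simps)

lemma bounded_clinear_zero: "bounded_clinear A \<Longrightarrow> A 0 = 0"
  by (simp add: bounded_clinear_def linear_simps)

lemma bounded_clinear_scaleR: "bounded_clinear A \<Longrightarrow> A (r *\<^sub>R x) = r *\<^sub>R A x"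
  by (simp add: bounded_clinear_def linear_simps)

lemma bounded_clinear_continuous: "bounded_clinear A \<Longrightarrow> continuous_on S A"
  by (simp add: bounded_clinear_def linear_continuous_on)

lemma bounded_clinear_tendsto: "bounded_clinear A \<Longrightarrow> (f \<longlongrightarrow> l) F \<Longrightarrow> ((\<lambda>x. A (f x)) \<longlongrightarrow> A l) F"
  by (simp add: bounded_clinear_def bounded_linear.tendsto)

lemma bounded_clinear_bound:
  assumes "bounded_clinear A"
  obtains K where "K > 0" "\<And>x. norm (A x) \<le> K * norm x"
  using bounded_linear.pos_bounded[OF bounded_clinear_bounded_linear[OF assms]]
  by (metis mult.commute)

lemma bounded_clinear_intro:
  assumes "\<And>x y. A (x + y) = A x + A y" "\<And>c x. A (c *\<^sub>C x) = c *\<^sub>C A x" "\<And>x. norm (A x) \<le> K * norm x"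
  shows "bounded_clinear A"
  unfolding bounded_clinear_def using assms
  by (auto intro!: bounded_linear_intro[where K = K] simp: scaleR_scaleC mult.commute)

lemma bounded_clinear_ident: "bounded_clinear (\<lambda>x. x)"
  by (simp add: bounded_clinear_def bounded_linear_ident)

lemma bounded_clinear_compose: "bounded_clinear A \<Longrightarrow> bounded_clinear B \<Longrightarrow> bounded_clinear (\<lambda>x. A (B x))"
  by (simp add: bounded_clinear_def bounded_linear_compose)

lemma bounded_clinear_minus:
  "bounded_clinear A \<Longrightarrow> bounded_clinear B \<Longrightarrow> bounded_clinear (\<lambda>x. A x - B x)"
  by (simp add: bounded_clinear_def bounded_linear_sub cvs.scale_right_diff_distrib)

lemma bounded_clinear_sum:
  "(\<And>i. i \<in> I \<Longrightarrow> bounded_clinear (A i)) \<Longrightarrow> bounded_clinear (\<lambda>x. \<Sum>i\<in>I. A i x)"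
  by (simp add: bounded_clinear_def bounded_linear_sum cvs.scale_sum_right)

lemma bounded_clinear_scaleC: "bounded_clinear (\<lambda>x :: 'a::complex_inner. c *\<^sub>C x)"
  by (rule bounded_clinear_intro[where K = "cmod c"]) (simp_all add: scaleC_add_right norm_scaleC mult.commute)

lemma subspace_closure_scaleC:
  fixes X :: "'a::complex_inner set"
  assumes "\<And>x. x \<in> X \<Longrightarrow> c *\<^sub>C x \<in> X" and x: "x \<in> closure X"
  shows "c *\<^sub>C x \<in> closure X"
proof -
  have "(\<lambda>x. c *\<^sub>C x) ` closure X \<subseteq> closure ((\<lambda>x. c *\<^sub>C x) ` X)"
    using bounded_clinear_continuous[OF bounded_clinear_scaleC]
    by (intro image_closure_subset) (auto intro: closure_subset[THEN subsetD])
  also have "\<dots> \<subseteq> closure X" using assms(1) by (intro closure_mono) auto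
  finally show ?thesis using x by blast
qed

text \<open>The representing vector is the limit of a minimising sequence of \<open>\<parallel>x\<parallel>\<^sup>2 - 2 \<phi> x\<close>.\<close>

lemma Riesz_on_subspace:
  fixes X :: "'a::{real_inner, complete_space} set" and \<phi> :: "'a \<Rightarrow> real"
  assumes X: "subspace X" and add: "\<And>x y. x \<in> X \<Longrightarrow> y \<in> X \<Longrightarrow> \<phi> (x + y) = \<phi> x + \<phi> y"
    and scale: "\<And>r x. x \<in> X \<Longrightarrow> \<phi> (r *\<^sub>R x) = r * \<phi> x"
    and bound: "\<And>x. x \<in> X \<Longrightarrow> \<bar>\<phi> x\<bar> \<le> C * norm x" and C: "0 \<le> C"
  obtains u where "u \<in> closure X" "\<And>x. x \<in> X \<Longrightarrow> inner x u = \<phi> x" "norm u \<le> C"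
proof -
  define J where "J x = inner x x - 2 * \<phi> x" for x
  define d where "d = Inf (J ` X)"
  have J_ge: "- (C\<^sup>2) \<le> J x" if "x \<in> X" for x
  proof -
    have "\<phi> x \<le> C * norm x" using bound[OF that] by linarith
    moreover have "0 \<le> (norm x - C)\<^sup>2" by simp
    ultimately show ?thesis
      by (simp add: J_def power2_diff flip: power2_norm_eq_inner) (simp add: mult.commute)
  qed
  have bdd: "bdd_below (J ` X)" using J_ge by (intro bdd_belowI[of _ "- (C\<^sup>2)"]) auto
  have d_le: "d \<le> J x" if "x \<in> X" for x
    unfolding d_def using that bdd by (intro cInf_lower) auto
  have "\<exists>x\<in>X. J x < d + 1 / real (Suc n)" for n
  proof -
    have "Inf (J ` X) < d + 1 / real (Suc n)" by (simp add: d_def)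
    then show ?thesis using cInf_lessD[of "J ` X"] subspace_0[OF X] by blast
  qed
  then obtain s where sX: "\<And>n. s n \<in> X" and sJ: "\<And>n. J (s n) < d + 1 / real (Suc n)" by metis
  \<comment> \<open>Parallelogram law: the midpoint of \<open>x\<close> and \<open>y\<close> lies in
    \<open>X\<close>, so \<open>J\<close> is at least \<open>d\<close> there. Near-minimisers are
    therefore close together.\<close>
  have par: "(norm (x - y))\<^sup>2 \<le> 2 * (J x + J y - 2 * d)" if "x \<in> X" "y \<in> X" for x y
  proof -
    have xy: "x + y \<in> X" using that X by (simp add: subspace_add)
    have "d \<le> J ((1/2) *\<^sub>R (x + y))" using xy X by (intro d_le subspace_scale)
    also have "\<dots> = inner (x + y) (x + y) / 4 - (\<phi> x + \<phi> y)"
      using scale[OF xy, of "1/2"] add[OF that] by (simp add: J_def)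
    finally have "4 * d \<le> inner (x + y) (x + y) - 4 * (\<phi> x + \<phi> y)" by (simp add: field_simps)
    moreover have "inner (x + y) (x + y) + (norm (x - y))\<^sup>2 = 2 * inner x x + 2 * inner y y"
      by (simp add: power2_norm_eq_inner inner_add_left inner_add_right inner_diff_left
          inner_diff_right inner_commute)
    ultimately show ?thesis by (simp add: J_def)
  qed
  have "Cauchy s"
  proof (rule metric_CauchyI)
    fix e :: real assume e: "e > 0"
    obtain N where N: "4 / e\<^sup>2 < real N" using reals_Archimedean2 by blast
    have "dist (s m) (s n) < e" if "m \<ge> N" "n \<ge> N" for m n
    proof -
      define h where "h = 1 / real (Suc N)"
      have "1 / real (Suc m) \<le> h" "1 / real (Suc n) \<le> h"
        unfolding h_def using that by (simp_all add: frac_le)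
      then have "J (s m) + J (s n) - 2 * d < 2 * h"
        using sJ[of m] sJ[of n] by linarith
      then have "2 * (J (s m) + J (s n) - 2 * d) < 4 * h" by (simp add: algebra_simps)
      with par[OF sX sX, of m n] have "(norm (s m - s n))\<^sup>2 < 4 * h" by (rule le_less_trans)
      also have "\<dots> \<le> e\<^sup>2"
      proof -
        have "4 < e\<^sup>2 * real N" using N e by (simp add: divide_simps mult.commute)
        also have "\<dots> \<le> e\<^sup>2 * real (Suc N)" by (simp add: mult_left_mono)
        finally show ?thesis by (simp add: h_def divide_simps mult.commute)
      qed
      finally show ?thesis using e by (simp add: dist_norm power_less_imp_less_base)
    qed
    then show "\<exists>M. \<forall>m\<ge>M. \<forall>n\<ge>M. dist (s m) (s n) < e" by blast
  qed
  then obtain u where u: "s \<longlonglongrightarrow> u" using Cauchy_convergent_iff convergent_def by blast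
  have uX: "u \<in> closure X" using u sX unfolding closure_sequential by blast
  have rep: "inner y u = \<phi> y" if y: "y \<in> X" for y
  proof -
    define a b where "a = inner u y - \<phi> y" and "b = inner y y"
    have b: "b \<ge> 0" by (simp add: b_def)
    \<comment> \<open>First variation in direction \<open>y\<close>. The limit \<open>u\<close> may
      lie outside \<open>X\<close>, where nothing is known about \<open>\<phi>\<close>, so the
      inequality is written for \<open>s n\<close> and then passed to the limit.\<close>
    have quad: "0 \<le> 2 * r * a + r\<^sup>2 * b" for r
    proof -
      have ge: "0 \<le> 1 / real (Suc n) + 2 * r * (inner (s n) y - \<phi> y) + r\<^sup>2 * b" for n
      proof -
        have ry: "r *\<^sub>R y \<in> X" using y X by (simp add: subspace_scale)
        have "d \<le> J (s n + r *\<^sub>R y)" using ry sX X by (intro d_le subspace_add)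
        also have "\<dots> = J (s n) + 2 * r * (inner (s n) y - \<phi> y) + r\<^sup>2 * b"
          using add[OF sX ry] scale[OF y]
          by (simp add: J_def b_def inner_add_left inner_add_right inner_commute power2_eq_square algebra_simps)
        finally show ?thesis using sJ[of n] by linarith
      qed
      have "(\<lambda>n. 1 / real (Suc n) + 2 * r * (inner (s n) y - \<phi> y) + r\<^sup>2 * b)
          \<longlonglongrightarrow> 0 + 2 * r * (inner u y - \<phi> y) + r\<^sup>2 * b"
        by (intro tendsto_intros u LIMSEQ_Suc[OF lim_1_over_n])
      then show ?thesis using ge unfolding a_def by (intro LIMSEQ_le_const[where X = "\<lambda>n. 1 / real (Suc n) + 2 * r * (inner (s n) y - \<phi> y) + r\<^sup>2 * b"]) auto
    qed
    \<comment> \<open>The optimal \<open>r\<close> would be \<open>- a / b\<close>; the denominator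
      \<open>b + 1\<close> avoids the case \<open>b = 0\<close> and still gives a negative value
      unless \<open>a = 0\<close>.\<close>
    have "0 \<le> 2 * (- a / (b + 1)) * a + (- a / (b + 1))\<^sup>2 * b" by (rule quad)
    also have "\<dots> = - (a\<^sup>2 * (b + 2)) / (b + 1)\<^sup>2"
      using b by (simp add: divide_simps power2_eq_square) (simp add: algebra_simps)
    finally have "a\<^sup>2 * (b + 2) \<le> 0" using b by (simp add: divide_simps)
    then have "a = 0" using b by (simp add: mult_le_0_iff)
    then show ?thesis by (simp add: a_def inner_commute)
  qed
  have "norm u \<le> C"
  proof -
    have "(\<lambda>n. inner (s n) u) \<longlonglongrightarrow> inner u u" "(\<lambda>n. C * norm (s n)) \<longlonglongrightarrow> C * norm u"
      by (intro tendsto_intros u)+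
    moreover have "inner (s n) u \<le> C * norm (s n)" for n
      using rep[OF sX] bound[OF sX, of n] by (metis abs_le_D1)
    ultimately have "inner u u \<le> C * norm u" by (intro LIMSEQ_le) auto
    then have le: "norm u * norm u \<le> C * norm u" by (simp add: power2_eq_square flip: power2_norm_eq_inner)
    then show ?thesis using C by (cases "u = 0") simp_all
  qed
  then show thesis using that uX rep by blast
qed

section \<open>Adjoints and self-adjoint operators\<close>

lemma subspace_range_bounded_clinear: "bounded_clinear A \<Longrightarrow> subspace (range A)"
  using bounded_clinear_bounded_linear[THEN bounded_linear.linear, of A]
  by (intro linear_subspace_image subspace_UNIV)

text \<open>The vector representing \<open>\<lambda>x. inner x z\<close> on \<open>X\<close> is the
  orthogonal projection of \<open>z\<close> onto the closure of \<open>X\<close>.\<close>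

lemma orthogonal_decomposition:
  fixes X :: "'a::{real_inner, complete_space} set"
  assumes "subspace X"
  obtains m where "m \<in> closure X" "\<And>x. x \<in> X \<Longrightarrow> inner x (z - m) = 0"
proof -
  obtain m where "m \<in> closure X" "\<And>x. x \<in> X \<Longrightarrow> inner x m = inner x z"
    by (rule Riesz_on_subspace[OF assms, of "\<lambda>x. inner x z" "norm z"])
      (auto simp: inner_add_left Cauchy_Schwarz_ineq2 mult.commute)
  then show thesis using that by (simp add: inner_diff_right)
qed

lemma closure_inner_zero:
  assumes "\<And>x. x \<in> X \<Longrightarrow> inner x w = 0" "m \<in> closure X"
  shows "inner m w = 0"
proof -
  have "closed {x. inner x w = 0}" by (intro closed_Collect_eq continuous_intros)
  then have "closure X \<subseteq> {x. inner x w = 0}" using assms by (intro closure_minimal) auto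
  then show ?thesis using assms by blast
qed

text \<open>Testing against all vectors transfers linearity from \<open>A\<close> to
  \<open>B\<close>, and testing at \<open>B x\<close> the bound. \<open>B\<close> starts as a bare
  function, since it arises by choosing Riesz vectors.\<close>

lemma bounded_clinear_adjoint_pair:
  fixes A :: "'a::complex_inner \<Rightarrow> 'b::complex_inner"
  assumes A: "bounded_clinear A" and AB: "\<And>x y. inner (A x) y = inner x (B y)"
  shows "bounded_clinear B"
proof -
  obtain K where K: "K > 0" "\<And>x. norm (A x) \<le> K * norm x" using bounded_clinear_bound[OF A] by blast
  have ext: "u = v" if "\<And>x. inner x u = inner x v" for u v :: 'a
  proof -
    have "inner (u - v) (u - v) = 0" using that[of "u - v"] by (simp add: inner_diff_right)
    then show ?thesis by simp
  qed
  show ?thesis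
  proof (rule bounded_clinear_intro[where K = K])
    show "B (x + y) = B x + B y" for x y
      by (rule ext) (simp add: inner_add_right flip: AB)
    show "B (c *\<^sub>C x) = c *\<^sub>C B x" for c x
    proof (rule ext)
      fix z
      have "inner z (B (c *\<^sub>C x)) = inner (A (cnj c *\<^sub>C z)) x"
        using inner_scaleC_left[of "cnj c" "A z" x] by (simp add: bounded_clinear_scale[OF A] flip: AB)
      also have "\<dots> = inner z (c *\<^sub>C B x)"
        using inner_scaleC_left[of "cnj c" z "B x"] by (simp add: AB)
      finally show "inner z (B (c *\<^sub>C x)) = inner z (c *\<^sub>C B x)" .
    qed
    show "norm (B x) \<le> K * norm x" for x
    proof -
      have "norm (B x) * norm (B x) = inner (A (B x)) x"
        by (simp add: AB power2_eq_square flip: power2_norm_eq_inner)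
      also have "\<dots> \<le> norm (A (B x)) * norm x" by (rule norm_cauchy_schwarz)
      also have "\<dots> \<le> (K * norm (B x)) * norm x" by (intro mult_right_mono K) simp
      finally have "norm (B x) * norm (B x) \<le> norm (B x) * (K * norm x)" by (simp add: ac_simps)
      then show ?thesis using K(1) by (cases "B x = 0") simp_all
    qed
  qed
qed

text \<open>Complex linearity allows the real identity to be used at \<open>\<i> *\<^sub>C x\<close>
  as well. For the same reason \<open>selfadj\<close> loses nothing by being stated with the real
  inner product.\<close>

lemma inner_adjoint_imp_cinner_adjoint:
  assumes "\<And>c x. A (c *\<^sub>C x) = c *\<^sub>C A x" "\<And>x y. inner (A x) y = inner x (B y)"
  shows "cinner (A x) y = cinner x (B y)"
  by (rule cinner_eqI) (simp_all add: assms flip: assms(1))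

lemma adjoint_exists:
  fixes A :: "'h::chilbert_space \<Rightarrow> 'h"
  assumes A: "bounded_clinear A"
  obtains B where "\<And>x y. inner (A x) y = inner x (B y)"
proof -
  obtain K where K: "K > 0" "\<And>x. norm (A x) \<le> K * norm x" using bounded_clinear_bound[OF A] by blast
  have "\<exists>u. \<forall>x. inner x u = inner (A x) y" for y
  proof -
    have le: "\<bar>inner (A x) y\<bar> \<le> K * norm y * norm x" for x
    proof -
      have "\<bar>inner (A x) y\<bar> \<le> norm (A x) * norm y" by (rule Cauchy_Schwarz_ineq2)
      also have "\<dots> \<le> (K * norm x) * norm y" by (intro mult_right_mono K) simp
      finally show ?thesis by (simp add: ac_simps)
    qed
    obtain u where "\<And>x. x \<in> UNIV \<Longrightarrow> inner x u = inner (A x) y"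
      by (rule Riesz_on_subspace[OF subspace_UNIV, of "\<lambda>x. inner (A x) y" "K * norm y"])
        (use K le in \<open>auto simp: bounded_clinear_add[OF A] bounded_clinear_scaleR[OF A] inner_add_left\<close>)
    then show ?thesis by blast
  qed
  then obtain B where "\<forall>y x. inner x (B y) = inner (A x) y" by metis
  then show thesis by (intro that[of B]) simp
qed

lemma
  fixes A :: "'h::chilbert_space \<Rightarrow> 'h"
  assumes A: "bounded_clinear A"
  shows inner_cadjoint: "inner (A x) y = inner x (cadjoint A y)"
    and bounded_clinear_cadjoint: "bounded_clinear (cadjoint A)"
proof -
  obtain B where B: "\<And>x y. inner (A x) y = inner x (B y)" using adjoint_exists[OF A] by blast
  have "cadjoint A = B"
    unfolding cadjoint_def
  proof (rule the_equality)
    show "\<forall>x y. cinner (A x) y = cinner x (B y)"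
      using inner_adjoint_imp_cinner_adjoint[of A B] B bounded_clinear_scale[OF A] by blast
    fix B' assume "\<forall>x y. cinner (A x) y = cinner x (B' y)"
    then have "inner x (B' y - B y) = 0" for x y
      by (simp add: inner_diff_right flip: B) (simp add: inner_eq_Re_cinner)
    then have "B' y - B y = 0" for y by (metis inner_eq_zero_iff)
    then show "B' = B" by (simp add: fun_eq_iff)
  qed
  then show "inner (A x) y = inner x (cadjoint A y)" "bounded_clinear (cadjoint A)"
    using B bounded_clinear_adjoint_pair[OF A B] by simp_all
qed

section \<open>Self-adjoint and positive operators and their spectra\<close>

definition selfadj :: "('h::chilbert_space \<Rightarrow> 'h) \<Rightarrow> bool"
  where "selfadj A \<longleftrightarrow> bounded_clinear A \<and> (\<forall>x y. inner (A x) y = inner x (A y))"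

lemma selfadj_bounded_clinear: "selfadj A \<Longrightarrow> bounded_clinear A"
  and selfadj_inner: "selfadj A \<Longrightarrow> inner (A x) y = inner x (A y)"
  by (simp_all add: selfadj_def)

lemma selfadj_kernel_orthogonal: "selfadj A \<Longrightarrow> (\<And>z. inner (A z) x = 0) \<Longrightarrow> A x = 0"
  by (metis inner_eq_zero_iff selfadj_inner)

text \<open>The squared norm of \<open>A x\<close> is \<open>inner x (A (A x))\<close>. Later this
  says that the kernel and the range of \<open>A\<close> meet only in \<open>0\<close>.\<close>

lemma selfadj_power2_ker:
  assumes "selfadj A" "A (A x) = 0"
  shows "A x = 0"
  using assms selfadj_inner[of A x "A x"] by simp

text \<open>Pythagoras: \<open>\<i> *\<^sub>C x\<close> is orthogonal to \<open>A x\<close> and to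
  \<open>x\<close> in the real inner product. The right-hand side does not see the sign of
  \<open>Im z\<close>, so \<open>A - z\<close> and \<open>A - cnj z\<close> have equal norms at
  every vector.\<close>

lemma selfadj_norm_shift:
  assumes A: "selfadj A"
  shows "(norm (A x - z *\<^sub>C x))\<^sup>2 = (norm (A x - Re z *\<^sub>R x))\<^sup>2 + (Im z)\<^sup>2 * (norm x)\<^sup>2"
proof -
  define y where "y = A x - Re z *\<^sub>R x"
  have yx: "inner y (\<i> *\<^sub>C x) = 0"
  proof -
    have "inner (A x) (\<i> *\<^sub>C x) = inner x (\<i> *\<^sub>C A x)"
      using selfadj_inner[OF A] bounded_clinear_scale[OF selfadj_bounded_clinear[OF A]] by simp
    also have "\<dots> = - inner (\<i> *\<^sub>C x) (A x)"
      using inner_scaleC_left[of \<i> x "A x"] inner_minus_right[of x "\<i> *\<^sub>C A x"]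
      by (simp add: cvs.scale_minus_left)
    finally have "inner (A x) (\<i> *\<^sub>C x) = 0" by (simp add: inner_commute)
    moreover have "inner x (\<i> *\<^sub>C x) = 0"
      using inner_ii[of x x] cinner_commute[of x x] by (simp add: inner_commute complex_eq_iff)
    ultimately show ?thesis by (simp add: y_def inner_diff_left)
  qed
  have z: "z *\<^sub>C x = Re z *\<^sub>R x + Im z *\<^sub>R (\<i> *\<^sub>C x)"
    by (subst complex_eq[of z]) (simp add: scaleC_add_left scaleR_scaleC mult.commute)
  have e: "A x - z *\<^sub>C x = y - Im z *\<^sub>R (\<i> *\<^sub>C x)" unfolding y_def by (subst z) simp
  have pyth: "(norm (y - Im z *\<^sub>R (\<i> *\<^sub>C x)))\<^sup>2 = (norm y)\<^sup>2 + (norm (Im z *\<^sub>R (\<i> *\<^sub>C x)))\<^sup>2"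
    by (simp only: power2_norm_eq_inner inner_diff_left inner_diff_right) (simp add: yx inner_commute)
  have "(norm (Im z *\<^sub>R (\<i> *\<^sub>C x)))\<^sup>2 = (Im z)\<^sup>2 * (norm x)\<^sup>2"
    by (simp add: norm_scaleC power_mult_distrib)
  then show ?thesis unfolding e pyth by (simp only: y_def)
qed

lemma bounded_clinear_minus_scaleC: "bounded_clinear A \<Longrightarrow> bounded_clinear (\<lambda>x. A x - z *\<^sub>C x)"
  for A :: "'h::chilbert_space \<Rightarrow> 'h"
  by (intro bounded_clinear_minus bounded_clinear_scaleC)

text \<open>The lower bound makes \<open>A - z\<close> injective with closed range. A vector
  orthogonal to the range is killed by \<open>A - cnj z\<close>, hence by \<open>A - z\<close> since
  the norms agree, so it is zero.\<close>

lemma selfadj_bounded_below_notin_spectrum: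
  assumes A: "selfadj A" and c: "c > 0" and below: "\<And>x. c * norm x \<le> norm (A x - z *\<^sub>C x)"
  shows "z \<notin> spectrum A"
proof -
  define L where "L x = A x - z *\<^sub>C x" for x
  have L: "bounded_clinear L"
    unfolding L_def by (intro bounded_clinear_minus_scaleC selfadj_bounded_clinear A)
  have "complete (range L)"
    using complete_isometric_image[OF c subspace_UNIV bounded_clinear_bounded_linear[OF L]] below
    by (simp add: L_def complete_UNIV)
  then have cl: "closure (range L) = range L" by (simp add: complete_imp_closed)
  have inj: "x = y" if "L x = L y" for x y
  proof -
    have "c * norm (x - y) \<le> 0" using below[of "x - y"] that bounded_clinear_diff[OF L, of x y] by (simp add: L_def)
    then show ?thesis using c by (simp add: mult_le_0_iff)
  qed
  have surj: "\<exists>x. L x = w" for w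
  proof -
    obtain m where m: "m \<in> closure (range L)" "\<And>x. x \<in> range L \<Longrightarrow> inner x (w - m) = 0"
      using orthogonal_decomposition[OF subspace_range_bounded_clinear[OF L], of w] by blast
    define v where "v = w - m"
    have "inner x (A v - cnj z *\<^sub>C v) = 0" for x
      using m(2)[of "L x"] selfadj_inner[OF A, of x v] inner_scaleC_left[of z x v]
      by (simp add: L_def v_def inner_diff_left inner_diff_right)
    then have "A v - cnj z *\<^sub>C v = 0" by (metis inner_eq_zero_iff)
    then have "(norm (A v - z *\<^sub>C v))\<^sup>2 = 0"
      using selfadj_norm_shift[OF A, of v z] selfadj_norm_shift[OF A, of v "cnj z"] by simp
    then have "c * norm v \<le> 0" using below[of v] by simp
    then have "v = 0" using c by (simp add: mult_le_0_iff)
    then show ?thesis using m(1) cl by (auto simp: v_def)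
  qed
  obtain B where B: "\<And>w. L (B w) = w" using surj by metis
  have BL: "B (L x) = x" for x by (rule inj) (simp add: B)
  have "bounded_clinear B"
  proof (rule bounded_clinear_intro[where K = "1 / c"])
    show "B (x + y) = B x + B y" for x y by (rule inj) (simp add: B bounded_clinear_add[OF L])
    show "B (a *\<^sub>C x) = a *\<^sub>C B x" for a x by (rule inj) (simp add: B bounded_clinear_scale[OF L])
    show "norm (B x) \<le> 1 / c * norm x" for x
      using below[of "B x"] B[of x] c by (simp add: L_def field_simps)
  qed
  then show ?thesis using B BL by (auto simp: spectrum_def L_def)
qed

lemma selfadj_spectrum_real:
  assumes A: "selfadj A" and z: "z \<in> spectrum A"
  shows "z = complex_of_real (Re z)"
proof (rule ccontr)
  assume "z \<noteq> complex_of_real (Re z)"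
  then have im: "Im z \<noteq> 0" by (auto simp: complex_eq_iff)
  have "\<bar>Im z\<bar> * norm x \<le> norm (A x - z *\<^sub>C x)" for x
  proof (rule power2_le_imp_le)
    show "(\<bar>Im z\<bar> * norm x)\<^sup>2 \<le> (norm (A x - z *\<^sub>C x))\<^sup>2"
      by (simp add: selfadj_norm_shift[OF A] power_mult_distrib)
  qed simp
  then show False using selfadj_bounded_below_notin_spectrum[OF A, of "\<bar>Im z\<bar>" z] im z by simp
qed

definition posop :: "('h::chilbert_space \<Rightarrow> 'h) \<Rightarrow> bool"
  where "posop A \<longleftrightarrow> selfadj A \<and> (\<forall>x. 0 \<le> inner (A x) x)"

lemma posop_selfadj: "posop A \<Longrightarrow> selfadj A"
  by (simp add: posop_def)

definition real_spectrum :: "('h::chilbert_space \<Rightarrow> 'h) \<Rightarrow> real set"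
  where "real_spectrum A = {r. complex_of_real r \<in> spectrum A}"

text \<open>Outside the interval \<open>A - r\<close> is bounded below: by \<open>- r\<close> for
  negative \<open>r\<close>, from positivity and Cauchy-Schwarz, and by \<open>r - onorm A\<close>
  for large \<open>r\<close>.\<close>

lemma posop_real_spectrum:
  assumes A: "posop A"
  shows "real_spectrum A \<subseteq> {0..onorm A}"
proof
  fix r assume r: "r \<in> real_spectrum A"
  have sA: "selfadj A" and bA: "bounded_linear A"
    using A by (auto simp: posop_def selfadj_def bounded_clinear_def)
  have below: "\<not> (c > 0 \<and> (\<forall>x. c * norm x \<le> norm (A x - r *\<^sub>R x)))" for c
    using selfadj_bounded_below_notin_spectrum[OF sA, of c "complex_of_real r"] r
    by (auto simp: real_spectrum_def scaleR_scaleC)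
  have "0 \<le> r"
  proof (rule ccontr)
    assume "\<not> 0 \<le> r"
    have "- r * norm x \<le> norm (A x - r *\<^sub>R x)" for x
    proof (cases "x = 0")
      case False
      have "- r * norm x * norm x \<le> inner (A x - r *\<^sub>R x) x"
        using A by (simp add: posop_def inner_diff_left power2_eq_square flip: power2_norm_eq_inner)
      also have "\<dots> \<le> norm (A x - r *\<^sub>R x) * norm x" by (rule norm_cauchy_schwarz)
      finally show ?thesis by (rule mult_right_le_imp_le) (use False in simp)
    qed (simp add: linear_simps bA)
    then show False using below[of "- r"] \<open>\<not> 0 \<le> r\<close> by simp
  qed
  moreover have "r \<le> onorm A"
  proof (rule ccontr)
    assume "\<not> r \<le> onorm A"
    have "(r - onorm A) * norm x \<le> norm (A x - r *\<^sub>R x)" for x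
      using onorm[OF bA, of x] norm_triangle_ineq2[of "r *\<^sub>R x" "A x"] \<open>0 \<le> r\<close>
      by (simp add: norm_minus_commute algebra_simps)
    then show False using below[of "r - onorm A"] \<open>\<not> r \<le> onorm A\<close> by simp
  qed
  ultimately show "r \<in> {0..onorm A}" by simp
qed

text \<open>If both points were outside the spectrum, the square of \<open>A\<close> minus
  \<open>b\<^sup>2\<close>, where \<open>b = onorm A\<close>, would be bounded below, and this
  pushes the ratio of \<open>norm (A x)\<close> to \<open>norm x\<close> uniformly below
  \<open>b\<close>. The vector \<open>x0\<close> excludes the zero space, where spectra are
  empty.\<close>

lemma selfadj_onorm_in_spectrum:
  fixes A :: "'h::chilbert_space \<Rightarrow> 'h"
  assumes A: "selfadj A" and x0: "x0 \<noteq> (0 :: 'h)"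
  shows "complex_of_real (onorm A) \<in> spectrum A \<or> complex_of_real (- onorm A) \<in> spectrum A"
proof (rule ccontr)
  assume neg: "\<not> ?thesis"
  define b where "b = onorm A"
  have cA: "bounded_clinear A" and bA: "bounded_linear A"
    using A by (auto simp: selfadj_def bounded_clinear_def)
  have b: "b \<ge> 0" "norm (A x) \<le> b * norm x" for x
    unfolding b_def by (rule onorm_pos_le[OF bA]) (rule onorm[OF bA])
  obtain B1 where B1: "bounded_clinear B1" "\<And>x. B1 (A x - b *\<^sub>R x) = x"
    using neg by (auto simp: spectrum_def b_def scaleR_scaleC)
  obtain B2 where B2: "bounded_clinear B2" "\<And>x. B2 (A x + b *\<^sub>R x) = x"
    using neg by (auto simp: spectrum_def b_def scaleR_scaleC cvs.scale_minus_left)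
  obtain M where M: "M > 0" "\<And>x. norm (B2 (B1 x)) \<le> M * norm x"
    using bounded_clinear_bound[OF bounded_clinear_compose[OF B2(1) B1(1)]] by blast
  have G: "norm x \<le> M * norm (A (A x) - b\<^sup>2 *\<^sub>R x)" for x
  proof -
    have "A (A x) - b\<^sup>2 *\<^sub>R x = A (A x + b *\<^sub>R x) - b *\<^sub>R (A x + b *\<^sub>R x)"
      by (simp add: bounded_clinear_add[OF cA] bounded_clinear_scaleR[OF cA] scaleR_add_right power2_eq_square)
    then have "B2 (B1 (A (A x) - b\<^sup>2 *\<^sub>R x)) = x" by (simp add: B1 B2)
    then show ?thesis using M(2)[of "A (A x) - b\<^sup>2 *\<^sub>R x"] by simp
  qed
  have key: "(norm x)\<^sup>2 \<le> M\<^sup>2 * (b\<^sup>2 * (b\<^sup>2 * (norm x)\<^sup>2 - (norm (A x))\<^sup>2))" for x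
  proof -
    have i: "inner (A (A x)) x = (norm (A x))\<^sup>2" by (simp add: selfadj_inner[OF A] power2_norm_eq_inner)
    have "(norm (A (A x) - b\<^sup>2 *\<^sub>R x))\<^sup>2 = (norm (A (A x)))\<^sup>2 - 2 * b\<^sup>2 * (norm (A x))\<^sup>2 + b\<^sup>2 * b\<^sup>2 * (norm x)\<^sup>2"
      using i by (simp add: power2_norm_eq_inner inner_diff_left inner_diff_right inner_commute algebra_simps)
    moreover have "(norm (A (A x)))\<^sup>2 \<le> b\<^sup>2 * (norm (A x))\<^sup>2"
      using power_mono[OF b(2)[of "A x"], of 2] by (simp add: power_mult_distrib)
    ultimately have "(norm (A (A x) - b\<^sup>2 *\<^sub>R x))\<^sup>2 \<le> b\<^sup>2 * (b\<^sup>2 * (norm x)\<^sup>2 - (norm (A x))\<^sup>2)"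
      by (simp add: algebra_simps)
    then have "M\<^sup>2 * (norm (A (A x) - b\<^sup>2 *\<^sub>R x))\<^sup>2 \<le> M\<^sup>2 * (b\<^sup>2 * (b\<^sup>2 * (norm x)\<^sup>2 - (norm (A x))\<^sup>2))"
      by (intro mult_left_mono) auto
    moreover have "(norm x)\<^sup>2 \<le> M\<^sup>2 * (norm (A (A x) - b\<^sup>2 *\<^sub>R x))\<^sup>2"
      using power_mono[OF G[of x], of 2] by (simp add: power_mult_distrib)
    ultimately show ?thesis by linarith
  qed
  show False
  proof (cases "b = 0")
    case True
    then show False using key[of x0] x0 by simp
  next
    case False
    \<comment> \<open>Comes from dividing \<open>key\<close> by \<open>M\<^sup>2 * b\<^sup>2\<close>
      and solving for \<open>(norm (A x))\<^sup>2\<close>.\<close>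
    define s where "s = b\<^sup>2 - 1 / (M\<^sup>2 * b\<^sup>2)"
    have le: "(norm (A x))\<^sup>2 \<le> s * (norm x)\<^sup>2" for x
    proof -
      have "1 / (M\<^sup>2 * b\<^sup>2) * (norm x)\<^sup>2 \<le> b\<^sup>2 * (norm x)\<^sup>2 - (norm (A x))\<^sup>2"
        using key[of x] False M(1) by (simp add: divide_simps mult.commute mult.left_commute)
      then show ?thesis unfolding s_def left_diff_distrib by linarith
    qed
    have s0: "s \<ge> 0"
    proof (rule ccontr)
      assume "\<not> s \<ge> 0"
      then have "s * (norm x0)\<^sup>2 < 0" using x0 by (simp add: mult_neg_pos)
      then show False using le[of x0] zero_le_power2[of "norm (A x0)"] by linarith
    qed
    have "norm (A x) \<le> sqrt s * norm x" for x
      using real_sqrt_le_mono[OF le[of x]] by (simp add: real_sqrt_mult)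
    then have "b \<le> sqrt s" unfolding b_def using s0 by (intro onorm_bound) auto
    then have "b\<^sup>2 \<le> s" using s0 b(1) by (metis power_mono real_sqrt_pow2)
    moreover have "s < b\<^sup>2" using False M(1) by (simp add: s_def)
    ultimately show False by simp
  qed
qed

section \<open>Polynomials of an operator\<close>

text \<open>Complex coefficients allow a polynomial to be split into linear factors even when its
  roots are not real.\<close>

definition cpoly_op :: "complex poly \<Rightarrow> ('h::chilbert_space \<Rightarrow> 'h) \<Rightarrow> 'h \<Rightarrow> 'h"
  where "cpoly_op p A x = (\<Sum>k\<le>degree p. coeff p k *\<^sub>C (A ^^ k) x)"

lemma cpoly_op_altdef: "degree p \<le> n \<Longrightarrow> cpoly_op p A x = (\<Sum>k\<le>n. coeff p k *\<^sub>C (A ^^ k) x)"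
  unfolding cpoly_op_def by (rule sum.mono_neutral_left) (auto simp: coeff_eq_0)

lemma cpoly_op_0 [simp]: "cpoly_op 0 A x = 0"
  by (simp add: cpoly_op_def)

lemma cpoly_op_add: "cpoly_op (p + q) A x = cpoly_op p A x + cpoly_op q A x"
proof -
  let ?n = "max (degree p) (degree q)"
  have "degree (p + q) \<le> ?n" by (rule degree_add_le_max)
  then show ?thesis
    using cpoly_op_altdef[of p ?n A x] cpoly_op_altdef[of q ?n A x] cpoly_op_altdef[of "p + q" ?n A x]
    by (simp add: scaleC_add_left sum.distrib)
qed

lemma cpoly_op_smult: "cpoly_op (smult c p) A x = c *\<^sub>C cpoly_op p A x"
  using cpoly_op_altdef[of "smult c p" "degree p" A x] degree_smult_le[of c p]
  by (simp add: cpoly_op_def cvs.scale_sum_right)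

lemma bounded_clinear_funpow: "bounded_clinear A \<Longrightarrow> bounded_clinear (A ^^ k)"
  for A :: "'h::chilbert_space \<Rightarrow> 'h"
  by (induction k) (simp_all add: id_def bounded_clinear_ident bounded_clinear_compose comp_def)

lemma bounded_clinear_cpoly_op: "bounded_clinear A \<Longrightarrow> bounded_clinear (cpoly_op p A)"
  unfolding cpoly_op_def[abs_def]
  by (intro bounded_clinear_sum bounded_clinear_compose[OF bounded_clinear_scaleC] bounded_clinear_funpow)

lemma cpoly_op_pCons:
  assumes A: "bounded_clinear A"
  shows "cpoly_op (pCons a p) A x = a *\<^sub>C x + A (cpoly_op p A x)"
proof -
  have "cpoly_op (pCons a p) A x = (\<Sum>k\<le>Suc (degree p). coeff (pCons a p) k *\<^sub>C (A ^^ k) x)"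
    by (rule cpoly_op_altdef) (rule degree_pCons_le)
  also have "\<dots> = a *\<^sub>C x + (\<Sum>k\<le>degree p. coeff p k *\<^sub>C A ((A ^^ k) x))"
    unfolding sum.atMost_Suc_shift by simp
  also have "(\<Sum>k\<le>degree p. coeff p k *\<^sub>C A ((A ^^ k) x)) = A (cpoly_op p A x)"
    unfolding cpoly_op_def
    by (simp add: bounded_linear.linear[OF bounded_clinear_bounded_linear[OF A], THEN linear_sum] bounded_clinear_scale[OF A])
  finally show ?thesis .
qed

lemma cpoly_op_mult:
  assumes A: "bounded_clinear A"
  shows "cpoly_op (p * q) A x = cpoly_op p A (cpoly_op q A x)"
proof (induction p)
  case (pCons a p)
  then show ?case
    by (simp add: mult_pCons_left cpoly_op_add cpoly_op_smult cpoly_op_pCons[OF A])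
qed simp

text \<open>\<open>q\<close> is a constant times linear factors, and each factor
  \<open>A - z\<close> is invertible because the root \<open>z\<close> lies outside the spectrum.
  This is one inclusion of the spectral mapping theorem.\<close>

lemma cpoly_op_invertible:
  assumes A: "bounded_clinear A" and "q \<noteq> 0" and "\<And>z. poly q z = 0 \<Longrightarrow> z \<notin> spectrum A"
  shows "\<exists>B. bounded_clinear B \<and> (\<forall>x. B (cpoly_op q A x) = x) \<and> (\<forall>x. cpoly_op q A (B x) = x)"
  using assms(2,3)
proof (induction "degree q" arbitrary: q rule: less_induct)
  case less
  show ?case
  proof (cases "degree q = 0")
    case True
    then obtain c where q: "q = [:c:]" by (rule degree_eq_zeroE)
    then have "c \<noteq> 0" using less.prems by simp
    moreover have "cpoly_op q A x = c *\<^sub>C x" for x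
      by (simp add: q cpoly_op_pCons[OF A] bounded_clinear_zero[OF A])
    ultimately show ?thesis
      by (intro exI[of _ "\<lambda>x. inverse c *\<^sub>C x"]) (simp add: bounded_clinear_scaleC)
  next
    case False
    then obtain z where z: "poly q z = 0"
      using fundamental_theorem_of_algebra[of q] constant_degree[of q] by auto
    then obtain r where r: "q = [:- z, 1:] * r" by (auto simp: poly_eq_0_iff_dvd dvd_def)
    have r0: "r \<noteq> 0" using less.prems(1) r by auto
    then have "degree r < degree q" unfolding r by (subst degree_mult_eq) auto
    moreover have "\<And>w. poly r w = 0 \<Longrightarrow> w \<notin> spectrum A" using less.prems(2) by (simp add: r)
    ultimately obtain B where B: "bounded_clinear B" "\<And>x. B (cpoly_op r A x) = x" "\<And>x. cpoly_op r A (B x) = x"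
      using less.hyps[of r] r0 by blast
    obtain C where C: "bounded_clinear C" "\<And>x. C (A x - z *\<^sub>C x) = x" "\<And>x. A (C x) - z *\<^sub>C C x = x"
      using less.prems(2)[OF z] unfolding spectrum_def by blast
    have q: "cpoly_op q A x = A (cpoly_op r A x) - z *\<^sub>C cpoly_op r A x" for x
      unfolding r cpoly_op_mult[OF A] by (simp add: cpoly_op_pCons[OF A] bounded_clinear_zero[OF A])
    show ?thesis
      by (intro exI[of _ "\<lambda>x. B (C x)"]) (simp add: q B C bounded_clinear_compose)
  qed
qed

lemma poly_op_eq: "poly_op p A x = cpoly_op (map_poly complex_of_real p) A x"
  by (simp add: poly_op_def cpoly_op_def degree_map_poly coeff_map_poly scaleR_scaleC)

lemma map_poly_of_real_simps:
  "map_poly complex_of_real (p + q) = map_poly complex_of_real p + map_poly complex_of_real q"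
  "map_poly complex_of_real (p - q) = map_poly complex_of_real p - map_poly complex_of_real q"
  "map_poly complex_of_real (p * q) = map_poly complex_of_real p * map_poly complex_of_real q"
  by (simp_all add: poly_eq_iff coeff_map_poly coeff_mult)

lemma poly_map_poly_of_real: "poly (map_poly complex_of_real p) (complex_of_real r) = complex_of_real (poly p r)"
  by (induction p) (simp_all add: map_poly_pCons)

lemma bounded_clinear_poly_op: "bounded_clinear A \<Longrightarrow> bounded_clinear (poly_op p A)"
  using bounded_clinear_cpoly_op[of A "map_poly complex_of_real p"] by (simp add: poly_op_eq[abs_def])

lemma poly_op_add: "poly_op (p + q) A x = poly_op p A x + poly_op q A x"
  by (simp add: poly_op_eq map_poly_of_real_simps cpoly_op_add)

lemma poly_op_diff: "poly_op (p - q) A x = poly_op p A x - poly_op q A x"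
  using poly_op_add[of "p - q" q A x] by simp

lemma poly_op_mult: "bounded_clinear A \<Longrightarrow> poly_op (p * q) A x = poly_op p A (poly_op q A x)"
  by (simp add: poly_op_eq map_poly_of_real_simps cpoly_op_mult)

lemma poly_op_pCons: "bounded_clinear A \<Longrightarrow> poly_op (pCons a p) A x = a *\<^sub>R x + A (poly_op p A x)"
  by (cases "pCons a p = 0") (simp_all add: poly_op_eq map_poly_pCons cpoly_op_pCons scaleR_scaleC bounded_clinear_zero)

lemma poly_op_0 [simp]: "poly_op 0 A x = 0"
  by (simp add: poly_op_eq)

lemma poly_op_kernel:
  assumes A: "bounded_clinear A" and x: "A x = 0"
  shows "poly_op p A x = poly p 0 *\<^sub>R x"
proof (cases p)
  case (pCons a q)
  have "A (poly_op q A x) = poly_op ([:0, 1:] * q) A x"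
    by (simp add: poly_op_pCons[OF A])
  also have "\<dots> = poly_op q A (A x)"
    unfolding mult.commute[of "[:0, 1:]"] poly_op_mult[OF A] by (simp add: poly_op_pCons[OF A] bounded_clinear_zero[OF A])
  finally show ?thesis
    using x by (simp add: pCons poly_op_pCons[OF A] bounded_clinear_zero[OF bounded_clinear_poly_op[OF A]])
qed

lemma selfadj_poly_op:
  assumes A: "selfadj A"
  shows "selfadj (poly_op p A)"
proof -
  have "inner ((A ^^ k) x) y = inner x ((A ^^ k) y)" for k x y
    by (induction k arbitrary: x y) (simp_all add: selfadj_inner[OF A] funpow_swap1)
  then have "inner (poly_op p A x) y = inner x (poly_op p A y)" for x y
    by (simp add: poly_op_def inner_sum_left inner_sum_right)
  then show ?thesis
    using A by (simp add: selfadj_def bounded_clinear_poly_op)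
qed

text \<open>A self-adjoint \<open>B\<close> has \<open>\<plusminus>\<parallel>B\<parallel>\<close> in its spectrum; for \<open>B = p(A)\<close>, factoring \<open>p \<mp> \<parallel>B\<parallel>\<close> into linear factors
  yields a point of the spectrum of \<open>A\<close> at which \<open>p\<close> takes that value.\<close>

lemma selfadj_poly_op_bound:
  fixes A :: "'h::chilbert_space \<Rightarrow> 'h"
  assumes A: "selfadj A" and K: "K \<ge> 0" and bound: "\<And>r. r \<in> real_spectrum A \<Longrightarrow> \<bar>poly p r\<bar> \<le> K"
  shows "norm (poly_op p A x) \<le> K * norm x"
proof (cases "x = 0")
  case True
  then show ?thesis
    using bounded_clinear_zero[OF bounded_clinear_poly_op[OF selfadj_bounded_clinear[OF A]]] by simp
next
  case x: False
  let ?B = "poly_op p A"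
  note cA = selfadj_bounded_clinear[OF A]
  note B = selfadj_poly_op[OF A, of p]
  have "complex_of_real (onorm ?B) \<in> spectrum ?B \<or> complex_of_real (- onorm ?B) \<in> spectrum ?B"
    by (rule selfadj_onorm_in_spectrum[OF B x])
  then obtain \<mu> where \<mu>: "\<bar>\<mu>\<bar> = \<bar>onorm ?B\<bar>" "complex_of_real \<mu> \<in> spectrum ?B"
    by (metis abs_minus_cancel)
  have "\<exists>r \<in> real_spectrum A. poly p r = \<mu>"
  proof (rule ccontr)
    assume no: "\<not> ?thesis"
    define q where "q = map_poly complex_of_real (p - [:\<mu>:])"
    have "poly_op (p - [:\<mu>:]) A y = ?B y - complex_of_real \<mu> *\<^sub>C y" for y
      by (simp add: poly_op_diff poly_op_pCons[OF cA] bounded_clinear_zero[OF cA] scaleR_scaleC)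
    then have q: "cpoly_op q A y = ?B y - complex_of_real \<mu> *\<^sub>C y" for y
      by (simp add: q_def flip: poly_op_eq)
    \<comment> \<open>If \<open>p\<close> were the constant \<open>\<mu>\<close>, any point of the
      real spectrum would do, and there is one because \<open>x\<close> is nonzero.\<close>
    have "q \<noteq> 0"
    proof
      assume "q = 0"
      then have "p - [:\<mu>:] = 0" unfolding q_def by (subst (asm) map_poly_eq_0_iff) auto
      then have p: "p = [:\<mu>:]" by simp
      have "\<exists>r. r \<in> real_spectrum A"
        using selfadj_onorm_in_spectrum[OF A x] unfolding real_spectrum_def by blast
      then show False using no p by auto
    qed
    moreover have "z \<notin> spectrum A" if "poly q z = 0" for z
    proof
      assume z: "z \<in> spectrum A"
      then have zr: "z = complex_of_real (Re z)" by (rule selfadj_spectrum_real[OF A])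
      then have "Re z \<in> real_spectrum A" using z by (simp add: real_spectrum_def)
      moreover have "poly p (Re z) = \<mu>"
        using that poly_map_poly_of_real[of "p - [:\<mu>:]" "Re z"] unfolding q_def zr[symmetric] by simp
      ultimately show False using no by blast
    qed
    ultimately obtain C where "bounded_clinear C" "\<forall>y. C (cpoly_op q A y) = y" "\<forall>y. cpoly_op q A (C y) = y"
      using cpoly_op_invertible[OF cA] by blast
    then show False using \<mu>(2) unfolding q spectrum_def by blast
  qed
  then have "\<bar>onorm ?B\<bar> \<le> K" using bound \<mu>(1) by fastforce
  then have "onorm ?B * norm x \<le> K * norm x" by (intro mult_right_mono) auto
  moreover have "norm (?B x) \<le> onorm ?B * norm x"
    using B by (intro onorm bounded_clinear_bounded_linear selfadj_bounded_clinear)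
  ultimately show ?thesis by linarith
qed

section \<open>The continuous functional calculus of a positive operator\<close>

lemma Weierstrass_poly:
  fixes f :: "real \<Rightarrow> real"
  assumes "continuous_on {a..b} f"
  obtains p where "uniform_limit {a..b} (\<lambda>n. poly (p n)) f sequentially"
proof -
  have "\<exists>p. \<forall>x\<in>{a..b}. \<bar>f x - poly p x\<bar> < 1 / real (Suc n)" for n
  proof -
    obtain g where g: "real_polynomial_function g" "\<And>x. x \<in> {a..b} \<Longrightarrow> \<bar>f x - g x\<bar> < 1 / real (Suc n)"
      using Stone_Weierstrass_real_polynomial_function[OF compact_Icc assms, of "1 / real (Suc n)"] by auto
    obtain c m where "g = (\<lambda>x. \<Sum>i\<le>m. c i * x ^ i)"
      using g(1) unfolding real_polynomial_function_iff_sum by blast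
    then have "g = poly (\<Sum>i\<le>m. monom (c i) i)" by (simp add: fun_eq_iff poly_sum poly_monom)
    then show ?thesis using g(2) by blast
  qed
  then obtain p where p: "\<And>n x. x \<in> {a..b} \<Longrightarrow> \<bar>f x - poly (p n) x\<bar> < 1 / real (Suc n)" by metis
  have "uniform_limit {a..b} (\<lambda>n. poly (p n)) f sequentially"
  proof (rule uniform_limitI)
    fix e :: real assume "e > 0"
    then obtain N where N: "1 / real (Suc N) < e" using nat_approx_posE by blast
    have "\<forall>x\<in>{a..b}. dist (poly (p n) x) (f x) < e" if "n \<ge> N" for n
    proof
      fix x assume "x \<in> {a..b}"
      then have "\<bar>f x - poly (p n) x\<bar> < 1 / real (Suc n)" by (rule p)
      also have "\<dots> \<le> 1 / real (Suc N)" using that by (simp add: frac_le)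
      finally show "dist (poly (p n) x) (f x) < e" using N by (simp add: dist_real_def abs_minus_commute)
    qed
    then show "\<forall>\<^sub>F n in sequentially. \<forall>x\<in>{a..b}. dist (poly (p n) x) (f x) < e"
      unfolding eventually_sequentially by blast
  qed
  then show thesis by (rule that)
qed

text \<open>The bound for polynomials turns closeness on the spectrum into closeness in operator
  norm. With \<open>q = p\<close> this is the Cauchy property; with two sequences it shows that the
  limit does not depend on the approximation.\<close>

lemma posop_uniform_limit_close:
  assumes A: "posop A"
    and p: "uniform_limit (real_spectrum A) (\<lambda>n. poly (p n)) f sequentially"
    and q: "uniform_limit (real_spectrum A) (\<lambda>n. poly (q n)) f sequentially" and e: "e > 0"
  shows "\<exists>N. \<forall>m\<ge>N. \<forall>n\<ge>N. \<forall>x. norm (poly_op (p m) A x - poly_op (q n) A x) \<le> e * norm x"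
proof -
  have e2: "e / 2 > 0" using e by simp
  obtain N1 where N1: "\<And>n r. n \<ge> N1 \<Longrightarrow> r \<in> real_spectrum A \<Longrightarrow> dist (poly (p n) r) (f r) < e / 2"
    using uniform_limitD[OF p e2] unfolding eventually_sequentially by blast
  obtain N2 where N2: "\<And>n r. n \<ge> N2 \<Longrightarrow> r \<in> real_spectrum A \<Longrightarrow> dist (poly (q n) r) (f r) < e / 2"
    using uniform_limitD[OF q e2] unfolding eventually_sequentially by blast
  have "norm (poly_op (p m) A x - poly_op (q n) A x) \<le> e * norm x" if mn: "m \<ge> max N1 N2" "n \<ge> max N1 N2" for m n x
  proof -
    have "\<bar>poly (p m - q n) r\<bar> \<le> e" if "r \<in> real_spectrum A" for r
    proof -
      have "dist (poly (p m) r) (poly (q n) r) \<le> e / 2 + e / 2"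
        using N1[of m r] N2[of n r] mn that
        by (intro order.trans[OF dist_triangle2[where z = "f r"]] add_mono less_imp_le) auto
      then show ?thesis by (simp add: dist_real_def)
    qed
    then have "norm (poly_op (p m - q n) A x) \<le> e * norm x"
      using e by (intro selfadj_poly_op_bound posop_selfadj[OF A]) auto
    then show ?thesis by (simp add: poly_op_diff)
  qed
  then show ?thesis by blast
qed

lemma onorm_tendsto_0_apply:
  assumes F: "\<And>n. bounded_linear (F n)" and lim: "(\<lambda>n. onorm (F n)) \<longlonglongrightarrow> 0" and y: "y \<longlonglongrightarrow> x"
  shows "(\<lambda>n. F n (y n)) \<longlonglongrightarrow> 0"
proof (rule Lim_null_comparison)
  show "\<forall>\<^sub>F n in sequentially. norm (F n (y n)) \<le> onorm (F n) * norm (y n)"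
    using F by (intro always_eventually allI onorm)
  show "(\<lambda>n. onorm (F n) * norm (y n)) \<longlonglongrightarrow> 0"
    using tendsto_mult[OF lim tendsto_norm[OF y]] by simp
qed

text \<open>Discharges the definite description: the limit \<open>B\<close> along one approximating
  sequence serves for all of them. The convergence statement is given for approximation on the
  interval around the spectrum, which is what Weierstrass supplies.\<close>

lemma cfc_posop:
  fixes A :: "'h::chilbert_space \<Rightarrow> 'h"
  assumes A: "posop A" and f: "continuous_on {0..} f"
  shows bounded_clinear_cfc: "bounded_clinear (cfc f A)"
    and cfc_onorm_tendsto: "\<And>p. uniform_limit {0..onorm A} (\<lambda>n. poly (p n)) f sequentially \<Longrightarrow>
      (\<lambda>n. onorm (\<lambda>x. poly_op (p n) A x - cfc f A x)) \<longlonglongrightarrow> 0"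
proof -
  let ?S = "real_spectrum A"
  note cA = selfadj_bounded_clinear[OF posop_selfadj[OF A]]
  note cp = bounded_clinear_poly_op[OF cA]
  have "continuous_on {0..onorm A} f" using f by (rule continuous_on_subset) auto
  then obtain p where "uniform_limit {0..onorm A} (\<lambda>n. poly (p n)) f sequentially" by (rule Weierstrass_poly)
  then have p: "uniform_limit ?S (\<lambda>n. poly (p n)) f sequentially"
    using posop_real_spectrum[OF A] by (rule uniform_limit_on_subset)
  have "convergent (\<lambda>n. poly_op (p n) A x)" for x
  proof -
    have "Cauchy (\<lambda>n. poly_op (p n) A x)"
    proof (rule metric_CauchyI)
      fix e :: real assume e: "e > 0"
      then have "e / (norm x + 1) > 0" by (simp add: add_nonneg_pos)
      then obtain N where N: "\<forall>m\<ge>N. \<forall>n\<ge>N. \<forall>x'. norm (poly_op (p m) A x' - poly_op (p n) A x') \<le> e / (norm x + 1) * norm x'"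
        using posop_uniform_limit_close[OF A p p] by blast
      have "e / (norm x + 1) * norm x < e" using e by (simp add: divide_simps add_nonneg_pos)
      then show "\<exists>M. \<forall>m\<ge>M. \<forall>n\<ge>M. dist (poly_op (p m) A x) (poly_op (p n) A x) < e"
        using N unfolding dist_norm by (meson le_less_trans)
    qed
    then show ?thesis by (simp add: Cauchy_convergent_iff)
  qed
  then obtain B where B: "\<And>x. (\<lambda>n. poly_op (p n) A x) \<longlonglongrightarrow> B x" unfolding convergent_def by metis
  have close: "\<exists>N. \<forall>n\<ge>N. \<forall>x. norm (poly_op (q n) A x - B x) \<le> e * norm x"
    if q: "uniform_limit ?S (\<lambda>n. poly (q n)) f sequentially" and e: "e > 0" for q e
  proof -
    obtain N where N: "\<forall>m\<ge>N. \<forall>n\<ge>N. \<forall>x. norm (poly_op (q m) A x - poly_op (p n) A x) \<le> e * norm x"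
      using posop_uniform_limit_close[OF A q p e] by blast
    have "norm (poly_op (q m) A x - B x) \<le> e * norm x" if "m \<ge> N" for m x
    proof (rule LIMSEQ_le_const2)
      show "(\<lambda>n. norm (poly_op (q m) A x - poly_op (p n) A x)) \<longlonglongrightarrow> norm (poly_op (q m) A x - B x)"
        by (intro tendsto_intros B)
      show "\<exists>N. \<forall>n\<ge>N. norm (poly_op (q m) A x - poly_op (p n) A x) \<le> e * norm x"
        using N that by blast
    qed
    then show ?thesis by blast
  qed
  have cB: "bounded_clinear B"
  proof -
    obtain N where N: "\<And>x. norm (poly_op (p N) A x - B x) \<le> norm x"
      using close[OF p, of 1] by auto
    obtain K where K: "\<And>x. norm (poly_op (p N) A x) \<le> K * norm x"
      using bounded_clinear_bound[OF cp] by blast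
    show ?thesis
    proof (rule bounded_clinear_intro[where K = "K + 1"])
      show "B (x + y) = B x + B y" for x y
      proof (rule LIMSEQ_unique[OF B])
        show "(\<lambda>n. poly_op (p n) A (x + y)) \<longlonglongrightarrow> B x + B y"
          unfolding bounded_clinear_add[OF cp] by (intro tendsto_intros B)
      qed
      show "B (c *\<^sub>C x) = c *\<^sub>C B x" for c x
      proof (rule LIMSEQ_unique[OF B])
        show "(\<lambda>n. poly_op (p n) A (c *\<^sub>C x)) \<longlonglongrightarrow> c *\<^sub>C B x"
          unfolding bounded_clinear_scale[OF cp] by (rule bounded_clinear_tendsto[OF bounded_clinear_scaleC B])
      qed
      show "norm (B x) \<le> (K + 1) * norm x" for x
        using K[of x] N[of x] norm_triangle_ineq2[of "B x" "poly_op (p N) A x"]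
        by (simp add: norm_minus_commute algebra_simps)
    qed
  qed
  have on: "(\<lambda>n. onorm (\<lambda>x. poly_op (q n) A x - B x)) \<longlonglongrightarrow> 0"
    if q: "uniform_limit ?S (\<lambda>n. poly (q n)) f sequentially" for q
  proof (rule LIMSEQ_I)
    fix e :: real assume e: "e > 0"
    then obtain N where N: "\<And>n x. n \<ge> N \<Longrightarrow> norm (poly_op (q n) A x - B x) \<le> e / 2 * norm x"
      using close[OF q, of "e / 2"] by auto
    have "norm (onorm (\<lambda>x. poly_op (q n) A x - B x) - 0) < e" if "n \<ge> N" for n
    proof -
      have "onorm (\<lambda>x. poly_op (q n) A x - B x) \<le> e / 2" using N[OF that] e by (intro onorm_bound) auto
      moreover have "0 \<le> onorm (\<lambda>x. poly_op (q n) A x - B x)"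
        by (intro onorm_pos_le bounded_clinear_bounded_linear bounded_clinear_minus cp cB)
      ultimately show ?thesis using e by simp
    qed
    then show "\<exists>N. \<forall>n\<ge>N. norm (onorm (\<lambda>x. poly_op (q n) A x - B x) - 0) < e" by blast
  qed
  have "cfc f A = B"
    unfolding cfc_def real_spectrum_def[symmetric]
  proof (rule the_equality)
    show "bounded_clinear B \<and> (\<forall>p. uniform_limit ?S (\<lambda>n. poly (p n)) f sequentially \<longrightarrow>
      (\<lambda>n. onorm (\<lambda>x. poly_op (p n) A x - B x)) \<longlonglongrightarrow> 0)" using cB on by blast
    fix B' assume B': "bounded_clinear B' \<and> (\<forall>p. uniform_limit ?S (\<lambda>n. poly (p n)) f sequentially \<longrightarrow>
      (\<lambda>n. onorm (\<lambda>x. poly_op (p n) A x - B' x)) \<longlonglongrightarrow> 0)"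
    show "B' = B"
    proof
      fix x :: 'h
      \<comment> \<open>The sequence \<open>p\<close> pins \<open>B'\<close> down; without any
        approximating sequence the condition on \<open>B'\<close> would be vacuous.\<close>
      have "(\<lambda>n. onorm (\<lambda>x. poly_op (p n) A x - B' x)) \<longlonglongrightarrow> 0" using B' p by blast
      then have "(\<lambda>n. poly_op (p n) A x - B' x) \<longlonglongrightarrow> 0"
        using B' cp by (intro onorm_tendsto_0_apply[where F = "\<lambda>n x. poly_op (p n) A x - B' x", OF _ _ tendsto_const]
          bounded_clinear_bounded_linear bounded_clinear_minus) auto
      then have "(\<lambda>n. poly_op (p n) A x) \<longlonglongrightarrow> B' x" by (simp add: LIM_zero_iff)
      then show "B' x = B x" using B LIMSEQ_unique by blast
    qed
  qed
  then show "bounded_clinear (cfc f A)" using cB by simp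
  show "(\<lambda>n. onorm (\<lambda>x. poly_op (p n) A x - cfc f A x)) \<longlonglongrightarrow> 0"
    if "uniform_limit {0..onorm A} (\<lambda>n. poly (p n)) f sequentially" for p
    using on[OF uniform_limit_on_subset[OF that posop_real_spectrum[OF A]]] \<open>cfc f A = B\<close> by simp
qed

text \<open>The argument moves along with the polynomial, so that in the product rule
  \<open>p n\<close> can be applied to \<open>poly_op (q n) A x\<close>.\<close>

lemma cfc_tendsto_convergent:
  assumes A: "posop A" and f: "continuous_on {0..} f"
    and p: "uniform_limit {0..onorm A} (\<lambda>n. poly (p n)) f sequentially" and y: "y \<longlonglongrightarrow> x"
  shows "(\<lambda>n. poly_op (p n) A (y n)) \<longlonglongrightarrow> cfc f A x"
proof -
  note cA = selfadj_bounded_clinear[OF posop_selfadj[OF A]]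
  note cB = bounded_clinear_cfc[OF A f]
  have "(\<lambda>n. poly_op (p n) A (y n) - cfc f A (y n)) \<longlonglongrightarrow> 0"
    by (intro onorm_tendsto_0_apply[where F = "\<lambda>n x. poly_op (p n) A x - cfc f A x", OF _ _ y]
        cfc_onorm_tendsto[OF A f p] bounded_clinear_bounded_linear bounded_clinear_minus
        bounded_clinear_poly_op cA cB)
  then have "(\<lambda>n. poly_op (p n) A (y n) - cfc f A (y n) + cfc f A (y n)) \<longlonglongrightarrow> 0 + cfc f A x"
    by (intro tendsto_add bounded_clinear_tendsto[OF cB y])
  then show ?thesis by simp
qed

lemmas cfc_tendsto = cfc_tendsto_convergent[OF _ _ _ tendsto_const]

lemma cfc_approx:
  assumes A: "posop A" and f: "continuous_on {0..} f"
  obtains p where "uniform_limit {0..onorm A} (\<lambda>n. poly (p n)) f sequentially"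
  using Weierstrass_poly[OF continuous_on_subset[OF f]] by (metis atLeastAtMost_iff atLeast_iff subsetI)

lemma cfc_cong:
  assumes A: "posop A" and f: "continuous_on {0..} f" and g: "continuous_on {0..} g"
    and eq: "\<And>r. r \<ge> 0 \<Longrightarrow> f r = g r"
  shows "cfc f A x = cfc g A x"
proof -
  obtain p where p: "uniform_limit {0..onorm A} (\<lambda>n. poly (p n)) f sequentially" by (rule cfc_approx[OF A f])
  then have "uniform_limit {0..onorm A} (\<lambda>n. poly (p n)) g sequentially"
    using eq by (subst (asm) uniform_limit_cong'[where i = g and g = "\<lambda>n. poly (p n)"]) auto
  then show ?thesis using LIMSEQ_unique[OF cfc_tendsto[OF A f p] cfc_tendsto[OF A g]] by blast
qed

lemma cfc_mult:
  assumes A: "posop A" and f: "continuous_on {0..} f" and g: "continuous_on {0..} g"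
  shows "cfc f A (cfc g A x) = cfc (\<lambda>r. f r * g r) A x"
proof -
  obtain p where p: "uniform_limit {0..onorm A} (\<lambda>n. poly (p n)) f sequentially" by (rule cfc_approx[OF A f])
  obtain q where q: "uniform_limit {0..onorm A} (\<lambda>n. poly (q n)) g sequentially" by (rule cfc_approx[OF A g])
  \<comment> \<open>Uniform convergence passes to products when the limit functions are bounded, as
    they are on a compact interval.\<close>
  have "bounded (h ` {0..onorm A})" if "continuous_on {0..} h" for h :: "real \<Rightarrow> real"
    by (intro compact_imp_bounded compact_continuous_image continuous_on_subset[OF that] compact_Icc) auto
  then have pq: "uniform_limit {0..onorm A} (\<lambda>n. poly (p n * q n)) (\<lambda>r. f r * g r) sequentially"
    using uniform_lim_mult[OF p q] f g by (simp add: poly_mult[abs_def])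
  have fg: "continuous_on {0..} (\<lambda>r. f r * g r)" by (intro continuous_intros f g)
  have "(\<lambda>n. poly_op (p n) A (poly_op (q n) A x)) \<longlonglongrightarrow> cfc f A (cfc g A x)"
    by (intro cfc_tendsto_convergent[OF A f p] cfc_tendsto[OF A g q])
  moreover have "(\<lambda>n. poly_op (p n) A (poly_op (q n) A x)) \<longlonglongrightarrow> cfc (\<lambda>r. f r * g r) A x"
    using cfc_tendsto[OF A fg pq, of x] posop_selfadj[OF A] by (simp add: poly_op_mult selfadj_bounded_clinear)
  ultimately show ?thesis by (rule LIMSEQ_unique)
qed

lemma cfc_ident:
  assumes A: "posop A"
  shows "cfc (\<lambda>r. r) A x = A x"
proof -
  have cA: "bounded_clinear A" using A by (simp add: posop_selfadj selfadj_bounded_clinear)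
  have "uniform_limit {0..onorm A} (\<lambda>n. poly [:0, 1:]) (\<lambda>r. r) sequentially"
    by (rule uniform_limitI) simp
  then have "(\<lambda>n::nat. poly_op [:0, 1:] A x) \<longlonglongrightarrow> cfc (\<lambda>r. r) A x"
    by (intro cfc_tendsto[OF A]) (auto intro: continuous_intros)
  then show ?thesis
    by (simp add: poly_op_pCons[OF cA] bounded_clinear_zero[OF cA] LIMSEQ_const_iff)
qed

lemma selfadj_cfc:
  assumes A: "posop A" and f: "continuous_on {0..} f"
  shows "selfadj (cfc f A)"
  unfolding selfadj_def
proof (intro conjI allI bounded_clinear_cfc[OF A f])
  fix x y
  obtain p where p: "uniform_limit {0..onorm A} (\<lambda>n. poly (p n)) f sequentially" by (rule cfc_approx[OF A f])
  have "(\<lambda>n. inner (poly_op (p n) A x) y) \<longlonglongrightarrow> inner (cfc f A x) y"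
    "(\<lambda>n. inner x (poly_op (p n) A y)) \<longlonglongrightarrow> inner x (cfc f A y)"
    by (intro tendsto_intros cfc_tendsto[OF A f p])+
  then show "inner (cfc f A x) y = inner x (cfc f A y)"
    using LIMSEQ_unique selfadj_inner[OF selfadj_poly_op[OF posop_selfadj[OF A]]] by simp
qed

text \<open>The operator is the square of the self-adjoint
  \<open>cfc (\<lambda>r. sqrt (f r)) A\<close>.\<close>

lemma posop_cfc:
  assumes A: "posop A" and f: "continuous_on {0..} f" and pos: "\<And>r. r \<ge> 0 \<Longrightarrow> 0 \<le> f r"
  shows "posop (cfc f A)"
  unfolding posop_def
proof (intro conjI allI selfadj_cfc[OF A f])
  fix x
  have g: "continuous_on {0..} (\<lambda>r. sqrt (f r))" by (intro continuous_intros f)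
  have "cfc f A x = cfc (\<lambda>r. sqrt (f r) * sqrt (f r)) A x"
    using pos by (intro cfc_cong[OF A f]) (auto intro: continuous_intros f)
  also have "\<dots> = cfc (\<lambda>r. sqrt (f r)) A (cfc (\<lambda>r. sqrt (f r)) A x)" by (rule cfc_mult[OF A g g, symmetric])
  finally have "inner (cfc f A x) x = inner (cfc (\<lambda>r. sqrt (f r)) A x) (cfc (\<lambda>r. sqrt (f r)) A x)"
    by (simp add: selfadj_inner[OF selfadj_cfc[OF A g]])
  then show "0 \<le> inner (cfc f A x) x" by simp
qed

text \<open>A polynomial acts on the kernel through its value at \<open>0\<close>, and
  \<open>0\<close> belongs to the interval of approximation. For \<open>r powr t\<close> the value
  is \<open>0\<close>, which puts the kernel of \<open>P\<close> into that of its power.\<close>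

lemma cfc_kernel:
  assumes A: "posop A" and f: "continuous_on {0..} f" and x: "A x = 0"
  shows "cfc f A x = f 0 *\<^sub>R x"
proof -
  have bA: "bounded_clinear A" using A by (simp add: posop_selfadj selfadj_bounded_clinear)
  obtain p where p: "uniform_limit {0..onorm A} (\<lambda>n. poly (p n)) f sequentially" by (rule cfc_approx[OF A f])
  have "0 \<in> {0..onorm A}" using onorm_pos_le[OF bounded_clinear_bounded_linear[OF bA]] by simp
  then have "(\<lambda>n. poly (p n) 0) \<longlonglongrightarrow> f 0" using tendsto_uniform_limitI[OF p] by blast
  then have "(\<lambda>n. poly (p n) 0 *\<^sub>R x) \<longlonglongrightarrow> f 0 *\<^sub>R x" by (intro tendsto_intros)
  moreover have "(\<lambda>n. poly (p n) 0 *\<^sub>R x) \<longlonglongrightarrow> cfc f A x"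
    using cfc_tendsto[OF A f p, of x] by (simp add: poly_op_kernel[OF bA x])
  ultimately show ?thesis using LIMSEQ_unique by blast
qed

section \<open>Complex-linear maps\<close>

text \<open>From here up to the polar decomposition everything is algebra without norms, so ranges
  need not be closed.\<close>

abbreviation clinear :: "('a::complex_vector \<Rightarrow> 'b::complex_vector) \<Rightarrow> bool"
  where "clinear \<equiv> Vector_Spaces.linear scaleC scaleC"

lemma clinearI:
  assumes "\<And>x y. f (x + y) = f x + f y" and "\<And>c x. f (c *\<^sub>C x) = c *\<^sub>C f x"
  shows "clinear f"
  using assms by (simp add: Vector_Spaces.linear_iff cvs.vector_space_axioms)

lemma clinear_add: "clinear f \<Longrightarrow> f (x + y) = f x + f y"
  and clinear_scale: "clinear f \<Longrightarrow> f (c *\<^sub>C x) = c *\<^sub>C f x"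
  by (simp_all add: Vector_Spaces.linear_iff)

lemma clinear_zero: "clinear f \<Longrightarrow> f 0 = 0"
  by (metis clinear_scale cvs.scale_zero_left)

lemma clinear_diff: "clinear f \<Longrightarrow> f (x - y) = f x - f y"
  by (metis add_diff_cancel clinear_add diff_add_cancel)

lemma clinear_sum: "clinear f \<Longrightarrow> f (sum g S) = (\<Sum>x\<in>S. f (g x))"
  by (induction S rule: infinite_finite_induct) (simp_all add: clinear_zero clinear_add)

lemma clinear_sum_scale: "clinear f \<Longrightarrow> f (\<Sum>x\<in>S. c x *\<^sub>C g x) = (\<Sum>x\<in>S. c x *\<^sub>C f (g x))"
  by (simp add: clinear_sum clinear_scale)

lemma subspace_clinear_image:
  assumes "clinear f" "cvs.subspace X" shows "cvs.subspace (f ` X)"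
  unfolding cvs.subspace_def
proof (intro conjI ballI allI)
  show "0 \<in> f ` X" using assms by (metis clinear_zero cvs.subspace_0 image_eqI)
  show "x + y \<in> f ` X" if "x \<in> f ` X" "y \<in> f ` X" for x y
    using that assms(2) by (auto simp: clinear_add[OF assms(1), symmetric] cvs.subspace_add)
  show "c *\<^sub>C x \<in> f ` X" if "x \<in> f ` X" for c x
    using that assms(2) by (auto simp: clinear_scale[OF assms(1), symmetric] cvs.subspace_scale)
qed

lemma subspace_clinear_Collect:
  assumes "clinear f" "cvs.subspace X" shows "cvs.subspace {x \<in> X. f x = 0}"
  using assms by (auto simp: cvs.subspace_def clinear_zero clinear_add clinear_scale)

section \<open>Dimensions of quotient spaces\<close>

definition qindep :: "'a::complex_vector set \<Rightarrow> 'a set \<Rightarrow> bool"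
  where "qindep B S \<longleftrightarrow> finite S \<and> (\<forall>c. (\<Sum>s\<in>S. c s *\<^sub>C s) \<in> B \<longrightarrow> (\<forall>s\<in>S. c s = 0))"

text \<open>A relation and not a number: it asserts finiteness together with the dimension, whereas
  \<open>quotient_dim\<close> has a value even when no finite basis exists.\<close>

definition qdim :: "'a::complex_vector set \<Rightarrow> 'a set \<Rightarrow> nat \<Rightarrow> bool"
  where "qdim Z B n \<longleftrightarrow> (\<exists>S. quotient_basis Z B S \<and> card S = n)"

lemma quotient_basis_iff:
  "quotient_basis Z B S \<longleftrightarrow> qindep B S \<and> S \<subseteq> Z \<and> (\<forall>z\<in>Z. \<exists>c. z - (\<Sum>s\<in>S. c s *\<^sub>C s) \<in> B)"
  by (auto simp: quotient_basis_def qindep_def)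

lemma qindepD: "qindep B S \<Longrightarrow> (\<Sum>s\<in>S. c s *\<^sub>C s) \<in> B \<Longrightarrow> s \<in> S \<Longrightarrow> c s = 0"
  unfolding qindep_def by blast

lemma qindep_diff_notin:
  assumes "qindep B S" "s \<in> S" "t \<in> S" "s \<noteq> t"
  shows "s - t \<notin> B"
proof
  assume "s - t \<in> B"
  let ?c = "\<lambda>x. if x = s then 1 else if x = t then - 1 else 0 :: complex"
  have "(\<Sum>x\<in>S. ?c x *\<^sub>C x) = (\<Sum>x\<in>{s, t}. ?c x *\<^sub>C x)"
    using assms by (intro sum.mono_neutral_right) (auto simp: qindep_def)
  also have "\<dots> = s - t" using assms by simp
  finally have "(\<Sum>x\<in>S. ?c x *\<^sub>C x) \<in> B" using \<open>s - t \<in> B\<close> by simp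
  then have "?c s = 0" using assms(1,2) qindepD[where c = ?c] by blast
  then show False by simp
qed

lemma qdimE:
  assumes "qdim Z B n"
  obtains S where "qindep B S" "S \<subseteq> Z" "\<forall>z\<in>Z. \<exists>c. z - (\<Sum>s\<in>S. c s *\<^sub>C s) \<in> B"
    "card S = n"
  using assms that unfolding qdim_def quotient_basis_iff by blast

lemma qdimI:
  assumes "qindep B S" "S \<subseteq> Z" "\<forall>z\<in>Z. \<exists>c. z - (\<Sum>s\<in>S. c s *\<^sub>C s) \<in> B"
    "card S = n"
  shows "qdim Z B n"
  unfolding qdim_def quotient_basis_iff using assms by (intro exI[of _ S] conjI)

lemma sum_delta_scaleC:
  "finite S \<Longrightarrow> s \<in> S \<Longrightarrow> (\<Sum>x\<in>S. (if x = s then 1 else 0) *\<^sub>C x) = s"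
  by (subst sum.remove[of _ s]) (auto simp: scaleC_one intro!: sum.neutral)

text \<open>Steinitz exchange modulo \<open>B\<close>: each \<open>s\<close> is replaced by a
  congruent combination \<open>g s\<close> of \<open>S'\<close>. The \<open>g s\<close> stay
  distinct and independent, and they lie in an honest span.\<close>

lemma qindep_card_le:
  assumes B: "cvs.subspace B" and S: "qindep B S" and S': "finite S'"
    and gen: "\<forall>s\<in>S. \<exists>c. s - (\<Sum>x\<in>S'. c x *\<^sub>C x) \<in> B"
  shows "card S \<le> card S'"
proof -
  obtain c where c: "\<forall>s\<in>S. s - (\<Sum>x\<in>S'. c s x *\<^sub>C x) \<in> B" using gen by metis
  define g where "g s = (\<Sum>x\<in>S'. c s x *\<^sub>C x)" for s
  have gB: "s - g s \<in> B" if "s \<in> S" for s using c that by (simp add: g_def)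
  have fin: "finite S" using S by (simp add: qindep_def)
  have inj: "inj_on g S"
  proof (rule inj_onI, rule ccontr)
    fix s t assume st: "s \<in> S" "t \<in> S" "g s = g t" "s \<noteq> t"
    have "(s - g s) - (t - g t) \<in> B" using st B by (intro cvs.subspace_diff gB)
    then show False using qindep_diff_notin[OF S] st by simp
  qed
  have indep: "cvs.independent (g ` S)"
  proof
    assume "cvs.dependent (g ` S)"
    then obtain u v where v: "v \<in> g ` S" "u v \<noteq> 0" and u: "(\<Sum>v\<in>g ` S. u v *\<^sub>C v) = 0"
      using fin by (auto simp: cvs.dependent_finite)
    have u': "(\<Sum>s\<in>S. u (g s) *\<^sub>C g s) = 0" using u inj by (simp add: sum.reindex)
    have "(\<Sum>s\<in>S. u (g s) *\<^sub>C (s - g s)) \<in> B"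
      using B by (intro cvs.subspace_sum cvs.subspace_scale gB)
    then have "(\<Sum>s\<in>S. u (g s) *\<^sub>C s) \<in> B"
      using u' by (simp add: cvs.scale_right_diff_distrib sum_subtractf)
    then have "\<forall>s\<in>S. u (g s) = 0" using S qindepD[where c = "\<lambda>s. u (g s)"] by blast
    then show False using v by auto
  qed
  have "g ` S \<subseteq> cvs.span S'"
    by (auto simp: g_def intro: cvs.span_sum cvs.span_scale cvs.span_base)
  then have "card (g ` S) \<le> card S'" using cvs.independent_span_bound[OF S' indep] by blast
  then show ?thesis using inj by (simp add: card_image)
qed

lemma qdim_bound:
  assumes "cvs.subspace B" "qdim Z B n" "qindep B S" "S \<subseteq> Z"
  shows "card S \<le> n"
  using assms qindep_card_le[of B S] unfolding qdim_def quotient_basis_iff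
  by (metis qindep_def subset_eq)

lemma qdim_unique:
  assumes "cvs.subspace B" "qdim Z B m" "qdim Z B n"
  shows "m = n"
proof -
  have "m \<le> n" if "qdim Z B m" "qdim Z B n" for m n
    using that(1) qdim_bound[OF assms(1) that(2)] by (auto simp: qdim_def quotient_basis_iff)
  then show ?thesis using assms by (meson le_antisym)
qed

lemma quotient_finite_dim_iff: "quotient_finite_dim Z B \<longleftrightarrow> (\<exists>n. qdim Z B n)"
  by (auto simp: quotient_finite_dim_def qdim_def)

lemma quotient_dim_eq:
  assumes "cvs.subspace B" "qdim Z B n"
  shows "quotient_dim Z B = n"
proof -
  have "quotient_basis Z B (SOME S. quotient_basis Z B S)"
    using assms(2) by (auto simp: qdim_def intro: someI)
  then have "qdim Z B (quotient_dim Z B)" by (auto simp: qdim_def quotient_dim_def)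
  then show ?thesis using qdim_unique assms by blast
qed

text \<open>An independent system of maximal size generates, since any vector outside its span
  modulo \<open>B\<close> would extend it. Finiteness of a quotient without a known basis is derived
  from such a bound.\<close>

lemma qdim_exists:
  assumes Z: "cvs.subspace Z" and B: "cvs.subspace B"
    and bound: "\<And>S. qindep B S \<Longrightarrow> S \<subseteq> Z \<Longrightarrow> card S \<le> n"
  shows "\<exists>m. qdim Z B m"
proof -
  have "qindep B {} \<and> {} \<subseteq> Z" by (simp add: qindep_def)
  then obtain S where S': "qindep B S \<and> S \<subseteq> Z" "\<forall>S'. qindep B S' \<and> S' \<subseteq> Z \<longrightarrow> card S' \<le> card S"
    using ex_has_greatest_nat[of "\<lambda>S. qindep B S \<and> S \<subseteq> Z" "{}" card "Suc n"] bound
      le_imp_less_Suc by blast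
  then have S: "qindep B S" "S \<subseteq> Z"
    and max: "\<And>S'. qindep B S' \<Longrightarrow> S' \<subseteq> Z \<Longrightarrow> card S' \<le> card S" by auto
  have fin: "finite S" using S by (simp add: qindep_def)
  have "\<exists>c. z - (\<Sum>s\<in>S. c s *\<^sub>C s) \<in> B" if z: "z \<in> Z" for z
  proof (rule ccontr)
    assume no: "\<nexists>c. z - (\<Sum>s\<in>S. c s *\<^sub>C s) \<in> B"
    have zS: "z \<notin> S"
    proof
      assume "z \<in> S"
      then have "(\<Sum>s\<in>S. (if s = z then 1 else 0) *\<^sub>C s) = z"
        using fin by (simp only: sum_delta_scaleC)
      then show False using no B by (metis cvs.subspace_0 diff_self)
    qed
    have "qindep B (insert z S)"
      unfolding qindep_def
    proof (intro conjI allI impI)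
      show "finite (insert z S)" using fin by simp
      fix c assume c: "(\<Sum>s\<in>insert z S. c s *\<^sub>C s) \<in> B"
      have cz: "c z = 0"
      proof (rule ccontr)
        assume cz: "c z \<noteq> 0"
        have "inverse (c z) *\<^sub>C (\<Sum>s\<in>insert z S. c s *\<^sub>C s) \<in> B"
          using c B by (intro cvs.subspace_scale)
        moreover have "inverse (c z) *\<^sub>C (\<Sum>s\<in>insert z S. c s *\<^sub>C s)
            = z - (\<Sum>s\<in>S. (- inverse (c z) * c s) *\<^sub>C s)"
          using fin zS cz
          by (simp add: scaleC_add_right scaleC_scaleC scaleC_one cvs.scale_sum_right sum_negf)
        ultimately have "z - (\<Sum>s\<in>S. (- inverse (c z) * c s) *\<^sub>C s) \<in> B" by (simp only:)
        then have "\<exists>c. z - (\<Sum>s\<in>S. c s *\<^sub>C s) \<in> B"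
          by (rule exI[of _ "\<lambda>s. - inverse (c z) * c s"])
        with no show False ..
      qed
      then have "(\<Sum>s\<in>S. c s *\<^sub>C s) \<in> B" using c fin zS by simp
      then show "\<forall>s\<in>insert z S. c s = 0" using S(1) cz unfolding qindep_def by blast
    qed
    then have "card (insert z S) \<le> card S" using S z by (intro max) auto
    then show False using fin zS by simp
  qed
  then have "quotient_basis Z B S" using S by (simp add: quotient_basis_iff)
  then show ?thesis by (auto simp: qdim_def)
qed

lemma qdim_add:
  assumes B: "cvs.subspace B" and Y: "cvs.subspace Y" and BY: "B \<subseteq> Y" and YZ: "Y \<subseteq> Z"
    and m: "qdim Z Y m" and n: "qdim Y B n"
  shows "qdim Z B (m + n)"
proof -
  obtain S where S: "qindep Y S" "S \<subseteq> Z" "\<forall>z\<in>Z. \<exists>c. z - (\<Sum>s\<in>S. c s *\<^sub>C s) \<in> Y"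
    "card S = m"
    by (rule qdimE[OF m])
  obtain R where R: "qindep B R" "R \<subseteq> Y" "\<forall>z\<in>Y. \<exists>c. z - (\<Sum>s\<in>R. c s *\<^sub>C s) \<in> B"
    "card R = n"
    by (rule qdimE[OF n])
  have fin: "finite S" "finite R" using S(1) R(1) by (auto simp: qindep_def)
  \<comment> \<open>A common element lies in \<open>Y\<close>, so it would be a nontrivial
    combination of \<open>S\<close> that is zero modulo \<open>Y\<close>.\<close>
  have disj: "S \<inter> R = {}"
  proof (rule ccontr)
    assume "S \<inter> R \<noteq> {}"
    then obtain s where s: "s \<in> S" "s \<in> R" by blast
    have "(\<Sum>x\<in>S. (if x = s then 1 else 0) *\<^sub>C x) = s"
      using fin s by (simp only: sum_delta_scaleC)
    then have "(\<Sum>x\<in>S. (if x = s then 1 else 0) *\<^sub>C x) \<in> Y" using subsetD[OF R(2) s(2)] by (simp only:)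
    then have "(if s = s then 1 else 0 :: complex) = 0"
      using S(1) s(1) qindepD[where c = "\<lambda>x. if x = s then 1 else 0"] by blast
    then show False by simp
  qed
  have "qindep B (S \<union> R)"
    unfolding qindep_def
  proof (intro conjI allI impI)
    show "finite (S \<union> R)" using fin by simp
    fix c assume "(\<Sum>s\<in>S \<union> R. c s *\<^sub>C s) \<in> B"
    then have c: "(\<Sum>s\<in>S. c s *\<^sub>C s) + (\<Sum>s\<in>R. c s *\<^sub>C s) \<in> B"
      using fin disj by (simp add: sum.union_disjoint)
    have RY: "(\<Sum>s\<in>R. c s *\<^sub>C s) \<in> Y"
      using R Y by (intro cvs.subspace_sum cvs.subspace_scale) auto
    have "(\<Sum>s\<in>S. c s *\<^sub>C s) \<in> Y"
      using cvs.subspace_diff[OF Y subsetD[OF BY c] RY] by (simp only: add_diff_cancel_right')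
    then have S0: "\<forall>s\<in>S. c s = 0" using S(1) unfolding qindep_def by blast
    then have "(\<Sum>s\<in>R. c s *\<^sub>C s) \<in> B" using c by simp
    then have "\<forall>s\<in>R. c s = 0" using R(1) unfolding qindep_def by blast
    then show "\<forall>s\<in>S \<union> R. c s = 0" using S0 by blast
  qed
  moreover have "\<forall>z\<in>Z. \<exists>c. z - (\<Sum>s\<in>S \<union> R. c s *\<^sub>C s) \<in> B"
  proof
    fix z assume "z \<in> Z"
    obtain c where c: "z - (\<Sum>s\<in>S. c s *\<^sub>C s) \<in> Y" using S(3) \<open>z \<in> Z\<close> by blast
    obtain e where e: "z - (\<Sum>s\<in>S. c s *\<^sub>C s) - (\<Sum>s\<in>R. e s *\<^sub>C s) \<in> B" using R(3) c by blast
    let ?f = "\<lambda>s. if s \<in> S then c s else e s"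
    have "(\<Sum>s\<in>S. ?f s *\<^sub>C s) = (\<Sum>s\<in>S. c s *\<^sub>C s)"
      and "(\<Sum>s\<in>R. ?f s *\<^sub>C s) = (\<Sum>s\<in>R. e s *\<^sub>C s)"
      using disj by (auto intro!: sum.cong)
    then have "(\<Sum>s\<in>S \<union> R. ?f s *\<^sub>C s) = (\<Sum>s\<in>S. c s *\<^sub>C s) + (\<Sum>s\<in>R. e s *\<^sub>C s)"
      using fin disj by (simp only: sum.union_disjoint)
    then have "z - (\<Sum>s\<in>S \<union> R. ?f s *\<^sub>C s) \<in> B" using e by (simp only: diff_diff_eq)
    then show "\<exists>c. z - (\<Sum>s\<in>S \<union> R. c s *\<^sub>C s) \<in> B"
      by (rule exI[of _ ?f])
  qed
  moreover have "card (S \<union> R) = m + n" using S(4) R(4) fin disj by (simp add: card_Un_disjoint)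
  moreover have "S \<union> R \<subseteq> Z" using S(2) R(2) YZ by blast
  ultimately show ?thesis by (intro qdimI)
qed

text \<open>Independence modulo the larger \<open>Y\<close> implies independence modulo
  \<open>B\<close>, so \<open>p\<close> bounds both layers; additivity and uniqueness then give the
  sum.\<close>

lemma qdim_split:
  assumes B: "cvs.subspace B" and Y: "cvs.subspace Y" and Z: "cvs.subspace Z"
    and BY: "B \<subseteq> Y" and YZ: "Y \<subseteq> Z" and p: "qdim Z B p"
  obtains m n where "qdim Z Y m" "qdim Y B n" "p = m + n"
proof -
  have "\<exists>n. qdim Y B n"
    using YZ by (intro qdim_exists[where n = p] qdim_bound[OF B p] Y B) auto
  moreover have "\<exists>m. qdim Z Y m"
  proof (rule qdim_exists[OF Z Y])
    fix S assume "qindep Y S" "S \<subseteq> Z"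
    then show "card S \<le> p" using BY by (intro qdim_bound[OF B p]) (auto simp: qindep_def)
  qed
  ultimately show ?thesis using that qdim_add[OF B Y BY YZ] qdim_unique[OF B p] by blast
qed

lemma qindep_image:
  assumes f: "clinear f" and X: "cvs.subspace X" and Z': "cvs.subspace Z'"
    and inj: "\<forall>x\<in>X. f x \<in> Z' \<longrightarrow> x \<in> X'" and S: "qindep X' S" "S \<subseteq> X"
  shows "inj_on f S \<and> qindep Z' (f ` S)"
proof
  show injS: "inj_on f S"
  proof (rule inj_onI, rule ccontr)
    fix s t assume st: "s \<in> S" "t \<in> S" "f s = f t" "s \<noteq> t"
    then have "f (s - t) \<in> Z'" using Z' by (simp add: clinear_diff[OF f] cvs.subspace_0)
    moreover have "s - t \<in> X" using st S X by (auto intro: cvs.subspace_diff)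
    ultimately show False using inj qindep_diff_notin[OF S(1)] st by blast
  qed
  show "qindep Z' (f ` S)"
    unfolding qindep_def
  proof (intro conjI allI impI)
    show "finite (f ` S)" using S by (simp add: qindep_def)
    fix c assume "(\<Sum>s\<in>f ` S. c s *\<^sub>C s) \<in> Z'"
    then have "f (\<Sum>s\<in>S. c (f s) *\<^sub>C s) \<in> Z'"
      using injS by (simp add: sum.reindex clinear_sum_scale[OF f])
    moreover have "(\<Sum>s\<in>S. c (f s) *\<^sub>C s) \<in> X"
      using S X by (intro cvs.subspace_sum cvs.subspace_scale) auto
    ultimately have "(\<Sum>s\<in>S. c (f s) *\<^sub>C s) \<in> X'" using inj by blast
    then have "\<forall>s\<in>S. c (f s) = 0"
      using S(1) qindepD[where c = "\<lambda>s. c (f s)"] by blast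
    then show "\<forall>s\<in>f ` S. c s = 0" by blast
  qed
qed

lemma qdim_iso_fwd:
  assumes f: "clinear f" and X: "cvs.subspace X" and Z': "cvs.subspace Z'"
    and sub: "f ` X \<subseteq> Z" "f ` X' \<subseteq> Z'"
    and inj: "\<forall>x\<in>X. f x \<in> Z' \<longrightarrow> x \<in> X'"
    and surj: "\<forall>z\<in>Z. \<exists>x\<in>X. z - f x \<in> Z'" and n: "qdim X X' n"
  shows "qdim Z Z' n"
proof -
  obtain S where S: "qindep X' S" "S \<subseteq> X" "\<forall>z\<in>X. \<exists>c. z - (\<Sum>s\<in>S. c s *\<^sub>C s) \<in> X'"
    "card S = n"
    by (rule qdimE[OF n])
  note i = qindep_image[OF f X Z' inj S(1,2)]
  have "\<forall>z\<in>Z. \<exists>c. z - (\<Sum>s\<in>f ` S. c s *\<^sub>C s) \<in> Z'"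
  proof
    fix z assume "z \<in> Z"
    obtain x where x: "x \<in> X" "z - f x \<in> Z'" using surj \<open>z \<in> Z\<close> by blast
    obtain c where c: "x - (\<Sum>s\<in>S. c s *\<^sub>C s) \<in> X'" using S(3) x by blast
    have "f (x - (\<Sum>s\<in>S. c s *\<^sub>C s)) \<in> Z'" using c sub by blast
    then have "f x - (\<Sum>s\<in>S. c s *\<^sub>C f s) \<in> Z'"
      by (simp add: clinear_diff[OF f] clinear_sum_scale[OF f])
    then have "z - f x + (f x - (\<Sum>s\<in>S. c s *\<^sub>C f s)) \<in> Z'"
      using x(2) Z' by (intro cvs.subspace_add)
    moreover have "(\<Sum>s\<in>f ` S. c (inv_into S f s) *\<^sub>C s) = (\<Sum>s\<in>S. c s *\<^sub>C f s)"
      using i by (simp add: sum.reindex)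
    ultimately have "z - (\<Sum>s\<in>f ` S. c (inv_into S f s) *\<^sub>C s) \<in> Z'" by simp
    then show "\<exists>c. z - (\<Sum>s\<in>f ` S. c s *\<^sub>C s) \<in> Z'"
      by (rule exI[of _ "\<lambda>s. c (inv_into S f s)"])
  qed
  moreover have "card (f ` S) = n" using i S(4) by (simp add: card_image)
  moreover have "f ` S \<subseteq> Z" using S(2) sub(1) by blast
  ultimately show ?thesis using i by (intro qdimI) auto
qed

text \<open>The conditions say that \<open>f\<close> induces an isomorphism of the quotients; with
  \<open>f\<close> the identity they cover the second isomorphism theorem. For the backward
  direction no inverse is built: \<open>n\<close> bounds independent systems in \<open>X\<close>, so
  a dimension exists, and it must be \<open>n\<close>.\<close>

lemma qdim_iso:
  assumes f: "clinear f" and X: "cvs.subspace X" and X': "cvs.subspace X'" and Z': "cvs.subspace Z'"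
    and sub: "f ` X \<subseteq> Z" "f ` X' \<subseteq> Z'"
    and inj: "\<forall>x\<in>X. f x \<in> Z' \<longrightarrow> x \<in> X'"
    and surj: "\<forall>z\<in>Z. \<exists>x\<in>X. z - f x \<in> Z'"
  shows "qdim X X' n \<longleftrightarrow> qdim Z Z' n"
proof
  show "qdim X X' n \<Longrightarrow> qdim Z Z' n" using qdim_iso_fwd[OF f X Z' sub inj surj] by blast
  assume n: "qdim Z Z' n"
  have "\<exists>m. qdim X X' m"
  proof (rule qdim_exists[OF X X'])
    fix S assume S: "qindep X' S" "S \<subseteq> X"
    then have "card (f ` S) \<le> n" using qindep_image[OF f X Z' inj S] sub by (intro qdim_bound[OF Z' n]) auto
    then show "card S \<le> n" using qindep_image[OF f X Z' inj S] by (simp add: card_image)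
  qed
  then show "qdim X X' n" using qdim_iso_fwd[OF f X Z' sub inj surj] qdim_unique[OF Z' n] by blast
qed

section \<open>Euler characteristics of cochain complexes\<close>

text \<open>The chain spaces are a parameter because the image of a Koszul complex under
  \<open>vmap A\<close> is a complex too, but in general not a full Koszul complex.\<close>

definition cocyc :: "(nat \<Rightarrow> 'a::complex_vector set) \<Rightarrow> ('a \<Rightarrow> 'a) \<Rightarrow> nat \<Rightarrow> 'a set"
  where "cocyc C D k = {x \<in> C k. D x = 0}"

definition cobd :: "(nat \<Rightarrow> 'a::complex_vector set) \<Rightarrow> ('a \<Rightarrow> 'a) \<Rightarrow> nat \<Rightarrow> 'a set"
  where "cobd C D k = (if k = 0 then {0} else D ` C (k - 1))"

definition betti :: "(nat \<Rightarrow> 'a::complex_vector set) \<Rightarrow> ('a \<Rightarrow> 'a) \<Rightarrow> nat \<Rightarrow> nat \<Rightarrow> bool"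
  where "betti C D k n \<longleftrightarrow> qdim (cocyc C D k) (cobd C D k) n"

definition cochain_complex :: "nat \<Rightarrow> (nat \<Rightarrow> 'a::complex_vector set) \<Rightarrow> ('a \<Rightarrow> 'a) \<Rightarrow> bool"
  where "cochain_complex d C D \<longleftrightarrow> clinear D \<and> (\<forall>k. cvs.subspace (C k)) \<and> C (Suc d) = {0} \<and>
    (\<forall>k. \<forall>x\<in>C k. D x \<in> C (Suc k)) \<and> (\<forall>k. \<forall>x\<in>C k. D (D x) = 0)"

text \<open>\<open>q k - c k - c (k + 1)\<close> is what a long exact sequence gives for the difference of the Betti
  numbers, where \<open>c\<close> are the ranks of the connecting maps.\<close>

definition betti_linked :: "nat \<Rightarrow> (nat \<Rightarrow> int) \<Rightarrow> (nat \<Rightarrow> nat \<Rightarrow> bool) \<Rightarrow> (nat \<Rightarrow> nat \<Rightarrow> bool) \<Rightarrow> bool"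
  where "betti_linked d q F G \<longleftrightarrow> (\<exists>c::nat \<Rightarrow> int. c 0 = 0 \<and> c (Suc d) = 0 \<and>
    (\<forall>k m. F k m \<longrightarrow> (\<exists>n. G k n \<and> int m - int n = q k - c k - c (Suc k))) \<and>
    (\<forall>k n. G k n \<longrightarrow> (\<exists>m. F k m \<and> int m - int n = q k - c k - c (Suc k))))"

lemma alternating_telescope:
  fixes c :: "nat \<Rightarrow> int"
  shows "(\<Sum>k\<le>d. (-1) ^ k * (c k + c (Suc k))) = c 0 + (-1) ^ d * c (Suc d)"
  by (induction d) (simp_all add: algebra_simps)

lemma betti_linked_finite:
  assumes "betti_linked d q F G"
  shows "(\<forall>k\<le>d. \<exists>n. F k n) \<longleftrightarrow> (\<forall>k\<le>d. \<exists>n. G k n)"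
  using assms unfolding betti_linked_def by meson

text \<open>Each rank \<open>c k\<close> enters in degrees \<open>k - 1\<close> and \<open>k\<close>
  with opposite signs, and the two outermost ranks are zero.\<close>

lemma betti_linked_euler:
  assumes l: "betti_linked d q F G" and F: "\<And>k. k \<le> d \<Longrightarrow> F k (m k)" and G: "\<And>k. k \<le> d \<Longrightarrow> G k (n k)"
    and u: "\<And>k a b. G k a \<Longrightarrow> G k b \<Longrightarrow> a = b"
  shows "(\<Sum>k\<le>d. (-1) ^ k * int (m k)) = (\<Sum>k\<le>d. (-1) ^ k * int (n k)) + (\<Sum>k\<le>d. (-1) ^ k * q k)"
proof -
  obtain c :: "nat \<Rightarrow> int" where c: "c 0 = 0" "c (Suc d) = 0"
    and FG: "\<And>k m. F k m \<Longrightarrow> \<exists>n. G k n \<and> int m - int n = q k - c k - c (Suc k)"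
    using l unfolding betti_linked_def by blast
  have "int (m k) = int (n k) + q k - (c k + c (Suc k))" if "k \<le> d" for k
    using FG[OF F[OF that]] u[OF G[OF that]] by (auto simp: algebra_simps)
  then have "(\<Sum>k\<le>d. (-1) ^ k * int (m k))
      = (\<Sum>k\<le>d. (-1) ^ k * (int (n k) + q k - (c k + c (Suc k))))"
    by (intro sum.cong) auto
  also have "\<dots> = (\<Sum>k\<le>d. (-1) ^ k * int (n k) + (-1) ^ k * q k - (-1) ^ k * (c k + c (Suc k)))"
    by (simp only: right_diff_distrib distrib_left)
  also have "\<dots> = (\<Sum>k\<le>d. (-1) ^ k * int (n k)) + (\<Sum>k\<le>d. (-1) ^ k * q k)"
    using c alternating_telescope[of c d] by (simp add: sum.distrib sum_subtractf)
  finally show ?thesis .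
qed

lemma subspace_cocyc: "cochain_complex d C D \<Longrightarrow> cvs.subspace (cocyc C D k)"
  unfolding cocyc_def cochain_complex_def by (simp add: subspace_clinear_Collect)

lemma subspace_cobd: "cochain_complex d C D \<Longrightarrow> cvs.subspace (cobd C D k)"
  unfolding cobd_def cochain_complex_def by (simp add: subspace_clinear_image)

lemma cobd_subset_cocyc: "cochain_complex d C D \<Longrightarrow> cobd C D k \<subseteq> cocyc C D k"
  unfolding cobd_def cochain_complex_def cocyc_def
  by (cases k) (auto simp: cvs.subspace_0 clinear_zero)

lemma betti_unique: "cochain_complex d C D \<Longrightarrow> betti C D k m \<Longrightarrow> betti C D k n \<Longrightarrow> m = n"
  unfolding betti_def using qdim_unique subspace_cobd by blast

lemma qdim_self: "cvs.subspace B \<Longrightarrow> qdim B B n \<longleftrightarrow> n = 0"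
proof -
  assume B: "cvs.subspace B"
  have "qdim B B 0" by (rule qdimI[of _ "{}"]) (auto simp: qindep_def)
  then show ?thesis using qdim_unique[OF B] by blast
qed

text \<open>Rank-nullity modulo a subspace: \<open>D\<close> maps \<open>X / (R + ker D)\<close> isomorphically onto
  \<open>D X / D R\<close>.\<close>

lemma qdim_rank_nullity:
  assumes D: "clinear D" and X: "cvs.subspace X" and R: "cvs.subspace R" and RX: "R \<subseteq> X"
    and q: "qdim X R q"
  obtains a c where "qdim {x \<in> X. D x = 0} {x \<in> R. D x = 0} a" "qdim (D ` X) (D ` R) c" "q = a + c"
proof -
  let ?Y = "{x \<in> X. D x \<in> D ` R}"
  have DR: "cvs.subspace (D ` R)" using D R by (rule subspace_clinear_image)
  have Y: "cvs.subspace ?Y"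
    using X DR D unfolding cvs.subspace_def
    by (auto simp: clinear_zero clinear_add clinear_scale)
  have RY: "R \<subseteq> ?Y" using RX by blast
  obtain c a where ca: "qdim X ?Y c" "qdim ?Y R a" "q = c + a"
    by (rule qdim_split[OF R Y X RY _ q]) auto
  have "qdim X ?Y c \<longleftrightarrow> qdim (D ` X) (D ` R) c"
  proof (rule qdim_iso[OF D X Y DR])
    show "\<forall>z\<in>D ` X. \<exists>x\<in>X. z - D x \<in> D ` R"
    proof
      fix z assume "z \<in> D ` X"
      then obtain x where "x \<in> X" "z - D x = 0" by auto
      then show "\<exists>x\<in>X. z - D x \<in> D ` R" using cvs.subspace_0[OF DR] by (auto intro!: bexI[of _ x])
    qed
  qed auto
  moreover have "qdim {x \<in> X. D x = 0} {x \<in> R. D x = 0} a \<longleftrightarrow> qdim ?Y R a"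
  proof (rule qdim_iso[where f = "\<lambda>x. x"])
    show "clinear (\<lambda>x::'a. x)" by (rule clinearI) auto
    show "cvs.subspace {x \<in> X. D x = 0}" "cvs.subspace {x \<in> R. D x = 0}"
      using D X R by (auto intro: subspace_clinear_Collect)
    show "(\<lambda>x. x) ` {x \<in> X. D x = 0} \<subseteq> ?Y"
      using cvs.subspace_0[OF DR] by auto
    show "\<forall>z\<in>?Y. \<exists>x\<in>{x \<in> X. D x = 0}. z - x \<in> R"
    proof
      fix z assume z: "z \<in> ?Y"
      then obtain r where r: "r \<in> R" "D z = D r" by blast
      then have "z - r \<in> {x \<in> X. D x = 0}" "z - (z - r) \<in> R"
        using z r subsetD[OF RX r(1)] cvs.subspace_diff[OF X] by (simp_all add: clinear_diff[OF D])
      then show "\<exists>x\<in>{x \<in> X. D x = 0}. z - x \<in> R" by blast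
    qed
  qed (use R in auto)
  ultimately show ?thesis using ca by (intro that[of a c]) simp_all
qed

text \<open>The dimension of \<open>cocyc C D k\<close> modulo \<open>cobd R D k\<close> is counted
  through \<open>cobd C D k\<close> and through \<open>cocyc R D k\<close>, with corrections
  \<open>c k\<close> and \<open>a k\<close>. Rank-nullity on \<open>C k\<close> modulo
  \<open>R k\<close> gives \<open>q k = a k + c (Suc k)\<close>.\<close>

lemma betti_linked_subcomplex:
  assumes C: "cochain_complex d C D" and R: "cochain_complex d R D" and RC: "\<And>k. R k \<subseteq> C k"
    and q: "\<And>k. qdim (C k) (R k) (q k)"
  shows "betti_linked d (\<lambda>k. int (q k)) (betti C D) (betti R D)"
proof -
  have D: "clinear D" and sC: "\<And>k. cvs.subspace (C k)" and sR: "\<And>k. cvs.subspace (R k)"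
    using C R unfolding cochain_complex_def by auto
  have "\<exists>a c. qdim (cocyc C D k) (cocyc R D k) a \<and> qdim (D ` C k) (D ` R k) c \<and> q k = a + c" for k
    unfolding cocyc_def by (rule qdim_rank_nullity[OF D sC sR RC q[of k]]) blast
  then obtain a c' where a: "\<And>k. qdim (cocyc C D k) (cocyc R D k) (a k)"
    and c': "\<And>k. qdim (D ` C k) (D ` R k) (c' k)" and qac: "\<And>k. q k = a k + c' k" by metis
  \<comment> \<open>\<open>c'\<close> is indexed by the source of \<open>D\<close> and
    \<open>c\<close> by its target; nothing maps into degree 0.\<close>
  define c where "c k = (if k = 0 then 0 else c' (k - 1))" for k
  have c: "qdim (cobd C D k) (cobd R D k) (c k)" for k
    using c'[of "k - 1"] by (auto simp: cobd_def c_def qdim_self cvs.subspace_single_0)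
  have c0: "c 0 = 0" by (simp add: c_def)
  have "D ` C d = {0}" "D ` R d = {0}"
    using C R cvs.subspace_0[OF subspace_clinear_image[OF D sC[of d]]]
      cvs.subspace_0[OF subspace_clinear_image[OF D sR[of d]]]
    unfolding cochain_complex_def by auto
  then have cd: "c (Suc d) = 0" using c[of "Suc d"] by (simp add: cobd_def qdim_self cvs.subspace_single_0)
  have bR: "cobd R D k \<subseteq> cobd C D k" for k using RC by (auto simp: cobd_def)
  have zR: "cocyc R D k \<subseteq> cocyc C D k" for k using RC by (auto simp: cocyc_def)
  note sub = subspace_cobd[OF C] subspace_cobd[OF R] subspace_cocyc[OF C] subspace_cocyc[OF R]
    cobd_subset_cocyc[OF C] cobd_subset_cocyc[OF R]
  have fwd: "\<exists>n. betti R D k n \<and> m + c k = a k + n" if m: "betti C D k m" for k m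
  proof -
    have p: "qdim (cocyc C D k) (cobd R D k) (m + c k)"
      using m c unfolding betti_def by (intro qdim_add[of _ "cobd C D k"] sub bR)
    obtain a' n where n: "qdim (cocyc C D k) (cocyc R D k) a'" "qdim (cocyc R D k) (cobd R D k) n"
      "m + c k = a' + n"
      by (rule qdim_split[OF sub(2,4,3,6) zR p])
    have "a' = a k" by (rule qdim_unique[OF sub(4) n(1) a])
    then show ?thesis using n unfolding betti_def by blast
  qed
  have bwd: "\<exists>m. betti C D k m \<and> m + c k = a k + n" if n: "betti R D k n" for k n
  proof -
    have p: "qdim (cocyc C D k) (cobd R D k) (a k + n)"
      using n a unfolding betti_def by (intro qdim_add[of _ "cocyc R D k"] sub zR)
    obtain m c1 where m: "qdim (cocyc C D k) (cobd C D k) m" "qdim (cobd C D k) (cobd R D k) c1"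
      "a k + n = m + c1"
      by (rule qdim_split[OF sub(2,1,3) bR sub(5) p])
    have "c1 = c k" by (rule qdim_unique[OF sub(2) m(2) c])
    then show ?thesis using m unfolding betti_def by metis
  qed
  have qc: "int (q k) = int (a k) + int (c (Suc k))" for k using qac by (simp add: c_def)
  show ?thesis
    unfolding betti_linked_def
  proof (intro exI[of _ "\<lambda>k. int (c k)"] conjI allI impI)
    fix k m assume "betti C D k m"
    then obtain n where "betti R D k n" "m + c k = a k + n" using fwd by blast
    then show "\<exists>n. betti R D k n \<and> int m - int n = int (q k) - int (c k) - int (c (Suc k))"
      unfolding qc by (intro exI[of _ n]) linarith
  next
    fix k n assume "betti R D k n"
    then obtain m where "betti C D k m" "m + c k = a k + n" using bwd by blast
    then show "\<exists>m. betti C D k m \<and> int m - int n = int (q k) - int (c k) - int (c (Suc k))"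
      unfolding qc by (intro exI[of _ m]) linarith
  qed (simp_all add: c0 cd)
qed

text \<open>Dual count, in \<open>Y k\<close>, the preimage of the cocycles of the image complex,
  modulo \<open>cobd C D k\<close>: once through the cocycles of \<open>C\<close>, once through the
  coboundaries plus the kernel of \<open>f\<close>. The ranks \<open>b k\<close> measure the
  coboundaries inside that kernel.\<close>

lemma betti_linked_quotient:
  assumes C: "cochain_complex d C D" and R: "cochain_complex d (\<lambda>k. f ` C k) D'" and f: "clinear f"
    and comm: "\<And>k x. x \<in> C k \<Longrightarrow> f (D x) = D' (f x)"
    and n: "\<And>k. qdim {x \<in> C k. f x = 0} {0} (n k)"
  shows "betti_linked d (\<lambda>k. int (n k)) (betti C D) (betti (\<lambda>k. f ` C k) D')"
proof -
  define N where "N k = {x \<in> C k. f x = 0}" for k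
  define Y where "Y k = {x \<in> C k. f (D x) = 0}" for k
  define S where "S k = {x \<in> cocyc C D k. \<exists>y\<in>cobd C D k. f x = f y}" for k
  have D: "clinear D" and sC: "\<And>k. cvs.subspace (C k)" and DC: "\<And>k x. x \<in> C k \<Longrightarrow> D x \<in> C (Suc k)"
    and Cd: "C (Suc d) = {0}"
    using C unfolding cochain_complex_def by auto
  have sN: "cvs.subspace (N k)" for k
    unfolding N_def using f sC by (rule subspace_clinear_Collect)
  have fD: "clinear (\<lambda>x. f (D x))"
    by (rule clinearI) (simp_all add: clinear_add[OF D] clinear_add[OF f] clinear_scale[OF D] clinear_scale[OF f])
  have sY: "cvs.subspace (Y k)" for k
    unfolding Y_def by (rule subspace_clinear_Collect[OF fD sC])
  have sB: "cvs.subspace (cobd C D k)" and sZ: "cvs.subspace (cocyc C D k)"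
    and BZ: "cobd C D k \<subseteq> cocyc C D k" for k
    using subspace_cobd[OF C] subspace_cocyc[OF C] cobd_subset_cocyc[OF C] by auto
  have ZY: "cocyc C D k \<subseteq> Y k" for k by (auto simp: cocyc_def Y_def clinear_zero[OF f])
  have sNB: "cvs.subspace (N k \<inter> cobd C D k)" for k by (intro cvs.subspace_inter sN sB)
  have zs: "cvs.subspace {0::'a}" by (rule cvs.subspace_single_0)
  have "\<exists>m b. qdim (N k) (N k \<inter> cobd C D k) m \<and> qdim (N k \<inter> cobd C D k) {0} b \<and> n k = m + b" for k
    by (rule qdim_split[OF zs sNB[of k] sN[of k] _ _ n[of k, folded N_def]])
      (auto simp: cvs.subspace_0 sN sB)
  then obtain m b where m: "\<And>k. qdim (N k) (N k \<inter> cobd C D k) (m k)"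
    and b: "\<And>k. qdim (N k \<inter> cobd C D k) {0} (b k)" and nmb: "\<And>k. n k = m k + b k" by metis
  have b0: "b 0 = 0" using b[of 0] sN[of 0] by (simp add: cobd_def cvs.subspace_0 qdim_self zs)
  have "N (Suc d) = {0}" unfolding N_def Cd by (auto simp: clinear_zero[OF f])
  then have bd: "b (Suc d) = 0" using b[of "Suc d"] by (simp add: cvs.subspace_0 qdim_self zs sB)
  \<comment> \<open>\<open>D\<close> maps \<open>Y k\<close> onto the coboundaries that lie in
    \<open>N (Suc k)\<close>, and its kernel is \<open>cocyc C D k\<close>; hence the shift of the
    degree.\<close>
  have Yb: "qdim (Y k) (cocyc C D k) (b (Suc k))" for k
  proof -
    have "qdim (Y k) (cocyc C D k) (b (Suc k)) \<longleftrightarrow> qdim (N (Suc k) \<inter> cobd C D (Suc k)) {0} (b (Suc k))"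
      by (rule qdim_iso[OF D sY sZ zs])
        (auto simp: Y_def N_def cocyc_def cobd_def DC)
    then show ?thesis using b by blast
  qed
  define BN where "BN k = {x + y |x y. x \<in> cobd C D k \<and> y \<in> N k}" for k
  have sBN: "cvs.subspace (BN k)" for k
    unfolding BN_def by (rule cvs.subspace_sums[OF sB sN])
  have BBN: "cobd C D k \<subseteq> BN k" for k
    unfolding BN_def using cvs.subspace_0[OF sN] by force
  have NY: "N k \<subseteq> Y k" for k
    by (auto simp: N_def Y_def comm) (metis clinear_zero cochain_complex_def R)
  have BNY: "BN k \<subseteq> Y k" for k
    using BZ[of k] ZY[of k] NY[of k] unfolding BN_def by (auto intro!: cvs.subspace_add[OF sY])
  have BNm: "qdim (BN k) (cobd C D k) (m k)" for k
  proof -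
    have "qdim (N k) (N k \<inter> cobd C D k) (m k) \<longleftrightarrow> qdim (BN k) (cobd C D k) (m k)"
    proof (rule qdim_iso[where f = "\<lambda>x. x"])
      show "clinear (\<lambda>x::'a. x)" by (rule clinearI) auto
      show "(\<lambda>x. x) ` N k \<subseteq> BN k" using cvs.subspace_0[OF sB] unfolding BN_def by force
      show "\<forall>z\<in>BN k. \<exists>x\<in>N k. z - x \<in> cobd C D k" unfolding BN_def by force
    qed (use sN sB sNB in auto)
    then show ?thesis using m by blast
  qed
  have quo: "qdim (Y k) (BN k) h \<longleftrightarrow> betti (\<lambda>k. f ` C k) D' k h" for k h
    unfolding betti_def
  proof (rule qdim_iso[OF f sY sBN subspace_cobd[OF R]])
    show "f ` Y k \<subseteq> cocyc (\<lambda>k. f ` C k) D' k"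
      by (auto simp: Y_def cocyc_def comm[symmetric])
    have fB: "f ` cobd C D k = cobd (\<lambda>k. f ` C k) D' k"
      by (auto simp: cobd_def clinear_zero[OF f] image_image comm)
    show "f ` BN k \<subseteq> cobd (\<lambda>k. f ` C k) D' k"
      unfolding fB[symmetric] BN_def N_def by (auto simp: clinear_add[OF f])
    show "\<forall>x\<in>Y k. f x \<in> cobd (\<lambda>k. f ` C k) D' k \<longrightarrow> x \<in> BN k"
    proof (intro ballI impI)
      fix x assume x: "x \<in> Y k" "f x \<in> cobd (\<lambda>k. f ` C k) D' k"
      then obtain y where y: "y \<in> cobd C D k" "f x = f y" unfolding fB[symmetric] by blast
      then have "y \<in> C k" using BZ[of k] by (auto simp: cocyc_def)
      then have "x - y \<in> N k"
        using x y sC by (auto simp: N_def Y_def clinear_diff[OF f] intro: cvs.subspace_diff)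
      moreover have "x = y + (x - y)" by simp
      ultimately show "x \<in> BN k" unfolding BN_def using y by blast
    qed
    show "\<forall>z\<in>cocyc (\<lambda>k. f ` C k) D' k. \<exists>x\<in>Y k. z - f x \<in> cobd (\<lambda>k. f ` C k) D' k"
      using cvs.subspace_0[OF subspace_cobd[OF R]] by (force simp: cocyc_def Y_def comm)
  qed
  have fwd: "\<exists>h'. betti (\<lambda>k. f ` C k) D' k h' \<and> b (Suc k) + h = h' + m k" if h: "betti C D k h" for k h
  proof -
    have p: "qdim (Y k) (cobd C D k) (b (Suc k) + h)"
      using h Yb unfolding betti_def by (intro qdim_add[of _ "cocyc C D k"] sB sZ BZ ZY)
    obtain h' m' where n: "qdim (Y k) (BN k) h'" "qdim (BN k) (cobd C D k) m'" "b (Suc k) + h = h' + m'"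
      by (rule qdim_split[OF sB sBN sY BBN BNY p])
    have "m' = m k" by (rule qdim_unique[OF sB n(2) BNm])
    then show ?thesis using n quo by blast
  qed
  have bwd: "\<exists>h. betti C D k h \<and> b (Suc k) + h = h' + m k" if h: "betti (\<lambda>k. f ` C k) D' k h'" for k h'
  proof -
    have p: "qdim (Y k) (cobd C D k) (h' + m k)"
      using h BNm quo by (intro qdim_add[of _ "BN k"] sB sBN BBN BNY) auto
    obtain b1 h where n: "qdim (Y k) (cocyc C D k) b1" "qdim (cocyc C D k) (cobd C D k) h"
      "h' + m k = b1 + h"
      by (rule qdim_split[OF sB sZ sY BZ ZY p])
    have "b1 = b (Suc k)" by (rule qdim_unique[OF sZ n(1) Yb])
    then show ?thesis using n unfolding betti_def by metis
  qed
  have nb: "int (n k) = int (m k) + int (b k)" for k using nmb by simp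
  show ?thesis
    unfolding betti_linked_def
  proof (intro exI[of _ "\<lambda>k. int (b k)"] conjI allI impI)
    fix k h assume "betti C D k h"
    then obtain h' where "betti (\<lambda>k. f ` C k) D' k h'" "b (Suc k) + h = h' + m k" using fwd by blast
    then show "\<exists>h'. betti (\<lambda>k. f ` C k) D' k h' \<and> int h - int h' = int (n k) - int (b k) - int (b (Suc k))"
      unfolding nb by (intro exI[of _ h']) linarith
  next
    fix k h' assume "betti (\<lambda>k. f ` C k) D' k h'"
    then obtain h where "betti C D k h" "b (Suc k) + h = h' + m k" using bwd by blast
    then show "\<exists>h. betti C D k h \<and> int h - int h' = int (n k) - int (b k) - int (b (Suc k))"
      unfolding nb by (intro exI[of _ h]) linarith
  qed (simp_all add: b0 bd)
qed

section \<open>The Koszul complex\<close>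

definition vmap :: "('a::complex_vector \<Rightarrow> 'b::complex_vector) \<Rightarrow> 'a ^ 'n::finite \<Rightarrow> 'b ^ 'n"
  where "vmap A x = (\<chi> I. A (x $ I))"

lemma vmap_nth [simp]: "vmap A x $ I = A (x $ I)"
  by (simp add: vmap_def)

lemma scaleC_vec_nth [simp]: "(c *\<^sub>C x) $ I = c *\<^sub>C (x $ I)" for x :: "'a::complex_vector ^ 'n::finite"
  by (simp add: scaleC_vec_def)

lemma clinear_vmap: "clinear A \<Longrightarrow> clinear (vmap A)"
  by (rule clinearI) (simp_all add: vec_eq_iff clinear_add clinear_scale)

lemma clinear_axis: "clinear (axis I)"
  by (rule clinearI) (simp_all add: vec_eq_iff axis_def)

text \<open>For \<open>i\<close> outside \<open>J\<close>, the sign of sorting \<open>e_i\<close>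
  into \<open>e_J\<close>. Wedge and contraction share it, so their signs cancel.\<close>

definition wedge_sign :: "'d::{finite,linorder} \<Rightarrow> 'd set \<Rightarrow> complex"
  where "wedge_sign i J = (-1) ^ card {j \<in> J. j < i}"

lemma wedge_sign_insert:
  assumes "j \<notin> J"
  shows "wedge_sign i (insert j J) = (if j < i then - wedge_sign i J else wedge_sign i J)"
proof -
  have "{k \<in> insert j J. k < i} = (if j < i then insert j {k \<in> J. k < i} else {k \<in> J. k < i})" by auto
  then show ?thesis using assms by (simp add: wedge_sign_def)
qed

lemma wedge_sign_square: "wedge_sign i J * wedge_sign i J = 1"
  by (simp add: wedge_sign_def flip: power_mult_distrib)

lemma wedge_nth: "wedge i x $ J = (if i \<in> J then wedge_sign i (J - {i}) *\<^sub>C (x $ (J - {i})) else 0)"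
  by (simp add: wedge_def wedge_sign_def)

lemma clinear_wedge: "clinear (wedge i)"
  by (rule clinearI) (simp_all add: vec_eq_iff wedge_nth scaleC_add_right mult.commute)

lemma wedge_vmap: "clinear A \<Longrightarrow> wedge i (vmap A x) = vmap A (wedge i x)"
  by (simp add: vec_eq_iff wedge_nth clinear_scale clinear_zero)

text \<open>Only components that contain two distinct indices \<open>i\<close> and \<open>j\<close>
  matter. In exactly one of the two orders the outer index passes a smaller inner one, which costs
  one extra sign.\<close>

lemma wedge_anticommute: "wedge i (wedge j x) = - wedge j (wedge i x)"
  unfolding vec_eq_iff
proof
  fix J
  show "wedge i (wedge j x) $ J = (- wedge j (wedge i x)) $ J"
  proof (cases "i \<noteq> j \<and> i \<in> J \<and> j \<in> J")
    case True
    define K where "K = J - {i} - {j}"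
    have K: "J - {i} = insert j K" "J - {j} = insert i K" "i \<notin> K" "j \<notin> K" "insert j K - {j} = K"
      "insert i K - {i} = K"
      using True by (auto simp: K_def)
    then have "wedge i (wedge j x) $ J = (wedge_sign i (insert j K) * wedge_sign j K) *\<^sub>C (x $ K)"
      and "wedge j (wedge i x) $ J = (wedge_sign j (insert i K) * wedge_sign i K) *\<^sub>C (x $ K)"
      using True by (simp_all add: wedge_nth)
    moreover have "wedge_sign i (insert j K) * wedge_sign j K = - (wedge_sign j (insert i K) * wedge_sign i K)"
      using True K by (cases i j rule: linorder_cases) (simp_all add: wedge_sign_insert)
    ultimately show ?thesis by simp
  qed (auto simp: wedge_nth)
qed

text \<open>Interior multiplication with the \<open>i\<close>-th coordinate functional; it serves as
  the homotopy that kills \<open>T i\<close> on cohomology.\<close>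

definition contract :: "'d::{finite,linorder} \<Rightarrow> 'h::complex_vector ^ 'd set \<Rightarrow> 'h ^ 'd set"
  where "contract i x = (\<chi> J. if i \<in> J then 0 else wedge_sign i J *\<^sub>C (x $ insert i J))"

lemma contract_nth: "contract i x $ J = (if i \<in> J then 0 else wedge_sign i J *\<^sub>C (x $ insert i J))"
  by (simp add: contract_def)

lemma clinear_contract: "clinear (contract i)"
  by (rule clinearI) (simp_all add: vec_eq_iff contract_nth scaleC_add_right mult.commute)

lemma contract_vmap: "clinear A \<Longrightarrow> contract i (vmap A x) = vmap A (contract i x)"
  by (simp add: vec_eq_iff contract_nth clinear_scale clinear_zero)

text \<open>The canonical anticommutation relation. For \<open>i = j\<close> just one of the two
  terms contributes to each component, according to whether \<open>i\<close> lies in it; otherwise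
  the signs are opposite.\<close>

lemma wedge_contract: "wedge j (contract i x) + contract i (wedge j x) = (if i = j then x else 0)"
  unfolding vec_eq_iff
proof
  fix J
  show "(wedge j (contract i x) + contract i (wedge j x)) $ J = (if i = j then x else 0) $ J"
  proof (cases "i = j")
    case True
    then show ?thesis
      by (auto simp: wedge_nth contract_nth wedge_sign_square insert_absorb)
  next
    case False
    show ?thesis
    proof (cases "j \<in> J \<and> i \<notin> J")
      case True
      define K where "K = J - {j}"
      have K: "J = insert j K" "j \<notin> K" "i \<notin> K" using True by (auto simp: K_def)
      have K': "insert i (insert j K) - {j} = insert i K" "insert j K - {j} = K" using K False by auto
      have "wedge j (contract i x) $ J = (wedge_sign j K * wedge_sign i K) *\<^sub>C (x $ insert i K)"
        and "contract i (wedge j x) $ J = (wedge_sign i (insert j K) * wedge_sign j (insert i K)) *\<^sub>C (x $ insert i K)"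
        using K K' False by (simp_all add: wedge_nth contract_nth)
      moreover have "wedge_sign i (insert j K) * wedge_sign j (insert i K) = - (wedge_sign j K * wedge_sign i K)"
        using False K by (cases i j rule: linorder_cases) (simp_all add: wedge_sign_insert)
      ultimately show ?thesis using False by simp
    qed (use False in \<open>auto simp: wedge_nth contract_nth\<close>)
  qed
qed

section \<open>The Koszul boundary map, its homotopies and chain maps\<close>

lemma koszul_map_eq: "koszul_map T x = (\<Sum>i\<in>UNIV. wedge i (vmap (T i) x))"
  by (simp add: koszul_map_def vmap_def)

lemma clinear_koszul_map: "(\<And>i. clinear (T i)) \<Longrightarrow> clinear (koszul_map T)"
  by (rule clinearI)
    (simp_all add: koszul_map_eq clinear_add[OF clinear_vmap] clinear_scale[OF clinear_vmap]
      clinear_add[OF clinear_wedge] clinear_scale[OF clinear_wedge] sum.distrib cvs.scale_sum_right)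

text \<open>The summands \<open>a i j\<close> are antisymmetric, so the double sum is its own
  negative. Two tuples are allowed: \<open>V = T\<close> gives a complex, and with the polar part as
  \<open>V\<close> the image of \<open>koszul_map V\<close> consists of cocycles of
  \<open>T\<close>.\<close>

lemma koszul_map_koszul_map:
  assumes T: "\<And>i. clinear (T i)" and c: "\<And>i j x. T i (V j x) = T j (V i x)"
  shows "koszul_map T (koszul_map V x) = 0"
proof -
  define a where "a i j = wedge i (wedge j (vmap (T i) (vmap (V j) x)))" for i j
  have "vmap (T i) (vmap (V j) x) = vmap (T j) (vmap (V i) x)" for i j
    by (simp add: vec_eq_iff c)
  then have a: "a i j = - a j i" for i j by (simp add: a_def wedge_anticommute[of i j])
  have "koszul_map T (koszul_map V x) = (\<Sum>i\<in>UNIV. \<Sum>j\<in>UNIV. a i j)"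
    unfolding koszul_map_eq a_def
    by (simp add: clinear_sum[OF clinear_vmap[OF T]] clinear_sum[OF clinear_wedge] wedge_vmap[OF T])
  moreover have "(\<Sum>i\<in>UNIV. \<Sum>j\<in>UNIV. a i j) = - (\<Sum>i\<in>UNIV. \<Sum>j\<in>UNIV. a i j)"
    by (subst sum.swap, subst a) (simp add: sum_negf)
  ultimately show ?thesis
    by (metis eq_neg_iff_add_eq_0 scaleR_half_double scaleR_zero_right)
qed

text \<open>By \<open>wedge_contract\<close> only the summand \<open>j = i\<close> survives, so
  contraction is a null-homotopy of \<open>vmap (T i)\<close>.\<close>

lemma koszul_homotopy:
  assumes T: "\<And>i. clinear (T i)"
  shows "koszul_map T (contract i x) + contract i (koszul_map T x) = vmap (T i) x"
proof -
  have "koszul_map T (contract i x) + contract i (koszul_map T x)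
      = (\<Sum>j\<in>UNIV. wedge j (contract i (vmap (T j) x)) + contract i (wedge j (vmap (T j) x)))"
    by (simp add: koszul_map_eq clinear_sum[OF clinear_contract] sum.distrib contract_vmap[OF T])
  also have "\<dots> = (\<Sum>j\<in>UNIV. if i = j then vmap (T j) x else 0)"
    by (simp add: wedge_contract)
  finally show ?thesis by simp
qed

lemma vmap_koszul_map:
  assumes B: "clinear B" and c: "\<And>j x. B (T j x) = T' j (B x)"
  shows "vmap B (koszul_map T x) = koszul_map T' (vmap B x)"
proof -
  have "vmap B (vmap (T j) x) = vmap (T' j) (vmap B x)" for j by (simp add: vec_eq_iff c)
  then show ?thesis
    by (simp add: koszul_map_eq clinear_sum[OF clinear_vmap[OF B]] flip: wedge_vmap[OF B])
qed

lemma subspace_koszul_chains: "cvs.subspace (koszul_chains k)"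
  by (auto simp: koszul_chains_def cvs.subspace_def)

lemma koszul_chains_top: "koszul_chains (Suc (CARD('d))) = {0 :: 'h::complex_vector ^ ('d::finite) set}"
proof -
  have "card I \<noteq> Suc (CARD('d))" for I :: "'d set"
    using card_mono[of UNIV I] by auto
  then show ?thesis by (auto simp: koszul_chains_def vec_eq_iff)
qed

lemma vmap_koszul_chains: "A 0 = 0 \<Longrightarrow> x \<in> koszul_chains k \<Longrightarrow> vmap A x \<in> koszul_chains k"
  by (simp add: koszul_chains_def)

lemma wedge_koszul_chains: "x \<in> koszul_chains k \<Longrightarrow> wedge i x \<in> koszul_chains (Suc k)"
  by (auto simp: koszul_chains_def wedge_nth card_Diff_singleton_if) (metis card_Suc_Diff1 finite)

lemma contract_koszul_chains: "x \<in> koszul_chains (Suc k) \<Longrightarrow> contract i x \<in> koszul_chains k"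
  by (auto simp: koszul_chains_def contract_nth)

lemma contract_koszul_chains_0: "x \<in> koszul_chains 0 \<Longrightarrow> contract i x = 0"
  by (auto simp: koszul_chains_def contract_nth vec_eq_iff)

lemma koszul_map_koszul_chains:
  "(\<And>i. T i 0 = 0) \<Longrightarrow> x \<in> koszul_chains k \<Longrightarrow> koszul_map T x \<in> koszul_chains (Suc k)"
  unfolding koszul_map_eq
  by (intro cvs.subspace_sum subspace_koszul_chains wedge_koszul_chains vmap_koszul_chains)

definition linear_commuting :: "('d \<Rightarrow> 'h::complex_vector \<Rightarrow> 'h) \<Rightarrow> bool"
  where "linear_commuting T \<longleftrightarrow> (\<forall>i. clinear (T i)) \<and> (\<forall>i j x. T i (T j x) = T j (T i x))"

lemma cochain_complex_koszul:
  fixes T :: "'d::{finite,linorder} \<Rightarrow> 'h::complex_vector \<Rightarrow> 'h"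
  assumes "linear_commuting T"
  shows "cochain_complex (CARD('d)) koszul_chains (koszul_map T)"
proof -
  have T: "clinear (T i)" and c: "T i (T j x) = T j (T i x)" for i j x
    using assms by (auto simp: linear_commuting_def)
  show ?thesis
    unfolding cochain_complex_def
    by (intro conjI allI ballI clinear_koszul_map[of T, OF T] koszul_map_koszul_map[of T T, OF T c]
        koszul_chains_top koszul_map_koszul_chains[of T, OF clinear_zero[OF T]] subspace_koszul_chains)
qed

abbreviation koszul_betti :: "('d::{finite,linorder} \<Rightarrow> 'h::complex_vector \<Rightarrow> 'h) \<Rightarrow> nat \<Rightarrow> nat \<Rightarrow> bool"
  where "koszul_betti T \<equiv> betti koszul_chains (koszul_map T)"

lemma cocycles_eq: "cocycles T k = cocyc koszul_chains (koszul_map T) k"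
  by (simp add: cocycles_def cocyc_def)

lemma coboundaries_eq: "coboundaries T k = cobd koszul_chains (koszul_map T) k"
  by (simp add: coboundaries_def cobd_def)

lemma fredholm_tuple_iff:
  "fredholm_tuple (T :: 'd::{finite,linorder} \<Rightarrow> _) \<longleftrightarrow> (\<forall>k\<le>CARD('d). \<exists>n. koszul_betti T k n)"
  by (simp add: fredholm_tuple_def quotient_finite_dim_iff betti_def cocycles_eq coboundaries_eq)

lemma fredholm_index_eq:
  fixes T :: "'d::{finite,linorder} \<Rightarrow> 'h::complex_vector \<Rightarrow> 'h"
  assumes "linear_commuting T" "\<And>k. k \<le> CARD('d) \<Longrightarrow> koszul_betti T k (n k)"
  shows "fredholm_index T = (\<Sum>k\<le>CARD('d). (-1) ^ k * int (n k))"
  unfolding fredholm_index_def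
  using assms(2) subspace_cobd[OF cochain_complex_koszul[OF assms(1)]]
  by (intro sum.cong refl) (simp add: betti_def cocycles_eq coboundaries_eq quotient_dim_eq)

section \<open>Shifted tuples and the comparison at nonzero points\<close>

lemma linear_commuting_shift:
  assumes "linear_commuting T"
  shows "linear_commuting (shift_tuple T l)"
proof -
  have T: "clinear (T i)" and c: "T i (T j x) = T j (T i x)" for i j x
    using assms by (auto simp: linear_commuting_def)
  show ?thesis
    unfolding linear_commuting_def shift_tuple_def
  proof (intro conjI allI)
    show "clinear (\<lambda>x. T i x - l $ i *\<^sub>C x)" for i
      by (rule clinearI)
        (simp_all add: clinear_add[OF T] clinear_scale[OF T] scaleC_add_right
          cvs.scale_right_diff_distrib mult.commute)
    show "T i (T j x - l $ j *\<^sub>C x) - l $ i *\<^sub>C (T j x - l $ j *\<^sub>C x)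
      = T j (T i x - l $ i *\<^sub>C x) - l $ j *\<^sub>C (T i x - l $ i *\<^sub>C x)" for i j x
      by (simp add: clinear_diff[OF T] clinear_scale[OF T] c[of i j]
          cvs.scale_right_diff_distrib mult.commute algebra_simps)
  qed
qed

lemma koszul_cocycle_annihilated:
  assumes T: "\<And>i. clinear (T i)" and z: "z \<in> cocyc koszul_chains (koszul_map T) k"
  shows "vmap (T i) z \<in> cobd koszul_chains (koszul_map T) k"
proof -
  have h: "vmap (T i) z = koszul_map T (contract i z)"
    using koszul_homotopy[of T i z, OF T] z by (simp add: cocyc_def clinear_zero[OF clinear_contract])
  show ?thesis
  proof (cases k)
    \<comment> \<open>In degree 0 the only coboundary is zero, but contraction vanishes there too,
      so \<open>vmap (T i) z\<close> is zero itself.\<close>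
    case 0
    then have "contract i z = 0" using z by (simp add: cocyc_def contract_koszul_chains_0)
    then show ?thesis unfolding h using 0 by (simp add: cobd_def clinear_zero[OF clinear_koszul_map[OF T]])
  next
    case (Suc j)
    then show ?thesis unfolding h using z by (auto simp: cobd_def cocyc_def contract_koszul_chains)
  qed
qed

lemma vmap_cocyc_cobd:
  assumes B: "clinear B" and c: "\<And>j x. B (T j x) = T' j (B x)"
  shows "vmap B ` cocyc koszul_chains (koszul_map T) k \<subseteq> cocyc koszul_chains (koszul_map T') k"
    and "vmap B ` cobd koszul_chains (koszul_map T) k \<subseteq> cobd koszul_chains (koszul_map T') k"
  using vmap_koszul_chains[of B, OF clinear_zero[OF B]]
  by (auto simp: cocyc_def cobd_def vmap_koszul_map[of B T T', OF B c, symmetric] clinear_zero[OF clinear_vmap[OF B]])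
    (auto simp: vmap_koszul_map[of B T T', OF B c])

text \<open>The maps induced on cohomology by \<open>A\<close> and \<open>W i\<close> are, up to the factor \<open>l $ i\<close>, inverse to each
  other, because \<open>T i - l $ i\<close> acts on the cohomology as zero.\<close>

lemma koszul_betti_exchange:
  fixes A :: "'h::complex_vector \<Rightarrow> 'h" and W :: "'d::{finite,linorder} \<Rightarrow> 'h \<Rightarrow> 'h"
  assumes A: "clinear A" and W: "\<And>i. clinear (W i)"
    and c: "\<And>i j x. W i (A (W j x)) = W j (A (W i x))" and li: "l $ i \<noteq> 0"
  shows "koszul_betti (shift_tuple (\<lambda>i. W i \<circ> A) l) k n \<longleftrightarrow> koszul_betti (shift_tuple (\<lambda>i. A \<circ> W i) l) k n"
proof -
  let ?T = "shift_tuple (\<lambda>i. W i \<circ> A) l" and ?T' = "shift_tuple (\<lambda>i. A \<circ> W i) l"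
  have WA: "clinear (W i \<circ> A)" and AW: "clinear (A \<circ> W i)" for i
    by (rule clinearI, simp_all add: clinear_add[OF W] clinear_add[OF A] clinear_scale[OF W] clinear_scale[OF A])+
  have lc: "linear_commuting ?T" "linear_commuting ?T'"
    by (rule linear_commuting_shift, simp add: linear_commuting_def WA AW c)+
  then have T: "clinear (?T i)" and T': "clinear (?T' i)" for i by (auto simp: linear_commuting_def)
  have cA: "A (?T j x) = ?T' j (A x)" for j x
    by (simp add: shift_tuple_def clinear_diff[OF A] clinear_scale[OF A])
  have cW: "W i (?T' j x) = ?T j (W i x)" for j x
    by (simp add: shift_tuple_def clinear_diff[OF W] clinear_scale[OF W] c[of i j])
  note mA = vmap_cocyc_cobd[of A ?T ?T', OF A cA] and mW = vmap_cocyc_cobd[of "W i" ?T' ?T, OF W cW]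
  note sub = subspace_cocyc[OF cochain_complex_koszul[OF lc(1)]] subspace_cobd[OF cochain_complex_koszul[OF lc(1)]]
    subspace_cobd[OF cochain_complex_koszul[OF lc(2)]]
  have shT: "vmap (?T i) z = vmap (W i) (vmap A z) - (l $ i) *\<^sub>C z"
    and shT': "vmap (?T' i) z = vmap A (vmap (W i) z) - (l $ i) *\<^sub>C z" for z :: "'h ^ 'd set"
    by (simp_all add: vec_eq_iff shift_tuple_def)
  show ?thesis
    unfolding betti_def
  proof (rule qdim_iso[OF clinear_vmap[OF A] sub mA])
    show "\<forall>x\<in>cocyc koszul_chains (koszul_map ?T) k. vmap A x \<in> cobd koszul_chains (koszul_map ?T') k \<longrightarrow>
      x \<in> cobd koszul_chains (koszul_map ?T) k"
    proof (intro ballI impI)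
      fix z assume z: "z \<in> cocyc koszul_chains (koszul_map ?T) k"
        and "vmap A z \<in> cobd koszul_chains (koszul_map ?T') k"
      then have "vmap (W i) (vmap A z) \<in> cobd koszul_chains (koszul_map ?T) k" using mW by blast
      then have "vmap (W i) (vmap A z) - vmap (?T i) z \<in> cobd koszul_chains (koszul_map ?T) k"
        using koszul_cocycle_annihilated[of ?T z, OF T z] sub by (intro cvs.subspace_diff)
      then have "(l $ i) *\<^sub>C z \<in> cobd koszul_chains (koszul_map ?T) k"
        by (simp add: shT)
      then have "inverse (l $ i) *\<^sub>C (l $ i) *\<^sub>C z \<in> cobd koszul_chains (koszul_map ?T) k"
        by (rule cvs.subspace_scale[OF sub(2)])
      then show "z \<in> cobd koszul_chains (koszul_map ?T) k"
        using li by simp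
    qed
    show "\<forall>z\<in>cocyc koszul_chains (koszul_map ?T') k. \<exists>x\<in>cocyc koszul_chains (koszul_map ?T) k.
      z - vmap A x \<in> cobd koszul_chains (koszul_map ?T') k"
    proof
      fix z assume z: "z \<in> cocyc koszul_chains (koszul_map ?T') k"
      \<comment> \<open>Preimage of the class of \<open>z\<close>: \<open>vmap A ?x\<close> differs
        from \<open>z\<close> by a multiple of \<open>vmap (?T' i) z\<close>, which is a
        coboundary.\<close>
      let ?x = "inverse (l $ i) *\<^sub>C vmap (W i) z"
      have x: "?x \<in> cocyc koszul_chains (koszul_map ?T) k"
        using z mW sub by (intro cvs.subspace_scale) auto
      have "- inverse (l $ i) *\<^sub>C vmap (?T' i) z \<in> cobd koszul_chains (koszul_map ?T') k"
        using koszul_cocycle_annihilated[of ?T' z, OF T' z] sub by (intro cvs.subspace_scale)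
      moreover have "- inverse (l $ i) *\<^sub>C vmap (?T' i) z = z - vmap A ?x"
        unfolding shT' using li
        by (simp add: clinear_scale[OF clinear_vmap[OF A]] cvs.scale_right_diff_distrib )
      ultimately show "\<exists>x\<in>cocyc koszul_chains (koszul_map ?T) k.
        z - vmap A x \<in> cobd koszul_chains (koszul_map ?T') k" using x by metis
    qed
  qed
qed

section \<open>Complexes with coefficients in a subspace, and the comparison at the origin\<close>

definition chains_in :: "'h::complex_vector set \<Rightarrow> nat \<Rightarrow> ('h ^ ('d::finite) set) set"
  where "chains_in F k = {x. \<forall>I. if card I = k then x $ I \<in> F else x $ I = 0}"

text \<open>\<open>chains_in F k\<close> is \<open>F\<close> tensored with the \<open>k\<close>-th
  exterior power, so a basis is given by \<open>axis I s\<close> with \<open>card I = k\<close> and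
  \<open>s\<close> in a basis of \<open>F\<close> modulo \<open>G\<close>. This covers both the
  kernel and the cokernel of \<open>vmap A\<close>.\<close>

lemma qdim_chains_in:
  assumes F: "cvs.subspace F" and G: "cvs.subspace G" and q: "qdim F G n"
  shows "qdim (chains_in F k :: ('h::complex_vector ^ ('d::finite) set) set) (chains_in G k) (n * (CARD('d) choose k))"
proof -
  obtain S where S: "qindep G S" "S \<subseteq> F" "\<forall>z\<in>F. \<exists>c. z - (\<Sum>s\<in>S. c s *\<^sub>C s) \<in> G" "card S = n"
    by (rule qdimE[OF q])
  have fin: "finite S" using S(1) by (simp add: qindep_def)
  \<comment> \<open>\<open>axis I s\<close> determines \<open>I\<close> only for nonzero
    \<open>s\<close>.\<close>
  have nz: "s \<noteq> 0" if "s \<in> S" for s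
  proof
    assume "s = 0"
    then have "(\<Sum>x\<in>S. (if x = s then 1 else 0) *\<^sub>C x) \<in> G"
      using sum_delta_scaleC[OF fin that] cvs.subspace_0[OF G] by (simp only:)
    then have "(if s = s then 1 else 0 :: complex) = 0"
      using S(1) that qindepD[where c = "\<lambda>x. if x = s then 1 else 0"] by blast
    then show False by simp
  qed
  define K :: "'d set set" where "K = {I. card I = k}"
  let ?a = "\<lambda>p :: 'd set \<times> 'h. axis (fst p) (snd p)"
  have inj: "inj_on ?a (K \<times> S)"
    by (rule inj_onI) (auto simp: axis_eq_axis nz)
  have cardK: "card K = CARD('d) choose k"
    using n_subsets[of "UNIV :: 'd set" k] by (simp add: K_def)
  have comp: "(\<Sum>x\<in>?a ` (K \<times> S). c x *\<^sub>C x) $ I = (if I \<in> K then \<Sum>s\<in>S. c (axis I s) *\<^sub>C s else 0)" for c I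
  proof -
    have "(\<Sum>x\<in>?a ` (K \<times> S). c x *\<^sub>C x) $ I = (\<Sum>p\<in>K \<times> S. (c (?a p) *\<^sub>C ?a p) $ I)"
      by (simp add: sum.reindex[OF inj])
    also have "\<dots> = (\<Sum>J\<in>K. \<Sum>s\<in>S. (c (axis J s) *\<^sub>C axis J s) $ I)"
      by (simp add: sum.cartesian_product case_prod_beta)
    also have "\<dots> = (\<Sum>J\<in>K. if J = I then \<Sum>s\<in>S. c (axis I s) *\<^sub>C s else 0)"
      by (intro sum.cong) (auto simp: axis_def)
    finally show ?thesis by simp
  qed
  show ?thesis
  proof (rule qdimI[of _ "?a ` (K \<times> S)"])
    show "qindep (chains_in G k) (?a ` (K \<times> S))"
      unfolding qindep_def
    proof (intro conjI allI impI)
      show "finite (?a ` (K \<times> S))" using fin by simp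
      fix c assume c: "(\<Sum>x\<in>?a ` (K \<times> S). c x *\<^sub>C x) \<in> chains_in G k"
      have "c (axis I s) = 0" if "I \<in> K" "s \<in> S" for I s
      proof -
        have "(\<Sum>x\<in>?a ` (K \<times> S). c x *\<^sub>C x) $ I \<in> G"
          using spec[OF c[unfolded chains_in_def mem_Collect_eq], of I] \<open>I \<in> K\<close>
          by (simp only: K_def mem_Collect_eq if_True)
        then have "(\<Sum>s\<in>S. c (axis I s) *\<^sub>C s) \<in> G" unfolding comp using \<open>I \<in> K\<close> by simp
        then show ?thesis using S(1) \<open>s \<in> S\<close> qindepD[where c = "\<lambda>s. c (axis I s)"] by blast
      qed
      then show "\<forall>x\<in>?a ` (K \<times> S). c x = 0" by auto
    qed
    show "?a ` (K \<times> S) \<subseteq> chains_in F k"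
      using S(2) cvs.subspace_0[OF F] by (auto simp: chains_in_def K_def axis_def)
    show "\<forall>z\<in>chains_in F k. \<exists>c. z - (\<Sum>s\<in>?a ` (K \<times> S). c s *\<^sub>C s) \<in> chains_in G k"
    proof
      fix z :: "'h ^ 'd set" assume z: "z \<in> chains_in F k"
      have "\<forall>I\<in>K. \<exists>c. z $ I - (\<Sum>s\<in>S. c s *\<^sub>C s) \<in> G"
        using z S(3) by (auto simp: chains_in_def K_def)
      then obtain e where e: "\<forall>I\<in>K. z $ I - (\<Sum>s\<in>S. e I s *\<^sub>C s) \<in> G" by metis
      define c where "c x = (let p = inv_into (K \<times> S) ?a x in e (fst p) (snd p))" for x
      have c: "c (axis I s) = e I s" if "I \<in> K" "s \<in> S" for I s
        using inv_into_f_f[OF inj, of "(I, s)"] that by (simp add: c_def)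
      have "z - (\<Sum>s\<in>?a ` (K \<times> S). c s *\<^sub>C s) \<in> chains_in G k"
        unfolding chains_in_def
      proof (intro CollectI allI)
        fix I
        show "if card I = k then (z - (\<Sum>s\<in>?a ` (K \<times> S). c s *\<^sub>C s)) $ I \<in> G
          else (z - (\<Sum>s\<in>?a ` (K \<times> S). c s *\<^sub>C s)) $ I = 0"
          unfolding vector_minus_component comp using e z c
          by (auto simp: K_def chains_in_def)
      qed
      then show "\<exists>c. z - (\<Sum>s\<in>?a ` (K \<times> S). c s *\<^sub>C s) \<in> chains_in G k" by (rule exI[of _ c])
    qed
    show "card (?a ` (K \<times> S)) = n * (CARD('d) choose k)"
      by (simp add: card_image[OF inj] card_cartesian_product cardK S(4) mult.commute)
  qed
qed

lemma alternating_choose_sum: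
  assumes "d > 0"
  shows "(\<Sum>k\<le>d. (-1) ^ k * int (n * (d choose k))) = 0"
proof -
  have "(\<Sum>k\<le>d. (-1) ^ k * int (n * (d choose k))) = int n * (\<Sum>k\<le>d. (-1) ^ k * int (d choose k))"
    unfolding sum_distrib_left of_nat_mult by (intro sum.cong refl) (simp only: mult.left_commute)
  also have "(\<Sum>k\<le>d. (-1) ^ k * int (d choose k)) = 0"
    by (rule choose_alternating_sum[OF assms])
  finally show ?thesis by simp
qed

text \<open>\<open>vmap A\<close> maps the complex of \<open>T\<close> onto a subcomplex of that of
  \<open>T'\<close>. The projection onto the image has a kernel of finite dimension, the inclusion
  has finite codimension, and both corrections are multiples of binomial coefficients whose
  alternating sum is zero.\<close>

lemma fredholm_intertwine:
  fixes T T' :: "'d::{finite,linorder} \<Rightarrow> 'h::complex_vector \<Rightarrow> 'h"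
  assumes lc: "linear_commuting T" "linear_commuting T'" and A: "clinear A"
    and c: "\<And>i x. A (T i x) = T' i (A x)"
    and ker: "qdim {x. A x = 0} {0} n" and coker: "qdim UNIV (range A) q"
  shows "fredholm_tuple T' \<longleftrightarrow> fredholm_tuple T"
    and "fredholm_tuple T \<Longrightarrow> fredholm_index T' = fredholm_index T"
proof -
  let ?C = "koszul_chains :: nat \<Rightarrow> ('h ^ 'd set) set"
  let ?R = "\<lambda>k. vmap A ` ?C k"
  let ?d = "CARD('d)"
  note C = cochain_complex_koszul[OF lc(1)] and C' = cochain_complex_koszul[OF lc(2)]
  have comm: "vmap A (koszul_map T x) = koszul_map T' (vmap A x)" for x
    by (rule vmap_koszul_map[of A T T', OF A c])
  have vA: "clinear (vmap A :: 'h ^ 'd set \<Rightarrow> 'h ^ 'd set)" by (rule clinear_vmap[OF A])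
  have RC: "?R k \<subseteq> ?C k" for k using vmap_koszul_chains[of A, OF clinear_zero[OF A]] by blast
  have R: "cochain_complex ?d ?R (koszul_map T')"
    using C C' RC unfolding cochain_complex_def
    by (auto simp: comm[symmetric] subspace_clinear_image[OF vA] clinear_zero[OF vA])
  have UN: "cvs.subspace (UNIV :: 'h set)" by (rule cvs.subspace_UNIV)
  have rA: "cvs.subspace (range A)" by (rule subspace_clinear_image[OF A UN])
  have "?C k = chains_in UNIV k" "?R k = chains_in (range A) k" for k
  proof -
    show "?C k = chains_in UNIV k" by (auto simp: koszul_chains_def chains_in_def)
    show "?R k = chains_in (range A) k"
    proof (intro subset_antisym subsetI)
      show "x \<in> chains_in (range A) k" if "x \<in> ?R k" for x
        using that by (auto simp: koszul_chains_def chains_in_def clinear_zero[OF A])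
      fix x :: "'h ^ 'd set" assume x: "x \<in> chains_in (range A) k"
      \<comment> \<open>Preimages are taken only in components of degree \<open>k\<close>:
        \<open>inv A 0\<close> need not be \<open>0\<close>, and \<open>y\<close> has to be a
        chain.\<close>
      define y where "y = (\<chi> I. if card I = k then inv A (x $ I) else 0)"
      have "A (inv A (x $ I)) = x $ I" if "card I = k" for I
        using x that by (intro f_inv_into_f) (auto simp: chains_in_def)
      then have "x = vmap A y" using x by (auto simp: vec_eq_iff y_def chains_in_def clinear_zero[OF A])
      moreover have "y \<in> ?C k" by (simp add: y_def koszul_chains_def)
      ultimately show "x \<in> ?R k" by blast
    qed
  qed
  then have qC: "qdim (?C k) (?R k) (q * (?d choose k))" for k
    using qdim_chains_in[OF UN rA coker, of k] by simp
  have "{x \<in> ?C k. vmap A x = 0} = chains_in {x. A x = 0} k" for k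
    by (auto simp: koszul_chains_def chains_in_def vec_eq_iff) (metis clinear_zero[OF A])
  moreover have "{0 :: 'h ^ 'd set} = chains_in {0} k" for k
    by (auto simp: chains_in_def vec_eq_iff split: if_splits)
  ultimately have qN: "qdim {x \<in> ?C k. vmap A x = 0} {0} (n * (?d choose k))" for k
    using qdim_chains_in[where 'd = 'd, OF subspace_clinear_Collect[OF A UN, simplified] cvs.subspace_single_0 ker, of k] by simp
  have l1: "betti_linked ?d (\<lambda>k. int (n * (?d choose k))) (koszul_betti T) (betti ?R (koszul_map T'))"
    by (rule betti_linked_quotient[OF C R vA]) (simp_all only: comm qN)
  have l2: "betti_linked ?d (\<lambda>k. int (q * (?d choose k))) (koszul_betti T') (betti ?R (koszul_map T'))"
    by (rule betti_linked_subcomplex[OF C' R]) (simp_all only: RC qC)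
  show "fredholm_tuple T' \<longleftrightarrow> fredholm_tuple T"
    unfolding fredholm_tuple_iff using betti_linked_finite[OF l1] betti_linked_finite[OF l2] by simp
  assume "fredholm_tuple T"
  then have "\<forall>k\<le>?d. \<exists>n. koszul_betti T k n" "\<forall>k\<le>?d. \<exists>n. betti ?R (koszul_map T') k n"
    "\<forall>k\<le>?d. \<exists>n. koszul_betti T' k n"
    unfolding fredholm_tuple_iff using betti_linked_finite[OF l1] betti_linked_finite[OF l2] by simp_all
  then have ex: "k \<le> ?d \<Longrightarrow> \<exists>n. koszul_betti T k n" "k \<le> ?d \<Longrightarrow> \<exists>n. betti ?R (koszul_map T') k n"
    "k \<le> ?d \<Longrightarrow> \<exists>n. koszul_betti T' k n" for k by blast+
  define a b r where "a k = (SOME n. koszul_betti T k n)" and "b k = (SOME n. koszul_betti T' k n)"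
    and "r k = (SOME n. betti ?R (koszul_map T') k n)" for k
  have a: "\<And>k. k \<le> ?d \<Longrightarrow> koszul_betti T k (a k)"
    and b: "\<And>k. k \<le> ?d \<Longrightarrow> koszul_betti T' k (b k)"
    and r: "\<And>k. k \<le> ?d \<Longrightarrow> betti ?R (koszul_map T') k (r k)"
    unfolding a_def b_def r_def by (simp_all only: someI_ex[OF ex(1)] someI_ex[OF ex(2)] someI_ex[OF ex(3)])
  \<comment> \<open>Types are nonempty; in dimension zero the alternating sum of binomial
    coefficients would be \<open>1\<close>.\<close>
  have d: "?d > 0" by simp
  show "fredholm_index T' = fredholm_index T"
    using betti_linked_euler[where m = a and n = r, OF l1 a r betti_unique[OF R]]
      betti_linked_euler[where m = b and n = r, OF l2 b r betti_unique[OF R]]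
    by (simp only: fredholm_index_eq[OF lc(1) a] fredholm_index_eq[OF lc(2) b] alternating_choose_sum[OF d])
qed


section \<open>Finite kernel and corank at the origin\<close>

lemma koszul_map_axis_empty:
  fixes T :: "'d::{finite,linorder} \<Rightarrow> 'h::complex_vector \<Rightarrow> 'h"
  assumes T: "\<And>i. T i 0 = 0"
  shows "koszul_map T (axis {} x) = (\<Sum>i\<in>UNIV. axis {i} (T i x))"
  unfolding koszul_map_eq
proof (intro sum.cong refl)
  fix i :: 'd
  have "J - {i} = {} \<longleftrightarrow> J = {i}" if "i \<in> J" for J using that by auto
  then show "wedge i (vmap (T i) (axis {} x)) = axis {i} (T i x)"
    using T by (auto simp: vec_eq_iff wedge_nth axis_def wedge_sign_def)
qed

lemma koszul_map_axis_empty_eq_0_iff: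
  fixes T :: "'d::{finite,linorder} \<Rightarrow> 'h::complex_vector \<Rightarrow> 'h"
  assumes T: "\<And>i. T i 0 = 0"
  shows "koszul_map T (axis {} x) = 0 \<longleftrightarrow> (\<forall>i. T i x = 0)"
proof
  assume "\<forall>i. T i x = 0"
  then show "koszul_map T (axis {} x) = 0"
    by (simp add: koszul_map_axis_empty[of T, OF T] axis_eq_0_iff[THEN iffD2])
next
  assume 0: "koszul_map T (axis {} x) = 0"
  show "\<forall>i. T i x = 0"
  proof
    fix i
    have "koszul_map T (axis {} x) $ {i} = (\<Sum>j\<in>UNIV. axis {j} (T j x) $ {i})"
      unfolding koszul_map_axis_empty[of T, OF T] by simp
    also have "\<dots> = (\<Sum>j\<in>UNIV. if j = i then T j x else 0)"
      by (intro sum.cong) (auto simp: axis_def)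
    finally show "T i x = 0" using 0 by simp
  qed
qed

lemma axis_koszul_chains: "axis I x \<in> koszul_chains (card I)"
  by (auto simp: koszul_chains_def axis_def)

lemma koszul_chains_0_iff: "x \<in> koszul_chains 0 \<longleftrightarrow> x = axis {} (x $ {})"
  by (auto simp: koszul_chains_def vec_eq_iff axis_def)

text \<open>The degree-0 cohomology controls \<open>ker P\<close>, and the degree-1 cohomology contains the classes of
  \<open>(V\<^sub>1 x, \<dots>, V\<^sub>d x)\<close>, \<open>x \<in> M\<close>, which vanish only for \<open>x\<close> in the range of \<open>P\<close>.\<close>

lemma fredholm_imp_finite_corank:
  fixes T V :: "'d::{finite,linorder} \<Rightarrow> 'h::complex_vector \<Rightarrow> 'h"
  assumes fr: "fredholm_tuple T" and lc: "linear_commuting T"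
    and V: "\<And>i. clinear (V i)" and P: "clinear P"
    and TVP: "\<And>i x. T i x = V i (P x)" and TV: "\<And>i j x. T i (V j x) = T j (V i x)"
    and ker: "\<And>x. P x = 0 \<longleftrightarrow> (\<forall>i. V i x = 0)"
    and M: "cvs.subspace M" and PM: "range P \<subseteq> M"
    and int: "\<And>x. x \<in> M \<Longrightarrow> P x = 0 \<Longrightarrow> x = 0"
    and dec: "\<And>z. \<exists>x. P x = 0 \<and> z - x \<in> M"
  shows "\<exists>n. qdim {x. P x = 0} {0} n" and "\<exists>q. qdim UNIV (range P) q"
proof -
  have T: "clinear (T i)" for i using lc by (simp add: linear_commuting_def)
  note T0 = clinear_zero[OF T] and V0 = clinear_zero[OF V]
  note cx = cochain_complex_koszul[OF lc]
  have ax: "clinear (axis {} :: 'h \<Rightarrow> 'h ^ 'd set)" by (rule clinear_axis)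
  have N: "cvs.subspace {x. P x = 0}"
    using subspace_clinear_Collect[OF P cvs.subspace_UNIV] by simp
  have rP: "cvs.subspace (range P)" by (rule subspace_clinear_image[OF P cvs.subspace_UNIV])
  \<comment> \<open>In the application \<open>M\<close> is the closure of the range of
    \<open>P\<close>. If all \<open>V i\<close> vanish at \<open>P x\<close>, then
    \<open>P (P x) = 0\<close>, and \<open>int\<close> gives \<open>P x = 0\<close> because
    \<open>P x\<close> lies in \<open>M\<close>.\<close>
  have kT: "(\<forall>i. T i x = 0) \<longleftrightarrow> P x = 0" for x
    using int[of "P x"] PM ker[of "P x"] by (auto simp: TVP V0)
  obtain n where "koszul_betti T 0 n" using fr unfolding fredholm_tuple_iff by auto
  then have b0: "qdim (cocyc koszul_chains (koszul_map T) 0) {0} n" by (simp add: betti_def cobd_def)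
  have "qdim {x. P x = 0} {0} n \<longleftrightarrow> qdim (cocyc koszul_chains (koszul_map T) 0) {0} n"
  proof (rule qdim_iso[OF ax N])
    show "axis {} ` {x. P x = 0} \<subseteq> cocyc koszul_chains (koszul_map T) 0"
      using axis_koszul_chains[where I = "{}"]
      by (auto simp: cocyc_def koszul_map_axis_empty_eq_0_iff[of T, OF T0] kT)
    show "\<forall>z\<in>cocyc koszul_chains (koszul_map T) 0. \<exists>x\<in>{x. P x = 0}. z - axis {} x \<in> {0}"
    proof
      fix z assume z: "z \<in> cocyc koszul_chains (koszul_map T) 0"
      then have za: "z = axis {} (z $ {})" by (simp add: cocyc_def koszul_chains_0_iff[symmetric])
      moreover have "P (z $ {}) = 0"
        using z koszul_map_axis_empty_eq_0_iff[of T "z $ {}", OF T0] unfolding za[symmetric] kT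
        by (simp add: cocyc_def)
      ultimately show "\<exists>x\<in>{x. P x = 0}. z - axis {} x \<in> {0}" by (intro bexI[of _ "z $ {}"]) simp_all
    qed
  qed (auto simp: axis_eq_0_iff)
  then have N0: "qdim {x. P x = 0} {0} n" using b0 by blast
  then show "\<exists>n. qdim {x. P x = 0} {0} n" ..
  have "1 \<le> CARD('d)" by (simp add: Suc_leI)
  then obtain m where m: "koszul_betti T 1 m" using fr unfolding fredholm_tuple_iff by blast
  define f where "f x = koszul_map V (axis {} x)" for x
  have f: "clinear f"
    by (rule clinearI)
      (simp_all add: f_def clinear_add[OF ax] clinear_scale[OF ax] clinear_add[OF clinear_koszul_map[OF V]]
        clinear_scale[OF clinear_koszul_map[OF V]])
  have f1: "f ` M \<subseteq> cocyc koszul_chains (koszul_map T) 1"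
    using koszul_map_koszul_map[of T V, OF T TV] koszul_map_koszul_chains[of V _ 0, OF V0]
      axis_koszul_chains[where I = "{}"]
    by (auto simp: f_def cocyc_def)
  have fP: "f (P x) = koszul_map T (axis {} x)" for x
    by (simp add: f_def koszul_map_axis_empty[of V, OF V0] koszul_map_axis_empty[of T, OF T0] TVP)
  have f2: "f ` range P \<subseteq> cobd koszul_chains (koszul_map T) 1"
    using axis_koszul_chains[where I = "{}"] by (auto simp: fP cobd_def intro!: imageI)
  \<comment> \<open>A coboundary in degree 1 has the form \<open>f (P w)\<close>. If it equals
    \<open>f x\<close>, all \<open>V i\<close> kill \<open>x - P w\<close>, hence so does
    \<open>P\<close>; as \<open>x - P w\<close> lies in \<open>M\<close>, it is zero.\<close>
  have f3: "\<forall>x\<in>M. f x \<in> cobd koszul_chains (koszul_map T) 1 \<longrightarrow> x \<in> range P"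
  proof (intro ballI impI)
    fix x assume x: "x \<in> M" "f x \<in> cobd koszul_chains (koszul_map T) 1"
    then obtain y where "f x = koszul_map T y" "y \<in> koszul_chains 0" by (auto simp: cobd_def)
    then have "f x = f (P (y $ {}))" unfolding fP by (metis koszul_chains_0_iff)
    then have "f (x - P (y $ {})) = 0" by (simp add: clinear_diff[OF f])
    then have "P (x - P (y $ {})) = 0"
      unfolding f_def ker koszul_map_axis_empty_eq_0_iff[of V, OF V0] by assumption
    moreover have "x - P (y $ {}) \<in> M" using x(1) PM by (intro cvs.subspace_diff[OF M]) auto
    ultimately have "x = P (y $ {})" using int by fastforce
    then show "x \<in> range P" by blast
  qed
  have "\<exists>q. qdim M (range P) q"
  proof (rule qdim_exists[OF M rP])
    fix S assume S: "qindep (range P) S" "S \<subseteq> M"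
    note i = qindep_image[OF f M subspace_cobd[OF cx] f3 S]
    have "card (f ` S) \<le> m"
      using i S(2) f1 m unfolding betti_def by (intro qdim_bound[OF subspace_cobd[OF cx]]) auto
    then show "card S \<le> m" using i by (simp add: card_image)
  qed
  \<comment> \<open>\<open>M\<close> is a complement of the kernel of \<open>P\<close>, so its
    codimension is the dimension already found in degree 0.\<close>
  moreover have "qdim {x. P x = 0} {0} n \<longleftrightarrow> qdim UNIV M n"
  proof (rule qdim_iso[where f = "\<lambda>x. x"])
    show "clinear (\<lambda>x::'h. x)" by (rule clinearI) auto
    show "\<forall>z\<in>UNIV. \<exists>x\<in>{x. P x = 0}. z - x \<in> M" using dec by blast
    show "\<forall>x\<in>{x. P x = 0}. x \<in> M \<longrightarrow> x \<in> {0}" using int by blast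
  qed (use N M cvs.subspace_0[OF M] in auto)
  ultimately show "\<exists>q. qdim UNIV (range P) q"
    using N0 qdim_add[OF rP M PM subset_UNIV] by blast
qed

text \<open>Every coboundary in top degree has its coefficient in the range of \<open>A\<close>.\<close>

lemma fredholm_comp_imp_finite_corank:
  fixes W :: "'d::{finite,linorder} \<Rightarrow> 'h::complex_vector \<Rightarrow> 'h"
  assumes fr: "fredholm_tuple (\<lambda>i. A \<circ> W i)" and lc: "linear_commuting (\<lambda>i. A \<circ> W i)"
    and A: "clinear A" and int: "\<And>x. A (A x) = 0 \<Longrightarrow> A x = 0"
  shows "\<exists>n. qdim {x. A x = 0} {0} n" and "\<exists>q. qdim UNIV (range A) q"
proof -
  let ?T = "\<lambda>i. A \<circ> W i" and ?d = "CARD('d)"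
  note cx = cochain_complex_koszul[OF lc]
  have rA: "cvs.subspace (range A)" by (rule subspace_clinear_image[OF A cvs.subspace_UNIV])
  have N: "cvs.subspace {x. A x = 0}"
    using subspace_clinear_Collect[OF A cvs.subspace_UNIV] by simp
  let ?Z = "cocyc koszul_chains (koszul_map ?T) ?d" and ?B = "cobd koszul_chains (koszul_map ?T) ?d"
  obtain m where m: "qdim ?Z ?B m" using fr unfolding fredholm_tuple_iff betti_def by blast
  have ax: "clinear (axis UNIV :: 'h \<Rightarrow> 'h ^ 'd set)" by (rule clinear_axis)
  have chd: "axis (UNIV :: 'd set) x \<in> koszul_chains ?d" for x :: 'h
    by (rule axis_koszul_chains)
  have f1: "range (axis UNIV) \<subseteq> ?Z"
  proof
    fix z :: "'h ^ 'd set" assume "z \<in> range (axis UNIV)"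
    then have z: "z \<in> koszul_chains ?d" using chd by auto
    then have "koszul_map ?T z \<in> {0}" using cx unfolding cochain_complex_def by metis
    then show "z \<in> ?Z" using z by (simp add: cocyc_def)
  qed
  have f3: "\<forall>x\<in>UNIV. axis UNIV x \<in> ?B \<longrightarrow> x \<in> range A"
  proof (intro ballI impI)
    fix x assume "axis UNIV x \<in> ?B"
    then obtain y where "axis UNIV x = koszul_map ?T y" by (auto simp: cobd_def split: if_splits)
    then have "x = koszul_map ?T y $ UNIV" by (metis axis_nth)
    also have "\<dots> = (\<Sum>i\<in>UNIV. wedge_sign i (UNIV - {i}) *\<^sub>C A (W i (y $ (UNIV - {i}))))"
      by (simp add: koszul_map_eq wedge_nth)
    also have "\<dots> \<in> range A" using rA by (intro cvs.subspace_sum cvs.subspace_scale) auto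
    finally show "x \<in> range A" .
  qed
  have bound: "card S \<le> m" if S: "qindep (range A) S" for S
  proof -
    have i: "inj_on (axis (UNIV :: 'd set)) S" "qindep ?B (axis UNIV ` S)"
      using qindep_image[OF ax cvs.subspace_UNIV subspace_cobd[OF cx] f3 S subset_UNIV] by auto
    have "card (axis (UNIV :: 'd set) ` S) \<le> m"
      using i f1 by (intro qdim_bound[OF subspace_cobd[OF cx] m]) auto
    then show ?thesis using i by (simp add: card_image)
  qed
  then show "\<exists>q. qdim UNIV (range A) q" by (intro qdim_exists[OF cvs.subspace_UNIV rA])
  show "\<exists>n. qdim {x. A x = 0} {0} n"
  proof (rule qdim_exists[OF N cvs.subspace_single_0])
    fix S assume S: "qindep {0} S" "S \<subseteq> {x. A x = 0}"
    \<comment> \<open>The kernel meets the range of \<open>A\<close> trivially, so independence in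
      the kernel persists modulo the range, where \<open>bound\<close> applies.\<close>
    have "qindep (range A) S"
      unfolding qindep_def
    proof (intro conjI allI impI)
      show "finite S" using S(1) by (simp add: qindep_def)
      fix c assume c: "(\<Sum>s\<in>S. c s *\<^sub>C s) \<in> range A"
      have "A (\<Sum>s\<in>S. c s *\<^sub>C s) = 0" using S(2) by (auto simp: clinear_sum_scale[OF A] intro!: sum.neutral)
      then have "(\<Sum>s\<in>S. c s *\<^sub>C s) \<in> {0}" using c int by auto
      then show "\<forall>s\<in>S. c s = 0" using S(1) unfolding qindep_def by blast
    qed
    then show "card S \<le> m" by (rule bound)
  qed
qed

section \<open>The spherical polar decomposition\<close>

lemma bounded_clinear_clinear: "bounded_clinear A \<Longrightarrow> clinear A"
  by (rule clinearI) (simp_all add: bounded_clinear_add bounded_clinear_scale)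

lemma subspace_closure_range:
  fixes A :: "'h::chilbert_space \<Rightarrow> 'h"
  assumes A: "bounded_clinear A"
  shows "cvs.subspace (closure (range A))"
proof -
  have "c *\<^sub>C x \<in> closure (range A)" if "x \<in> closure (range A)" for c x
    using that by (rule subspace_closure_scaleC[rotated]) (auto simp flip: bounded_clinear_scale[OF A])
  moreover have "x + y \<in> closure (range A)" if "x \<in> closure (range A)" "y \<in> closure (range A)" for x y
  proof -
    obtain u v where u: "\<forall>n. u n \<in> range A" "u \<longlonglongrightarrow> x" and v: "\<forall>n. v n \<in> range A" "v \<longlonglongrightarrow> y"
      using \<open>x \<in> closure (range A)\<close> \<open>y \<in> closure (range A)\<close> unfolding closure_sequential by blast
    have "u n + v n \<in> range A" for n
      using u(1) v(1) subspace_add[OF subspace_range_bounded_clinear[OF A]] by blast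
    then show ?thesis
      unfolding closure_sequential using tendsto_add[OF u(2) v(2)]
      by (intro exI[of _ "\<lambda>n. u n + v n"]) auto
  qed
  moreover have "0 \<in> closure (range A)"
    using subspace_0[OF subspace_range_bounded_clinear[OF A]] by (rule subsetD[OF closure_subset])
  ultimately show ?thesis by (simp add: cvs.subspace_def)
qed

text \<open>Projecting \<open>x\<close> onto the closure of the range leaves a remainder orthogonal
  to the range, hence in the kernel. Operators are compared below on these two parts
  separately.\<close>

lemma selfadj_decomposition:
  assumes P: "selfadj P"
  obtains m where "m \<in> closure (range P)" "P (x - m) = 0"
proof -
  obtain m where m: "m \<in> closure (range P)" "\<And>y. y \<in> range P \<Longrightarrow> inner y (x - m) = 0"
    using orthogonal_decomposition[OF subspace_range_bounded_clinear[OF selfadj_bounded_clinear[OF P]], of x] by blast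
  have "P (x - m) = 0" using m(2) by (intro selfadj_kernel_orthogonal[OF P]) blast
  then show thesis using that m(1) by blast
qed

lemma selfadj_kernel_closure_range:
  assumes P: "selfadj P" and "P k = 0" and "m \<in> closure (range P)"
  shows "inner m k = 0"
  using assms(2) by (intro closure_inner_zero[OF _ assms(3)]) (auto simp: selfadj_inner[OF P])

lemma selfadj_closure_range_inter_kernel:
  assumes "selfadj P" "m \<in> closure (range P)" "P m = 0"
  shows "m = 0"
  using selfadj_kernel_closure_range[OF assms(1,3,2)] by simp

text \<open>The adjoint \<open>U\<close> of the sought factor is obtained from Riesz on the subspace \<open>range P\<close>, applied to
  the functionals \<open>P z \<mapsto> \<langle>T z, y\<rangle>\<close>.\<close>

lemma Douglas_factorization:
  fixes T P :: "'h::chilbert_space \<Rightarrow> 'h"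
  assumes T: "bounded_clinear T" and P: "selfadj P" and le: "\<And>x. norm (T x) \<le> norm (P x)"
  obtains V where "bounded_clinear V" "\<And>x. V (P x) = T x" "\<And>x. P x = 0 \<Longrightarrow> V x = 0"
proof -
  note cP = selfadj_bounded_clinear[OF P]
  have wd: "T x = T y" if "P x = P y" for x y
    using le[of "x - y"] that by (simp add: bounded_clinear_diff[OF T] bounded_clinear_diff[OF cP])
  have "\<exists>u. u \<in> closure (range P) \<and> (\<forall>z. inner (P z) u = inner (T z) y) \<and> norm u \<le> norm y" for y
  proof -
    \<comment> \<open>\<open>inv P\<close> picks an arbitrary preimage; by \<open>wd\<close> the map
      \<open>T\<close> does not distinguish between them.\<close>
    define \<phi> where "\<phi> w = inner (T (inv P w)) y" for w
    have \<phi>: "\<phi> (P z) = inner (T z) y" for z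
      using wd[of "inv P (P z)" z] by (simp add: \<phi>_def f_inv_into_f)
    obtain u where "u \<in> closure (range P)" "\<And>w. w \<in> range P \<Longrightarrow> inner w u = \<phi> w" "norm u \<le> norm y"
    proof (rule Riesz_on_subspace[OF subspace_range_bounded_clinear[OF cP], of \<phi> "norm y"])
      show "\<phi> (w + v) = \<phi> w + \<phi> v" if "w \<in> range P" "v \<in> range P" for w v
        using that by (auto simp: \<phi> inner_add_left bounded_clinear_add[OF T] simp flip: bounded_clinear_add[OF cP])
      show "\<phi> (r *\<^sub>R w) = r * \<phi> w" if "w \<in> range P" for r w
        using that by (auto simp: \<phi> bounded_clinear_scaleR[OF T] simp flip: bounded_clinear_scaleR[OF cP])
      show "\<bar>\<phi> w\<bar> \<le> norm y * norm w" if "w \<in> range P" for w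
      proof -
        obtain z where z: "w = P z" using \<open>w \<in> range P\<close> by blast
        have "\<bar>inner (T z) y\<bar> \<le> norm (T z) * norm y" by (rule Cauchy_Schwarz_ineq2)
        also have "\<dots> \<le> norm (P z) * norm y" by (intro mult_right_mono le) simp
        finally show ?thesis by (simp add: z \<phi> mult.commute)
      qed
    qed auto
    then show ?thesis using \<phi> by (intro exI[of _ u]) auto
  qed
  then obtain U where U: "\<And>y. U y \<in> closure (range P)" "\<And>z y. inner (P z) (U y) = inner (T z) y"
    "\<And>y. norm (U y) \<le> norm y" by metis
  note cl = subspace_closure_range[OF cP]
  \<comment> \<open>Vectors in the closure of the range are determined by their inner products with
    the range. Taking the representing vectors there makes \<open>U\<close> linear, and it makes
    \<open>V\<close> vanish on the kernel of \<open>P\<close>.\<close>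
  have eq0: "u = v" if "u \<in> closure (range P)" "v \<in> closure (range P)" "\<And>z. inner (P z) u = inner (P z) v" for u v
  proof -
    have "u - v \<in> closure (range P)" using that cl by (intro cvs.subspace_diff)
    moreover have "P (u - v) = 0"
      using that(3) by (intro selfadj_kernel_orthogonal[OF P]) (simp add: inner_diff_right)
    ultimately show ?thesis using selfadj_closure_range_inter_kernel[OF P] by fastforce
  qed
  have cU: "bounded_clinear U"
  proof (rule bounded_clinear_intro[where K = 1])
    show "U (x + y) = U x + U y" for x y
      using U cl by (intro eq0 cvs.subspace_add) (auto simp: inner_add_right)
    show "U (c *\<^sub>C x) = c *\<^sub>C U x" for c x
    proof (rule eq0)
      fix z
      have "inner (P z) (U (c *\<^sub>C x)) = inner (T (cnj c *\<^sub>C z)) x"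
        using inner_scaleC_left[of "cnj c" "T z" x] by (simp add: U bounded_clinear_scale[OF T])
      also have "\<dots> = inner (P z) (c *\<^sub>C U x)"
        using inner_scaleC_left[of "cnj c" "P z" "U x"] by (simp add: bounded_clinear_scale[OF cP] flip: U(2))
      finally show "inner (P z) (U (c *\<^sub>C x)) = inner (P z) (c *\<^sub>C U x)" .
    qed (use U cl in \<open>auto intro: cvs.subspace_scale\<close>)
  qed (simp add: U)
  obtain V where V: "\<And>x y. inner (U x) y = inner x (V y)" using adjoint_exists[OF cU] by blast
  have V0: "V x = v" if "\<And>y. inner y (V x) = inner y v" for x v
  proof -
    have "inner (V x - v) (V x - v) = 0" using that[of "V x - v"] by (simp add: inner_diff_right)
    then show ?thesis by simp
  qed
  show thesis
  proof (rule that)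
    show "bounded_clinear V" using cU V by (rule bounded_clinear_adjoint_pair)
    show "V (P x) = T x" for x
      by (rule V0) (metis U(2) V inner_commute)
    show "V x = 0" if "P x = 0" for x
      using selfadj_kernel_closure_range[OF P that U(1)] by (intro V0) (simp flip: V)
  qed
qed

section \<open>Modulus, polar part and fractional powers\<close>

lemma norm_column_op: "(norm (column_op T x))\<^sup>2 = (\<Sum>i\<in>UNIV. (norm (T i x))\<^sup>2)"
  by (simp add: column_op_def norm_vec_def L2_set_def sum_nonneg)

lemma column_op_eq_0_iff: "column_op V x = 0 \<longleftrightarrow> (\<forall>i. V i x = 0)"
  by (simp add: column_op_def vec_eq_iff)

lemma bounded_clinear_column_op_iff:
  fixes V :: "'d::finite \<Rightarrow> 'h::chilbert_space \<Rightarrow> 'h"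
  shows "bounded_clinear (column_op V) \<longleftrightarrow> (\<forall>i. bounded_clinear (V i))"
proof
  assume c: "bounded_clinear (column_op V)"
  show "\<forall>i. bounded_clinear (V i)"
  proof
    fix i
    have "bounded_linear (\<lambda>x. column_op V x $ i)"
      by (rule bounded_linear_compose[OF bounded_linear_vec_nth bounded_clinear_bounded_linear[OF c]])
    moreover have "column_op V (a *\<^sub>C x) $ i = a *\<^sub>C (column_op V x $ i)" for a x
      by (simp add: bounded_clinear_scale[OF c])
    ultimately show "bounded_clinear (V i)" by (simp add: bounded_clinear_def column_op_def)
  qed
next
  assume c: "\<forall>i. bounded_clinear (V i)"
  then have "\<exists>K. \<forall>x. norm (V i x) \<le> K * norm x" for i by (metis bounded_clinear_bound)
  then obtain K where K: "\<And>i x. norm (V i x) \<le> K i * norm x" by metis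
  show "bounded_clinear (column_op V)"
  proof (rule bounded_clinear_intro[where K = "sum K UNIV"])
    show "norm (column_op V x) \<le> sum K UNIV * norm x" for x
    proof -
      have "norm (column_op V x) \<le> (\<Sum>i\<in>UNIV. norm (V i x))"
        unfolding norm_vec_def column_op_def by (rule order.trans[OF L2_set_le_sum]) simp_all
      also have "\<dots> \<le> (\<Sum>i\<in>UNIV. K i * norm x)" by (intro sum_mono K)
      finally show ?thesis by (simp add: sum_distrib_right)
    qed
  qed (use c in \<open>simp_all add: column_op_def vec_eq_iff bounded_clinear_add bounded_clinear_scale\<close>)
qed

text \<open>The square of the modulus has the squared norm of the column as its quadratic form. This
  equality of norms is the link between modulus and tuple that the polar decomposition is built
  on.\<close>

lemma spherical_modulus:
  fixes T :: "'d::finite \<Rightarrow> 'h::chilbert_space \<Rightarrow> 'h"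
  assumes T: "\<And>i. bounded_clinear (T i)"
  shows posop_spherical_modulus: "posop (spherical_modulus T)"
    and norm_spherical_modulus: "norm (spherical_modulus T x) = norm (column_op T x)"
proof -
  define S where "S x = (\<Sum>i\<in>UNIV. cadjoint (T i) (T i x))" for x
  have P: "spherical_modulus T = cfc sqrt S" by (simp add: spherical_modulus_def S_def[abs_def])
  have Sxy: "inner (S x) y = (\<Sum>i\<in>UNIV. inner (T i x) (T i y))" for x y
    unfolding S_def inner_sum_left
    by (intro sum.cong refl) (metis inner_cadjoint[OF T] inner_commute)
  have S: "posop S"
    unfolding posop_def selfadj_def
  proof (intro conjI allI)
    show "bounded_clinear S"
      unfolding S_def[abs_def] by (intro bounded_clinear_sum bounded_clinear_compose[OF bounded_clinear_cadjoint] T)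
    show "inner (S x) y = inner x (S y)" for x y
      unfolding inner_commute[of x] Sxy by (simp add: inner_commute)
    show "0 \<le> inner (S x) x" for x by (simp add: Sxy sum_nonneg)
  qed
  have sq: "continuous_on {0..} sqrt" by (intro continuous_intros)
  show pP: "posop (spherical_modulus T)" unfolding P by (rule posop_cfc[OF S sq]) simp
  have "cfc sqrt S (cfc sqrt S x) = cfc (\<lambda>r. sqrt r * sqrt r) S x" by (rule cfc_mult[OF S sq sq])
  also have "\<dots> = cfc (\<lambda>r. r) S x" by (rule cfc_cong[OF S]) (auto intro!: continuous_intros)
  also have "\<dots> = S x" by (rule cfc_ident[OF S])
  finally have "inner (cfc sqrt S x) (cfc sqrt S x) = inner (S x) x"
    using selfadj_inner[OF selfadj_cfc[OF S sq], of "cfc sqrt S x" x] by simp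
  then have "(norm (spherical_modulus T x))\<^sup>2 = (norm (column_op T x))\<^sup>2"
    unfolding norm_column_op P by (simp add: power2_norm_eq_inner Sxy)
  then show "norm (spherical_modulus T x) = norm (column_op T x)"
    by (simp add: power2_eq_iff_nonneg)
qed

text \<open>Discharges the definite description. The \<open>V i\<close> are built one at a time;
  that their column is a partial isometry comes from the equality of norms on the range of the
  modulus, extended to its closure. Uniqueness is checked on that closure and on the kernel.\<close>

lemma polar_part:
  fixes T :: "'d::finite \<Rightarrow> 'h::chilbert_space \<Rightarrow> 'h"
  assumes T: "\<And>i. bounded_clinear (T i)"
  shows bounded_clinear_polar_part: "bounded_clinear (polar_part T i)"
    and polar_part_spherical_modulus: "polar_part T i (spherical_modulus T x) = T i x"
    and polar_part_kernel: "spherical_modulus T x = 0 \<longleftrightarrow> (\<forall>i. polar_part T i x = 0)"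
proof -
  define P where "P = spherical_modulus T"
  have P: "selfadj P" unfolding P_def by (intro posop_selfadj posop_spherical_modulus T)
  note cP = selfadj_bounded_clinear[OF P]
  have nP: "norm (P x) = norm (column_op T x)" for x unfolding P_def by (rule norm_spherical_modulus[OF T])
  have le: "norm (T i x) \<le> norm (P x)" for i x
    unfolding nP using Finite_Cartesian_Product.norm_nth_le[of "column_op T x" i] by (simp add: column_op_def)
  have "\<exists>V. bounded_clinear V \<and> (\<forall>x. V (P x) = T i x) \<and> (\<forall>x. P x = 0 \<longrightarrow> V x = 0)" for i
    by (rule Douglas_factorization[OF T P le[of i]]) blast
  then obtain V where V: "\<And>i. bounded_clinear (V i)" "\<And>i x. V i (P x) = T i x" "\<And>i x. P x = 0 \<Longrightarrow> V i x = 0"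
    by metis
  have cV: "bounded_clinear (column_op V)" using V(1) by (simp add: bounded_clinear_column_op_iff)
  have iso: "norm (column_op V m) = norm m" if "m \<in> closure (range P)" for m
  proof -
    have "closed {m. norm (column_op V m) = norm m}"
      by (intro closed_Collect_eq continuous_intros bounded_clinear_continuous cV)
    moreover have "range P \<subseteq> {m. norm (column_op V m) = norm m}"
      by (auto simp: nP) (simp add: column_op_def V(2))
    ultimately show ?thesis using closure_minimal that by blast
  qed
  have ker: "P x = 0 \<longleftrightarrow> (\<forall>i. V i x = 0)" for x
  proof
    \<comment> \<open>After the kernel part of \<open>x\<close> is split off, the column of
      \<open>V\<close> still vanishes at the rest \<open>m\<close>, but there it is
      isometric.\<close>
    assume Vx: "\<forall>i. V i x = 0"
    obtain m where m: "m \<in> closure (range P)" "P (x - m) = 0" by (rule selfadj_decomposition[OF P])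
    have "V i m = 0" for i using V(3)[OF m(2), of i] Vx by (simp add: bounded_clinear_diff[OF V(1)])
    then have "column_op V m = 0" by (simp add: column_op_eq_0_iff)
    then have "m = 0" using iso[OF m(1)] by simp
    then show "P x = 0" using m(2) by simp
  qed (simp add: V(3))
  have "polar_part T = V"
    unfolding polar_part_def P_def[symmetric]
  proof (rule the_equality, intro conjI allI)
    show "partial_isometry (column_op V)"
      unfolding partial_isometry_def
    proof (intro conjI allI impI cV)
      fix x assume x: "\<forall>y. column_op V y = 0 \<longrightarrow> cinner x y = 0"
      obtain m where m: "m \<in> closure (range P)" "P (x - m) = 0" by (rule selfadj_decomposition[OF P])
      have "cinner x (x - m) = 0" using x m(2) by (simp add: column_op_eq_0_iff ker)
      then have "inner x (x - m) = 0" by (simp add: inner_eq_Re_cinner)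
      moreover have "inner m (x - m) = 0" by (rule selfadj_kernel_closure_range[OF P m(2,1)])
      ultimately have "inner (x - m) (x - m) = 0" by (simp only: inner_diff_left diff_self)
      then have "x = m" by simp
      then show "norm (column_op V x) = norm x" using iso m(1) by simp
    qed
    show "T i = V i \<circ> P" for i by (simp add: fun_eq_iff V(2))
    show "{x. column_op V x = 0} = {x. P x = 0}" by (simp add: column_op_eq_0_iff ker)
  next
    fix V' :: "'d \<Rightarrow> 'h \<Rightarrow> 'h"
    assume V': "partial_isometry (column_op V') \<and> (\<forall>i. T i = V' i \<circ> P) \<and> {x. column_op V' x = 0} = {x. P x = 0}"
    then have cV': "bounded_clinear (V' i)" for i
      using bounded_clinear_column_op_iff unfolding partial_isometry_def by blast
    have V'P: "V' i (P x) = V i (P x)" for i x using V' V(2) by (metis comp_apply)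
    have "V' i x = V i x" for i x
    proof -
      obtain m where m: "m \<in> closure (range P)" "P (x - m) = 0" by (rule selfadj_decomposition[OF P])
      have "closed {y. V' i y = V i y}"
        by (intro closed_Collect_eq bounded_clinear_continuous cV' V(1))
      moreover have "range P \<subseteq> {y. V' i y = V i y}" using V'P by blast
      ultimately have "V' i m = V i m" using closure_minimal m(1) by blast
      moreover have "column_op V' (x - m) = 0" using V' m(2) by blast
      then have "V' i (x - m) = 0" by (simp add: column_op_eq_0_iff)
      moreover have "V i (x - m) = 0" using V(3) m(2) by blast
      ultimately show ?thesis by (simp add: bounded_clinear_diff[OF cV'] bounded_clinear_diff[OF V(1)])
    qed
    then show "V' = V" by (simp add: fun_eq_iff)
  qed
  then show "bounded_clinear (polar_part T i)" "polar_part T i (spherical_modulus T x) = T i x"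
    "spherical_modulus T x = 0 \<longleftrightarrow> (\<forall>i. polar_part T i x = 0)"
    using V ker by (simp_all flip: P_def)
qed

text \<open>By convention the power 0 is the identity and not \<open>cfc\<close> of
  \<open>r powr 0\<close>, so \<open>t = 1\<close> is treated apart, through \<open>one\<close>. A
  positive exponent makes \<open>r powr t\<close> continuous at \<open>0\<close>, where it
  vanishes.\<close>

lemma op_powr:
  fixes P :: "'h::chilbert_space \<Rightarrow> 'h"
  assumes P: "posop P" and t: "0 < t" "t \<le> 1"
  shows selfadj_op_powr: "selfadj (op_powr P t)"
    and bounded_clinear_op_powr_compl: "bounded_clinear (op_powr P (1 - t))"
    and op_powr_compl_left: "op_powr P (1 - t) (op_powr P t x) = P x"
    and op_powr_compl_right: "op_powr P t (op_powr P (1 - t) x) = P x"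
    and op_powr_kernel: "op_powr P t x = 0 \<longleftrightarrow> P x = 0"
proof -
  have c: "continuous_on {0..} (\<lambda>r::real. r powr s)" if "s > 0" for s
    using that by (intro continuous_on_powr' continuous_intros) auto
  have A: "op_powr P t = cfc (\<lambda>r. r powr t) P" using t by (simp add: op_powr_def)
  show sA: "selfadj (op_powr P t)" unfolding A by (rule selfadj_cfc[OF P c[OF t(1)]])
  have prod: "cfc (\<lambda>r. r powr a) P (cfc (\<lambda>r. r powr b) P x) = P x" if "a > 0" "b > 0" "a + b = 1" for a b x
  proof -
    have "cfc (\<lambda>r. r powr a) P (cfc (\<lambda>r. r powr b) P x) = cfc (\<lambda>r. r powr a * r powr b) P x"
      by (rule cfc_mult[OF P c[OF that(1)] c[OF that(2)]])
    also have "\<dots> = cfc (\<lambda>r. r) P x"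
      using that by (intro cfc_cong[OF P] continuous_on_mult c continuous_on_id) (simp_all flip: powr_add)
    finally show ?thesis by (simp add: cfc_ident[OF P])
  qed
  have one: "cfc (\<lambda>r. r powr 1) P x = P x" for x
    using cfc_cong[OF P c[of 1], of "\<lambda>r. r" x] cfc_ident[OF P] by (simp add: continuous_on_id)
  show "bounded_clinear (op_powr P (1 - t))"
    using t bounded_clinear_cfc[OF P c[of "1 - t"]] by (cases "t = 1") (simp_all add: op_powr_def id_def bounded_clinear_ident)
  show left: "op_powr P (1 - t) (op_powr P t x) = P x" for x
    using t prod[of "1 - t" t x] one by (auto simp: op_powr_def)
  show "op_powr P t (op_powr P (1 - t) x) = P x"
    using t prod[of t "1 - t" x] one by (auto simp: op_powr_def)
  show "op_powr P t x = 0 \<longleftrightarrow> P x = 0"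
  proof
    assume "op_powr P t x = 0"
    then show "P x = 0"
      using left[of x] bounded_clinear_zero[OF \<open>bounded_clinear (op_powr P (1 - t))\<close>] by simp
  next
    assume "P x = 0"
    then show "op_powr P t x = 0" unfolding A using cfc_kernel[OF P c[OF t(1)]] by simp
  qed
qed

section \<open>The Aluthge transform\<close>

lemma fredholm_cong:
  fixes T T' :: "'d::{finite,linorder} \<Rightarrow> 'h::complex_vector \<Rightarrow> 'h"
  assumes "linear_commuting T" "linear_commuting T'" and eq: "\<And>k n. koszul_betti T k n \<longleftrightarrow> koszul_betti T' k n"
  shows "fredholm_tuple T' \<longleftrightarrow> fredholm_tuple T"
    and "fredholm_tuple T \<Longrightarrow> fredholm_index T' = fredholm_index T"
proof -
  show "fredholm_tuple T' \<longleftrightarrow> fredholm_tuple T" by (simp add: fredholm_tuple_iff eq)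
  assume fr: "fredholm_tuple T"
  define n where "n k = (SOME n. koszul_betti T k n)" for k
  have n: "koszul_betti T k (n k)" if "k \<le> CARD('d)" for k
    unfolding n_def using fr that fredholm_tuple_iff by (metis someI_ex)
  show "fredholm_index T' = fredholm_index T"
    using fredholm_index_eq[OF assms(1) n] fredholm_index_eq[OF assms(2) n[unfolded eq]] by simp
qed

theorem theorem1p2:
  fixes T :: "'d::{finite,linorder} \<Rightarrow> 'h::chilbert_space \<Rightarrow> 'h" and t :: real
  assumes "\<not> (\<exists>S :: 'h set. finite S \<and> cvs.span S = UNIV)"
    and "commuting_tuple T"
    and "0 < t" and "t \<le> 1"
  shows "taylor_essential_spectrum (aluthge t T) = taylor_essential_spectrum T \<and>
    (\<forall>l. l \<notin> taylor_essential_spectrum T \<longrightarrow>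
      fredholm_index (shift_tuple (aluthge t T) l) = fredholm_index (shift_tuple T l))"
proof -
  have T: "bounded_clinear (T i)" and comm: "T i (T j x) = T j (T i x)" for i j x
    using assms(2) by (auto simp: commuting_tuple_def fun_eq_iff)
  define P V where "P = spherical_modulus T" and "V = polar_part T"
  define A B where "A = op_powr P t" and "B = op_powr P (1 - t)"
  define W where "W i = V i \<circ> B" for i
  have pP: "posop P" unfolding P_def by (rule posop_spherical_modulus[OF T])
  note sP = posop_selfadj[OF pP]
  note cP = selfadj_bounded_clinear[OF sP]
  have V: "bounded_clinear (V i)" and VP: "V i (P x) = T i x" and kerV: "P x = 0 \<longleftrightarrow> (\<forall>i. V i x = 0)" for i x
    unfolding P_def V_def by (rule bounded_clinear_polar_part[OF T] polar_part_spherical_modulus[OF T] polar_part_kernel[OF T])+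
  have sA: "selfadj A" and cB: "bounded_clinear B" and BA: "B (A x) = P x" and AB: "A (B x) = P x"
    and kerA: "A x = 0 \<longleftrightarrow> P x = 0" for x
    unfolding A_def B_def
    by (rule selfadj_op_powr[OF pP assms(3,4)] bounded_clinear_op_powr_compl[OF pP assms(3,4)]
        op_powr_compl_left[OF pP assms(3,4)] op_powr_compl_right[OF pP assms(3,4)] op_powr_kernel[OF pP assms(3,4)])+
  have clA: "clinear A" using sA by (intro bounded_clinear_clinear selfadj_bounded_clinear)
  have W: "bounded_clinear (W i)" for i
    unfolding W_def comp_def by (rule bounded_clinear_compose[OF V cB])
  then have clW: "clinear (W i)" for i by (rule bounded_clinear_clinear)
  have TV: "T i (V j x) = T j (V i x)" for i j x
  proof -
    obtain m where m: "m \<in> closure (range P)" "P (x - m) = 0" by (rule selfadj_decomposition[OF sP])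
    have "closed {y. T i (V j y) = T j (V i y)}"
      by (intro closed_Collect_eq bounded_clinear_continuous[OF bounded_clinear_compose] T V)
    moreover have "range P \<subseteq> {y. T i (V j y) = T j (V i y)}" by (auto simp: VP comm)
    ultimately have "T i (V j m) = T j (V i m)" using closure_minimal m(1) by blast
    moreover have "V k (x - m) = 0" for k using m(2) kerV by blast
    then have "V k x = V k m" for k by (simp add: bounded_clinear_diff[OF V])
    ultimately show ?thesis by simp
  qed
  \<comment> \<open>Since \<open>B \<circ> A\<close> is \<open>P\<close> and
    \<open>V i \<circ> P\<close> is \<open>T i\<close>, the two sides are
    \<open>T i (V j (B x))\<close> and \<open>T j (V i (B x))\<close>.\<close>
  have cross: "W i (A (W j x)) = W j (A (W i x))" for i j x
    by (simp add: W_def BA VP TV[of i j])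
  have Teq: "T = (\<lambda>i. W i \<circ> A)" by (simp add: fun_eq_iff W_def BA VP)
  have Aeq: "aluthge t T = (\<lambda>i. A \<circ> W i)"
    by (simp add: fun_eq_iff aluthge_def A_def B_def W_def P_def V_def)
  have lcT: "linear_commuting T"
    unfolding linear_commuting_def using comm bounded_clinear_clinear[OF T] by blast
  have lcA: "linear_commuting (\<lambda>i. A \<circ> W i)"
    unfolding linear_commuting_def comp_def
    using bounded_clinear_clinear[OF bounded_clinear_compose[OF selfadj_bounded_clinear[OF sA] W]] cross by metis
  have main: "(fredholm_tuple (shift_tuple (aluthge t T) l) \<longleftrightarrow> fredholm_tuple (shift_tuple T l)) \<and>
    (fredholm_tuple (shift_tuple T l) \<longrightarrow>
      fredholm_index (shift_tuple (aluthge t T) l) = fredholm_index (shift_tuple T l))" for l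
  proof (cases "l = 0")
    case False
    then obtain i where i: "l $ i \<noteq> 0" by (auto simp: vec_eq_iff)
    have eq: "koszul_betti (shift_tuple T l) k n \<longleftrightarrow> koszul_betti (shift_tuple (aluthge t T) l) k n" for k n
      unfolding Aeq unfolding Teq by (rule koszul_betti_exchange[OF clA clW cross i])
    show ?thesis
      using fredholm_cong[OF linear_commuting_shift[OF lcT] linear_commuting_shift[OF lcA[folded Aeq]] eq] by blast
  next
    case True
    have sh: "shift_tuple S l = S" for S :: "'d \<Rightarrow> 'h \<Rightarrow> 'h" by (simp add: True shift_tuple_def fun_eq_iff)
    have rP: "cvs.subspace (range P)" and rA: "cvs.subspace (range A)"
      by (rule subspace_clinear_image[OF bounded_clinear_clinear[OF cP] cvs.subspace_UNIV]
          subspace_clinear_image[OF clA cvs.subspace_UNIV])+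
    have fin: "(\<exists>n. qdim {x. A x = 0} {0} n) \<and> (\<exists>q. qdim UNIV (range A) q)"
      if "fredholm_tuple T \<or> fredholm_tuple (\<lambda>i. A \<circ> W i)"
      using that
    proof
      assume fr: "fredholm_tuple T"
      note fc = fredholm_imp_finite_corank[of T V P "closure (range P)", OF fr lcT bounded_clinear_clinear[OF V]
          bounded_clinear_clinear[OF cP] VP[symmetric] TV kerV subspace_closure_range[OF cP] closure_subset
          selfadj_closure_range_inter_kernel[OF sP]]
      have dec: "\<exists>x. P x = 0 \<and> z - x \<in> closure (range P)" for z
      proof -
        obtain m where "m \<in> closure (range P)" "P (z - m) = 0" by (rule selfadj_decomposition[OF sP])
        then show ?thesis by (intro exI[of _ "z - m"]) simp
      qed
      obtain q where q: "qdim UNIV (range P) q" using fc(2) dec by blast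
      \<comment> \<open>Because \<open>P\<close> is \<open>A \<circ> B\<close>, the range of
        \<open>A\<close> lies between that of \<open>P\<close> and the whole space, so its corank is
        finite as well.\<close>
      have "range P \<subseteq> range A" by (auto simp flip: AB)
      then have "\<exists>q. qdim UNIV (range A) q"
        using qdim_split[OF rP rA cvs.subspace_UNIV _ subset_UNIV q] by metis
      then show ?thesis using fc(1) dec by (simp add: kerA)
    next
      assume fr: "fredholm_tuple (\<lambda>i. A \<circ> W i)"
      show ?thesis
        using fredholm_comp_imp_finite_corank[OF fr lcA clA selfadj_power2_ker[OF sA]] by blast
    qed
    have AT: "A (T i x) = (A \<circ> W i) (A x)" for i x by (simp add: Teq)
    note fi = fredholm_intertwine[of T "\<lambda>i. A \<circ> W i" A, OF lcT lcA clA AT]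
    show ?thesis unfolding sh Aeq using fin fi by blast
  qed
  then show ?thesis by (auto simp: taylor_essential_spectrum_def)
qed

end
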